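(* The Jacobian of each of the following five genus-$2$ curves over $\mathbb{Q}$ has a $\mathbb{Q}$-rational torsion point of order exactly $28$: \begin{align*} C_{28,1}\colon\ y^2 + (x^2 + x) y &= x^6 + 3 x^5 + 5 x^4 - 4 x^2 - 10 x + 4,\\ C_{28,2}\colon\ y^2 + (x^2 + x) y &= x^6 + 3 x^5 + 3 x^4 + 13 x^3 - 6 x^2 + 18 x,\\ C_{28,3}\colon\ y^2 + (x^2 + x) y &= 4 x^6 - 2 x^5 + 18 x^4 + 3 x^3 + 13 x^2 + 23 x - 11,\\ C_{28,4}\colon\ y^2 + (x^2 + x) y &= 28320768 x^6 + 167100960 x^5 + 213557586 x^4 - 35302844 x^3\\ &\qquad + 154134546 x^2 - 155174208 x + 40064896,\\ C_{28,5}\colon\ y^2 + (x^2 + x) y &= 25 x^6 - 455 x^5 + 1675 x^4 + 2494 x^3 + 570 x^2 - 1210 x. \end{align*}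
   Context: A genus-$2$ curve given by an affine equation $y^2 + h(x) y = f(x)$, with $\deg h \le 3$ and $\deg f\le 6$, means the smooth projective geometrically irreducible curve over $\mathbb{Q}$ with that affine model. Its Jacobian is the associated principally polarized abelian surface over $\mathbb{Q}$, and "rational" means defined over $\mathbb{Q}$. *)

theory Defs
  imports
    "HOL-Algebra.Algebraic_Closure_Type"
    "HOL-Algebra.Multiplicative_Group"
    "HOL-Computational_Algebra.Computational_Algebra"
begin

text \<open>
  Standard criterion for the smooth projective model of \<open>y\<^sup>2 + h(x) y = f(x)\<close> to be a geometrically
  irreducible curve of genus 2: the polynomial \<open>4f + h\<^sup>2\<close>, obtained by completing the square, has no
  repeated factor and has degree 5 or 6.
\<close>

definition genus_two_model :: "rat poly \<Rightarrow> rat poly \<Rightarrow> bool" where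
  "genus_two_model h f \<longleftrightarrow>
     Polynomial.degree h \<le> 3 \<and> Polynomial.degree f \<le> 6 \<and>
     5 \<le> Polynomial.degree (4 * f + h\<^sup>2) \<and> squarefree (4 * f + h\<^sup>2)"

type_synonym qbar = "rat alg_closure"

text \<open>
  The function field of the curve over the algebraic closure of \<open>\<rat>\<close> is the quotient of \<open>K[Y]\<close>, for
  \<open>K\<close> the field of rational functions in \<open>x\<close>, by the ideal generated by \<open>Y\<^sup>2 + h Y - f\<close>. A residue
  class is represented by its unique member of degree less than 2 in \<open>Y\<close>.
\<close>

type_synonym ffelem = "qbar poly fract poly"

definition base_change :: "rat poly \<Rightarrow> qbar poly fract" where
  "base_change p = to_fract (map_poly to_ac p)"

definition curve_poly :: "rat poly \<Rightarrow> rat poly \<Rightarrow> ffelem" where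
  "curve_poly h f = [:- base_change f, base_change h, 1:]"

definition function_field :: "rat poly \<Rightarrow> rat poly \<Rightarrow> ffelem ring" where
  "function_field h f =
     \<lparr>carrier = {g. Polynomial.degree g < 2},
      monoid.mult = (\<lambda>a b. (a * b) mod curve_poly h f),
      one = 1,
      zero = 0,
      add = (+)\<rparr>"

definition ff_const :: "qbar \<Rightarrow> ffelem" where
  "ff_const c = [:to_fract [:c:]:]"

definition ff_x :: ffelem where
  "ff_x = [:to_fract [:0, 1:]:]"

definition ff_y :: ffelem where
  "ff_y = [:0, 1:]"

text \<open>
  The geometric points of the smooth projective curve are the places of its function field, that
  is, the normalized (surjective onto \<open>\<int>\<close>) discrete valuations that are trivial on the constants.
  A valuation is given the value 0 wherever it is undefined (at the zero element and outside the
  function field), so that a place corresponds to exactly one HOL function.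
\<close>

definition places :: "rat poly \<Rightarrow> rat poly \<Rightarrow> (ffelem \<Rightarrow> int) set" where
  "places h f =
     (let L = function_field h f; U = carrier L - {\<zero>\<^bsub>L\<^esub>} in
       {v. (\<forall>a\<in>U. \<forall>b\<in>U. v (a \<otimes>\<^bsub>L\<^esub> b) = v a + v b) \<and>
           (\<forall>a\<in>U. \<forall>b\<in>U. a \<oplus>\<^bsub>L\<^esub> b \<in> U \<longrightarrow> min (v a) (v b) \<le> v (a \<oplus>\<^bsub>L\<^esub> b)) \<and>
           (\<forall>c. c \<noteq> 0 \<longrightarrow> v (ff_const c) = 0) \<and>
           v ` U = UNIV \<and>
           (\<forall>a. a \<notin> U \<longrightarrow> v a = 0)})"

type_synonym divisor = "(ffelem \<Rightarrow> int) \<Rightarrow> int"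

definition degree_zero_divisors :: "rat poly \<Rightarrow> rat poly \<Rightarrow> divisor monoid" where
  "degree_zero_divisors h f =
     \<lparr>carrier = {D. finite {v. D v \<noteq> 0} \<and> {v. D v \<noteq> 0} \<subseteq> places h f \<and> (\<Sum>v | D v \<noteq> 0. D v) = 0},
      monoid.mult = (\<lambda>D E v. D v + E v),
      one = (\<lambda>_. 0)\<rparr>"

text \<open>
  Intersecting with the divisors of degree zero does not exclude any \<open>g\<close>: the divisor of a nonzero
  function has finite support and degree zero.
\<close>

definition principal_divisors :: "rat poly \<Rightarrow> rat poly \<Rightarrow> divisor set" where
  "principal_divisors h f =
     {D \<in> carrier (degree_zero_divisors h f).
        \<exists>g \<in> carrier (function_field h f) - {\<zero>\<^bsub>function_field h f\<^esub>}.
          \<forall>v \<in> places h f. D v = v g}"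

text \<open>
  The group of geometric points of the Jacobian, as the group of degree-zero divisor classes of the
  curve over the algebraic closure of \<open>\<rat>\<close>.
\<close>

definition jacobian :: "rat poly \<Rightarrow> rat poly \<Rightarrow> divisor set monoid" where
  "jacobian h f = degree_zero_divisors h f Mod principal_divisors h f"

definition absolute_galois :: "(qbar \<Rightarrow> qbar) set" where
  "absolute_galois =
     {\<sigma>. bij \<sigma> \<and> (\<forall>a b. \<sigma> (a + b) = \<sigma> a + \<sigma> b) \<and> (\<forall>a b. \<sigma> (a * b) = \<sigma> a * \<sigma> b) \<and>
         (\<forall>q. \<sigma> (to_ac q) = to_ac q)}"

text \<open>
  The action of the absolute Galois group on the function field through the coefficients: each
  \<open>\<sigma>\<close> has exactly one extension to an automorphism that fixes \<open>x\<close> and \<open>y\<close>.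
\<close>

definition galois_lifts :: "rat poly \<Rightarrow> rat poly \<Rightarrow> (ffelem \<Rightarrow> ffelem) set" where
  "galois_lifts h f =
     {\<phi> \<in> ring_iso (function_field h f) (function_field h f).
        \<phi> ff_x = ff_x \<and> \<phi> ff_y = ff_y \<and>
        (\<exists>\<sigma>\<in>absolute_galois. \<forall>c. \<phi> (ff_const c) = ff_const (\<sigma> c))}"

text \<open>
  An automorphism \<open>\<phi>\<close> sends the place \<open>v\<close> to \<open>v \<circ> \<phi>\<^sup>-\<^sup>1\<close>, so the coefficient of the transformed divisor
  at \<open>v\<close> is the coefficient of \<open>D\<close> at \<open>v \<circ> \<phi>\<close> (set to 0 outside the function field).
\<close>

definition act_divisor ::
  "rat poly \<Rightarrow> rat poly \<Rightarrow> (ffelem \<Rightarrow> ffelem) \<Rightarrow> divisor \<Rightarrow> divisor" where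
  "act_divisor h f \<phi> D =
     (\<lambda>v. if v \<in> places h f
           then D (\<lambda>a. if a \<in> carrier (function_field h f) then v (\<phi> a) else 0)
           else 0)"

text \<open>
  A rational point of the Jacobian is a Galois-invariant divisor class; the class need not contain
  a Galois-invariant divisor.
\<close>

definition jacobian_rational_points :: "rat poly \<Rightarrow> rat poly \<Rightarrow> divisor set set" where
  "jacobian_rational_points h f =
     {P \<in> carrier (jacobian h f). \<forall>\<phi>\<in>galois_lifts h f. act_divisor h f \<phi> ` P = P}"

end

(*
  Put Y = 2 y + h and F = 4 f + h^2, so that Y^2 = F, where F has degree 6. For polynomials u, v
  over the rationals with u | F - v^2 and deg u = 2 d, let D(u, v) be the sum of the points with
  u(x) = 0, Y = v(x), minus d times the sum of the two points at infinity. If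
  a^2 - b^2 F = c u^n, the degrees of a and b are small enough and a - b v is prime to u, then
  a + b Y has divisor n D(u, v). For each curve such functions are exhibited for a divisor D4 with
  n = 4 and a divisor D7 with n = 7, and the class of D4 + D7 has order 28: the functions with at
  most simple poles, all of them at infinity, are the polynomials of degree at most 1 in x, which
  rules out that 2 D4 or D7 is principal.

  Places are constructed by the embeddings of the function field into Laurent series in t given by
  x = r + t^2 and x = t^(-2); F(x) has even order there and is therefore a square. At an
  unramified value of x, the residue of Y determines the place.
*)
theory Submission
  imports Defs
begin

section \<open>Coordinates on the function field\<close>

text \<open>Splitting 28 as 4 * 7 keeps the exhibited functions small. For D4 the source is a
  factorization F = q A: a function q a1 + b0 Y has divisor 2 D4 plus the two branch points over the
  roots of q minus the two infinite points, so its square divided by q has divisor 4 D4. These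
  branch points are what keeps 2 D4 from being principal.

  The obstacle is that points are abstract valuations, with no list of them at hand. Values are
  therefore found through norms: w(a + b Y) + w(a - b Y) is the value of a polynomial in x, known
  from orders of roots or from a degree, and the residue of Y decides how the sum is shared. This
  needs a nonzero residue, so the supports avoid the branch points, and degree 6 makes infinity
  unramified as well. Above a branch point the existence of a place suffices. Since divisors have
  degree zero by definition, the places in the supports must also be counted exactly. Rationality is
  cheap: D4 and D7 are themselves Galois invariant.\<close>

lemma map_poly_hom_add:
  assumes "f 0 = 0" "\<And>x y. f (x + y) = f x + f y"
  shows "map_poly f (p + q) = map_poly f p + map_poly f q"
  by (rule poly_eqI) (simp add: coeff_map_poly assms)

lemma map_poly_hom_uminus:
  assumes "f 0 = 0" "\<And>x. f (- x) = - f x"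
  shows "map_poly f (- p) = - map_poly f p"
  by (rule poly_eqI) (simp add: coeff_map_poly assms)

lemma map_poly_hom_mult:
  fixes f :: "'a::comm_semiring_1 \<Rightarrow> 'b::comm_semiring_1"
  assumes f: "f 0 = 0" "\<And>x y. f (x + y) = f x + f y" "\<And>x y. f (x * y) = f x * f y"
  shows "map_poly f (p * q) = map_poly f p * map_poly f q"
proof (induction p)
  case (pCons a p)
  have "map_poly f (smult a q) = smult (f a) (map_poly f q)"
    by (rule map_poly_smult) (simp_all add: f)
  then show ?case
    using pCons by (simp add: map_poly_hom_add map_poly_pCons f)
qed simp

section \<open>Base change of rational polynomials to the algebraic closure\<close>

definition base_poly :: "rat poly \<Rightarrow> qbar poly" where
  "base_poly p = map_poly to_ac p"

lemma base_poly_0 [simp]: "base_poly 0 = 0"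
  by (simp add: base_poly_def)

lemma base_poly_pCons [simp]: "base_poly (pCons a p) = pCons (to_ac a) (base_poly p)"
  by (simp add: base_poly_def map_poly_pCons)

lemma base_poly_1 [simp]: "base_poly 1 = 1"
  by (simp add: base_poly_def)

lemma base_poly_add [simp]: "base_poly (p + q) = base_poly p + base_poly q"
  by (simp add: base_poly_def map_poly_hom_add)

lemma base_poly_uminus [simp]: "base_poly (- p) = - base_poly p"
  by (simp add: base_poly_def map_poly_hom_uminus)

lemma base_poly_diff [simp]: "base_poly (p - q) = base_poly p - base_poly q"
  using base_poly_add[of p "- q"] by simp

lemma base_poly_mult [simp]: "base_poly (p * q) = base_poly p * base_poly q"
  by (simp add: base_poly_def map_poly_hom_mult)

lemma base_poly_power [simp]: "base_poly (p ^ n) = base_poly p ^ n"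
  by (induction n) simp_all

lemma base_poly_smult [simp]: "base_poly (smult c p) = smult (to_ac c) (base_poly p)"
  by (simp add: base_poly_def map_poly_smult)

lemma base_poly_numeral [simp]: "base_poly (numeral n) = numeral n"
  by (simp add: numeral_poly)

lemma base_poly_eq_0_iff [simp]: "base_poly p = 0 \<longleftrightarrow> p = 0"
  by (auto simp: base_poly_def map_poly_eq_0_iff)

lemma degree_base_poly [simp]: "degree (base_poly p) = degree p"
  by (simp add: base_poly_def degree_map_poly)

lemma base_poly_pderiv: "base_poly (pderiv p) = pderiv (base_poly p)"
  by (rule poly_eqI) (simp add: base_poly_def coeff_map_poly coeff_pderiv del: of_nat_Suc)

lemma base_change_conv: "base_change p = to_fract (base_poly p)"
  by (simp add: base_change_def base_poly_def)

lemma to_fract_power [simp]: "to_fract (p ^ n) = to_fract p ^ n"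
  by (induction n) simp_all

lemma to_fract_numeral [simp]: "to_fract (numeral n) = numeral n"
proof -
  have "to_fract (of_nat m) = (of_nat m :: 'a fract)" for m
    by (induction m) simp_all
  from this[of "numeral n"] show ?thesis by simp
qed

lemma numeral_fract_neq_0 [simp]: "(numeral n :: 'a::{idom,ring_char_0} fract) \<noteq> 0"
proof -
  have "to_fract (numeral n :: 'a) \<noteq> 0"
    by (simp only: to_fract_eq_0_iff) simp
  then show ?thesis by simp
qed

text \<open>
  In terms of \<open>Y = 2 y + h\<close>, for which \<open>Y\<^sup>2 = 4 f + h\<^sup>2\<close>, the element \<open>ff_elem h a b\<close> is \<open>a + b Y\<close>.
\<close>

definition ff_elem :: "rat poly \<Rightarrow> qbar poly fract \<Rightarrow> qbar poly fract \<Rightarrow> ffelem" where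
  "ff_elem h a b = [:a + b * base_change h, 2 * b:]"

lemma ff_elem_eq_iff [simp]: "ff_elem h a b = ff_elem h c d \<longleftrightarrow> a = c \<and> b = d"
  by (auto simp: ff_elem_def)

lemma ff_elem_eq_0_iff [simp]: "ff_elem h a b = 0 \<longleftrightarrow> a = 0 \<and> b = 0"
  by (auto simp: ff_elem_def)

lemma ff_elem_0_0 [simp]: "ff_elem h 0 0 = 0"
  by simp

lemma carrier_eq: "carrier (function_field h f) = {ff_elem h a b | a b. True}"
proof -
  have "\<exists>a b. g = ff_elem h a b" if "degree g < 2" for g :: ffelem
  proof -
    define c d where "c = coeff g 0" and "d = coeff g 1"
    have g: "g = [:c, d:]"
      using that by (intro poly_eqI) (auto simp: c_def d_def coeff_pCons coeff_eq_0 split: nat.splits)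
    \<comment> \<open>Solves c + d y = a + b (2 y + h) for a and b.\<close>
    then have "g = ff_elem h (c - d / 2 * base_change h) (d / 2)"
      by (simp add: ff_elem_def)
    then show ?thesis by blast
  qed
  then show ?thesis
    by (auto simp: function_field_def ff_elem_def degree_pCons_eq_if)
qed

lemma elem_carrier [simp]: "ff_elem h a b \<in> carrier (function_field h f)"
  by (auto simp: carrier_eq)

lemma zero_function_field [simp]: "\<zero>\<^bsub>function_field h f\<^esub> = 0"
  by (simp add: function_field_def)

lemma add_elem [simp]:
  "ff_elem h a b \<oplus>\<^bsub>function_field h f\<^esub> ff_elem h c d = ff_elem h (a + c) (b + d)"
  by (simp add: function_field_def ff_elem_def algebra_simps)

lemma ff_const_elem: "ff_const c = ff_elem h (to_fract [:c:]) 0"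
  by (simp add: ff_const_def ff_elem_def)

lemma ff_x_elem: "ff_x = ff_elem h (to_fract [:0, 1:]) 0"
  by (simp add: ff_x_def ff_elem_def)

lemma ff_y_elem: "ff_y = ff_elem h (- base_change h / 2) (1 / 2)"
  by (simp add: ff_y_def ff_elem_def)

text \<open>Separability is a Bezout identity over the rationals because such an identity passes to
  \<open>qbar\<close> coefficientwise and there shows that all roots are simple. With degree 6 there
  are two distinct points at infinity.\<close>

locale hyperelliptic =
  fixes h f F :: "rat poly"
  assumes F_eq: "F = 4 * f + h\<^sup>2"
    and degree_F: "degree F = 6"
    and bezout: "\<exists>S T. S * F + T * pderiv F = 1"
begin

definition FK :: "qbar poly fract" where
  "FK = to_fract (base_poly F)"

abbreviation E where "E \<equiv> ff_elem h"
abbreviation L where "L \<equiv> function_field h f"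
abbreviation P where "P \<equiv> places h f"

lemma mult_elem [simp]:
  "E a b \<otimes>\<^bsub>L\<^esub> E c d = E (a * c + b * d * FK) (a * d + b * c)"
proof -
  define H where "H = base_change h"
  define C where "C = curve_poly h f"
  have FK: "FK = 4 * base_change f + H\<^sup>2"
  proof -
    have "FK = to_fract (base_poly (4 * f + h\<^sup>2))"
      unfolding F_eq[symmetric] FK_def ..
    then show ?thesis
      by (simp add: base_change_conv H_def)
  qed
  have C: "C = [:- base_change f, H, 1:]"
    by (simp add: C_def curve_poly_def H_def)
  \<comment> \<open>As polynomials in y, Y^2 = 4 C + FK, so the product leaves the quotient 4 b
    d.\<close>
  have *: "E a b * E c d = E (a * c + b * d * FK) (a * d + b * c) + C * [:4 * b * d:]"
    by (simp add: ff_elem_def C FK H_def[symmetric] algebra_simps power2_eq_square)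
  have "degree (E (a * c + b * d * FK) (a * d + b * c)) < degree C"
    by (simp add: ff_elem_def C degree_pCons_eq_if)
  then have "(E a b * E c d) mod C = E (a * c + b * d * FK) (a * d + b * c)"
    unfolding * mod_mult_self2 by (rule mod_poly_less)
  then show ?thesis
    unfolding function_field_def C_def by (simp only: monoid.select_convs)
qed

end

section \<open>Valuations\<close>

context hyperelliptic
begin

definition \<Phi> :: "qbar poly" where
  "\<Phi> = base_poly F"

lemma FK_eq: "FK = to_fract \<Phi>"
  by (simp add: FK_def \<Phi>_def)

lemma degree_\<Phi>: "degree \<Phi> = 6"
  by (simp add: \<Phi>_def degree_F)

lemma \<Phi>_nonzero [simp]: "\<Phi> \<noteq> 0"
  using degree_\<Phi> by auto

lemma order_root_\<Phi>:
  assumes "poly \<Phi> r = 0"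
  shows "order r \<Phi> = 1"
proof -
  obtain S T where "S * F + T * pderiv F = 1"
    using bezout by blast
  then have "base_poly (S * F + T * pderiv F) = 1" by simp
  then have "base_poly S * \<Phi> + base_poly T * pderiv \<Phi> = 1"
    by (simp add: base_poly_pderiv \<Phi>_def)
  then have "poly (base_poly S * \<Phi> + base_poly T * pderiv \<Phi>) r = 1" by simp
  with assms have *: "poly (pderiv \<Phi>) r \<noteq> 0" by auto
  have "order r \<Phi> \<noteq> 0"
    using assms order_root[of \<Phi> r] by simp
  then have "order r \<Phi> = Suc (order r (pderiv \<Phi>))"
    using assms by (intro order_pderiv) auto
  then show ?thesis using * by (simp add: order_0I)
qed

text \<open>At a root of \<Phi>, which is simple, a^2 has even order and b^2 F odd order. So F is
  not a square in K and the function field is a field.\<close>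

lemma norm_nonzero:
  assumes "a \<noteq> 0 \<or> b \<noteq> 0"
  shows "a\<^sup>2 - b\<^sup>2 * FK \<noteq> 0"
proof
  assume eq: "a\<^sup>2 - b\<^sup>2 * FK = 0"
  then have b: "b \<noteq> 0" using assms by auto
  with eq have eq': "(a / b)\<^sup>2 = to_fract \<Phi>"
    by (simp add: FK_eq field_simps)
  obtain p q where pq: "a / b = Fract p q" "q \<noteq> 0"
    by (cases "a / b") auto
  with eq' have "to_fract (p\<^sup>2) = to_fract (\<Phi> * q\<^sup>2)"
    by (simp add: Fract_conv_to_fract field_simps)
  then have pq2: "p\<^sup>2 = \<Phi> * q\<^sup>2"
    by (simp only: to_fract_eq_iff)
  then have p: "p \<noteq> 0" using pq(2) by auto
  obtain r where r: "poly \<Phi> r = 0"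
    using alg_closed_imp_poly_has_root[of \<Phi>] degree_\<Phi> by auto
  have "order r (p\<^sup>2) = 2 * order r p"
    using p by (simp add: power2_eq_square order_mult)
  moreover have "order r (\<Phi> * q\<^sup>2) = 1 + 2 * order r q"
    using pq(2) by (simp add: power2_eq_square order_mult order_root_\<Phi>[OF r])
  ultimately have "2 * order r p = 1 + 2 * order r q"
    using pq2 by metis
  then show False by presburger
qed

lemma inverse_exists:
  assumes ab: "a \<noteq> 0 \<or> b \<noteq> 0"
  shows "\<exists>c d. (c \<noteq> 0 \<or> d \<noteq> 0) \<and> a * c + b * d * FK = 1 \<and> a * d + b * c = 0"
proof -
  define N where "N = a\<^sup>2 - b\<^sup>2 * FK"
  have N: "N \<noteq> 0" unfolding N_def by (rule norm_nonzero[OF ab])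
  have "a * (a / N) + b * (- b / N) * FK = (a\<^sup>2 - b\<^sup>2 * FK) / N"
    by (simp add: power2_eq_square diff_divide_distrib)
  then have "a * (a / N) + b * (- b / N) * FK = 1" "a * (- b / N) + b * (a / N) = 0"
    using N by (simp_all add: N_def[symmetric])
  moreover have "a / N \<noteq> 0 \<or> - b / N \<noteq> 0" using ab N by auto
  ultimately show ?thesis by blast
qed

text \<open>
  Every place takes the value 0 at the zero element; \<open>integral w\<close> and \<open>vanishing w\<close> give it the
  value infinity instead, so that they describe the valuation ring and its maximal ideal.
\<close>

definition integral :: "(ffelem \<Rightarrow> int) \<Rightarrow> qbar poly fract \<Rightarrow> qbar poly fract \<Rightarrow> bool" where
  "integral w a b \<longleftrightarrow> a = 0 \<and> b = 0 \<or> 0 \<le> w (E a b)"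

definition vanishing :: "(ffelem \<Rightarrow> int) \<Rightarrow> qbar poly fract \<Rightarrow> qbar poly fract \<Rightarrow> bool" where
  "vanishing w a b \<longleftrightarrow> a = 0 \<and> b = 0 \<or> 0 < w (E a b)"

abbreviation wx :: "(ffelem \<Rightarrow> int) \<Rightarrow> qbar poly \<Rightarrow> int" where
  "wx w p \<equiv> w (E (to_fract p) 0)"

lemma placesI:
  assumes "\<And>a b c d. a \<noteq> 0 \<or> b \<noteq> 0 \<Longrightarrow> c \<noteq> 0 \<or> d \<noteq> 0 \<Longrightarrow>
             w (E (a * c + b * d * FK) (a * d + b * c)) = w (E a b) + w (E c d)"
    and "\<And>a b c d. a \<noteq> 0 \<or> b \<noteq> 0 \<Longrightarrow> c \<noteq> 0 \<or> d \<noteq> 0 \<Longrightarrow> a + c \<noteq> 0 \<or> b + d \<noteq> 0 \<Longrightarrow>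
             min (w (E a b)) (w (E c d)) \<le> w (E (a + c) (b + d))"
    and "\<And>c. c \<noteq> 0 \<Longrightarrow> wx w [:c:] = 0"
    and "\<And>n. \<exists>a b. (a \<noteq> 0 \<or> b \<noteq> 0) \<and> w (E a b) = n"
    and "w 0 = 0"
    and "\<And>g. g \<notin> carrier L \<Longrightarrow> w g = 0"
  shows "w \<in> P"
proof -
  have surj: "w ` (carrier L - {0}) = UNIV"
  proof (intro equalityI subset_UNIV subsetI)
    fix n
    obtain a b where "a \<noteq> 0 \<or> b \<noteq> 0" "w (E a b) = n" using assms(4) by blast
    then show "n \<in> w ` (carrier L - {0})"
      by (intro image_eqI[of _ _ "E a b"]) auto
  qed
  have m: "w (x \<otimes>\<^bsub>L\<^esub> y) = w x + w y" if "x \<in> carrier L - {0}" "y \<in> carrier L - {0}" for x y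
    using that by (auto simp: carrier_eq assms(1))
  have a: "min (w x) (w y) \<le> w (x \<oplus>\<^bsub>L\<^esub> y)"
    if xy_in: "x \<in> carrier L - {0}" "y \<in> carrier L - {0}" "x \<oplus>\<^bsub>L\<^esub> y \<in> carrier L - {0}" for x y
  proof -
    obtain a b c d where xy: "x = E a b" "y = E c d"
      using xy_in by (auto simp: carrier_eq)
    show ?thesis using xy_in assms(2)[of a b c d] by (auto simp: xy)
  qed
  show ?thesis
    unfolding places_def Let_def using m a surj assms(3,5,6)
    by (auto simp: ff_const_elem[of _ h])
qed

context
  fixes w assumes w: "w \<in> P"
begin

lemma place_mult:
  assumes "a \<noteq> 0 \<or> b \<noteq> 0" "c \<noteq> 0 \<or> d \<noteq> 0"
  shows "w (E (a * c + b * d * FK) (a * d + b * c)) = w (E a b) + w (E c d)"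
proof -
  have "\<forall>x\<in>carrier L - {0}. \<forall>y\<in>carrier L - {0}. w (x \<otimes>\<^bsub>L\<^esub> y) = w x + w y"
    using w by (simp add: places_def Let_def)
  then have "w (E a b \<otimes>\<^bsub>L\<^esub> E c d) = w (E a b) + w (E c d)"
    using assms by (metis DiffI elem_carrier ff_elem_eq_0_iff singletonD)
  then show ?thesis by simp
qed

lemma place_add:
  assumes "a \<noteq> 0 \<or> b \<noteq> 0" "c \<noteq> 0 \<or> d \<noteq> 0" "a + c \<noteq> 0 \<or> b + d \<noteq> 0"
  shows "min (w (E a b)) (w (E c d)) \<le> w (E (a + c) (b + d))"
proof -
  have "\<forall>x\<in>carrier L - {0}. \<forall>y\<in>carrier L - {0}. x \<oplus>\<^bsub>L\<^esub> y \<in> carrier L - {0} \<longrightarrow>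
          min (w x) (w y) \<le> w (x \<oplus>\<^bsub>L\<^esub> y)"
    using w by (simp add: places_def Let_def)
  moreover have "E a b \<in> carrier L - {0}" "E c d \<in> carrier L - {0}"
    "E a b \<oplus>\<^bsub>L\<^esub> E c d \<in> carrier L - {0}"
    using assms by auto
  ultimately show ?thesis by (metis add_elem)
qed

lemma place_const: "c \<noteq> 0 \<Longrightarrow> wx w [:c:] = 0"
  using w by (simp add: places_def Let_def ff_const_elem[of _ h])

lemma place_zero: "w 0 = 0"
  using w by (simp add: places_def Let_def)

lemma place_outside: "g \<notin> carrier L \<Longrightarrow> w g = 0"
  using w by (simp add: places_def Let_def)

lemma place_surj: "\<exists>a b. (a \<noteq> 0 \<or> b \<noteq> 0) \<and> w (E a b) = n"
proof -
  have "w ` (carrier L - {0}) = UNIV"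
    using w by (simp add: places_def Let_def)
  then have "n \<in> w ` (carrier L - {0})" by simp
  then obtain g where g: "g \<in> carrier L - {0}" "w g = n" by (elim imageE) simp
  then obtain a b where "g = E a b" by (auto simp: carrier_eq)
  with g show ?thesis by (intro exI[of _ a] exI[of _ b]) auto
qed

text \<open>The main tool for values: the norm lies in K, where values come from roots and degrees,
  so only the split between the two conjugates remains to be found.\<close>

lemma place_norm:
  assumes "a \<noteq> 0 \<or> b \<noteq> 0"
  shows "w (E a b) + w (E a (- b)) = w (E (a\<^sup>2 - b\<^sup>2 * FK) 0)"
  using place_mult[of a b a "- b"] assms by (simp add: power2_eq_square algebra_simps)

lemma place_scale:
  assumes "c \<noteq> 0" "a \<noteq> 0 \<or> b \<noteq> 0"
  shows "w (E (c * a) (c * b)) = w (E c 0) + w (E a b)"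
  using place_mult[of c 0 a b] assms by simp

lemma integral_add: "integral w a b \<Longrightarrow> integral w c d \<Longrightarrow> integral w (a + c) (b + d)"
  using place_add[of a b c d] place_zero unfolding integral_def
  by (cases "a = 0 \<and> b = 0"; cases "c = 0 \<and> d = 0"; cases "a + c = 0 \<and> b + d = 0") auto

lemma vanishing_add: "vanishing w a b \<Longrightarrow> vanishing w c d \<Longrightarrow> vanishing w (a + c) (b + d)"
  using place_add[of a b c d] place_zero unfolding vanishing_def
  by (cases "a = 0 \<and> b = 0"; cases "c = 0 \<and> d = 0"; cases "a + c = 0 \<and> b + d = 0") auto

lemma integral_mult:
  assumes "integral w a b" "integral w c d"
  shows "integral w (a * c + b * d * FK) (a * d + b * c)"
proof (cases "(a = 0 \<and> b = 0) \<or> (c = 0 \<and> d = 0)")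
  case False
  then have "a \<noteq> 0 \<or> b \<noteq> 0" "c \<noteq> 0 \<or> d \<noteq> 0" by auto
  with assms place_mult[OF this] show ?thesis by (auto simp: integral_def)
qed (auto simp: integral_def)

lemma vanishing_mult:
  assumes "vanishing w a b" "integral w c d"
  shows "vanishing w (a * c + b * d * FK) (a * d + b * c)"
proof (cases "(a = 0 \<and> b = 0) \<or> (c = 0 \<and> d = 0)")
  case False
  then have "a \<noteq> 0 \<or> b \<noteq> 0" "c \<noteq> 0 \<or> d \<noteq> 0" by auto
  with assms place_mult[OF this] show ?thesis by (auto simp: integral_def vanishing_def)
qed (auto simp: vanishing_def)

lemma vanishing_imp_integral: "vanishing w a b \<Longrightarrow> integral w a b"
  by (auto simp: vanishing_def integral_def)

lemma place_1: "w (E 1 0) = 0"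
  using place_const[of 1] by (simp flip: one_pCons)

lemma place_minus: "w (E (- a) (- b)) = w (E a b)"
proof (cases "a = 0 \<and> b = 0")
  case False
  have "wx w [:- 1:] = 0" by (rule place_const) simp
  moreover have "to_fract [:- 1 :: qbar:] = - 1"
    by (metis minus_pCons one_pCons to_fract_1 to_fract_uminus minus_zero)
  ultimately show ?thesis
    using place_mult[of "- 1" 0 a b] False by simp
qed simp

lemma vanishing_minus: "vanishing w a b \<Longrightarrow> vanishing w (- a) (- b)"
  by (auto simp: vanishing_def place_minus)

lemma integral_minus: "integral w a b \<Longrightarrow> integral w (- a) (- b)"
  by (auto simp: integral_def place_minus)

lemma place_eq_0_iff:
  assumes "integral w a b" "a \<noteq> 0 \<or> b \<noteq> 0"
  shows "w (E a b) = 0 \<longleftrightarrow> \<not> vanishing w a b"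
  using assms by (auto simp: integral_def vanishing_def)

lemma integral_poly_mult:
  "integral w (to_fract p) 0 \<Longrightarrow> integral w (to_fract q) 0 \<Longrightarrow> integral w (to_fract (p * q)) 0"
  using integral_mult[of "to_fract p" 0 "to_fract q" 0] by simp

lemma integral_const [simp]: "integral w (to_fract [:c:]) 0"
  by (cases "c = 0") (simp_all add: integral_def place_const)

lemma wx_mult:
  assumes "p \<noteq> 0" "q \<noteq> 0"
  shows "wx w (p * q) = wx w p + wx w q"
  using place_mult[of "to_fract p" 0 "to_fract q" 0] assms by simp

lemma wx_power:
  assumes "p \<noteq> 0"
  shows "wx w (p ^ n) = int n * wx w p"
proof (induction n)
  case 0
  then show ?case by (simp add: place_1)
next
  case (Suc n)
  then show ?case using wx_mult[of p "p ^ n"] assms by (simp add: algebra_simps)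
qed

lemma wx_smult: "c \<noteq> 0 \<Longrightarrow> wx w (smult c p) = wx w p"
  using wx_mult[of "[:c:]" p] by (cases "p = 0") (simp_all add: place_const)

end

end

section \<open>Laurent series\<close>

text \<open>Split off t^(2 m); the remaining unit power series has a square root because its
  constant term has one and 2 is invertible.\<close>

lemma fls_square_root_exists:
  fixes g :: "'a::{alg_closed_field,field_char_0} fls"
  assumes "g \<noteq> 0" "even (fls_subdegree g)"
  shows "\<exists>s. s\<^sup>2 = g"
proof -
  define b where "b = fls_base_factor_to_fps g"
  have b0: "b $ 0 \<noteq> 0"
    using assms(1) by (simp add: b_def fls_base_factor_to_fps_base)
  obtain c where c: "c\<^sup>2 = b $ 0"
    using nth_root_exists[of 2 "b $ 0"] by auto
  define s where "s = fps_radical (\<lambda>_ _. c) (Suc 1) b"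
  have "s ^ Suc 1 = b"
    unfolding s_def using power_radical[OF b0, of "\<lambda>_ _. c" 1] c by (simp add: numeral_2_eq_2)
  then have s: "s * s = b" by simp
  obtain m where m: "fls_subdegree g = m + m"
    using assms(2) by (auto elim!: evenE)
  have "(fps_to_fls s * fls_X_intpow m)\<^sup>2 = fps_to_fls (s * s) * (fls_X_intpow m * fls_X_intpow m)"
    by (simp only: power2_eq_square fls_times_fps_to_fls mult.assoc mult.left_commute)
  also have "\<dots> = fls_base_factor g * fls_X_intpow (fls_subdegree g)"
    by (simp only: s b_def fls_X_intpow_times_fls_X_intpow m)
       (simp add: assms(1))
  also have "\<dots> = g"
    by (rule fls_base_factor_X_power_decompose(1)[symmetric])
  finally show ?thesis by blast
qed

definition fls_eval :: "'a::field fls \<Rightarrow> 'a poly \<Rightarrow> 'a fls" where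
  "fls_eval \<tau> p = poly (map_poly fls_const p) \<tau>"

lemma fls_eval_simps [simp]:
  "fls_eval \<tau> 0 = 0" "fls_eval \<tau> 1 = 1" "fls_eval \<tau> [:c:] = fls_const c"
  "fls_eval \<tau> [:0, 1:] = \<tau>" "fls_eval \<tau> [:c, 1:] = fls_const c + \<tau>"
  by (simp_all add: fls_eval_def map_poly_pCons)

lemma fls_eval_add [simp]: "fls_eval \<tau> (p + q) = fls_eval \<tau> p + fls_eval \<tau> q"
  by (simp add: fls_eval_def map_poly_hom_add fls_plus_const)

lemma fls_eval_mult [simp]: "fls_eval \<tau> (p * q) = fls_eval \<tau> p * fls_eval \<tau> q"
  by (simp add: fls_eval_def map_poly_hom_mult fls_plus_const)

text \<open>Applied to the value group of a Laurent embedding. In the embeddings used, e is 2 at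
  unramified points, where all series are even in t, and 1 at branch points; taking the generator
  avoids the case distinction.\<close>

lemma int_subgroup_cyclic:
  fixes G :: "int set"
  assumes diff: "\<And>m n. m \<in> G \<Longrightarrow> n \<in> G \<Longrightarrow> m - n \<in> G" and "n \<in> G" "n \<noteq> 0"
  shows "\<exists>e>0. G = {k * e | k. True}"
proof -
  have zero: "0 \<in> G" using diff[OF assms(2) assms(2)] by simp
  have neg: "- m \<in> G" if "m \<in> G" for m using diff[OF zero that] by simp
  have "\<exists>m::nat. 0 < m \<and> int m \<in> G"
    using assms(2,3) neg[OF assms(2)] by (intro exI[of _ "nat \<bar>n\<bar>"]) (auto simp: abs_if)
  define e where "e = (LEAST m::nat. 0 < m \<and> int m \<in> G)"
  have e: "0 < e" "int e \<in> G"
    using LeastI_ex[OF \<open>\<exists>m::nat. 0 < m \<and> int m \<in> G\<close>] by (auto simp: e_def)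
  have nat_mult: "int k * int e \<in> G" for k
  proof (induction k)
    case (Suc k)
    then show ?case using diff[OF Suc neg[OF e(2)]] by (simp add: algebra_simps)
  qed (simp add: zero)
  have mult: "k * int e \<in> G" for k
    using nat_mult[of "nat k"] neg[OF nat_mult[of "nat (- k)"]] by (cases "k \<ge> 0") auto
  have "\<exists>k. m = k * int e" if m: "m \<in> G" for m
  proof -
    have "m mod int e \<in> G"
      using diff[OF m mult[of "m div int e"]] by (simp add: minus_div_mult_eq_mod)
    moreover have "0 \<le> m mod int e" "m mod int e < int e" using e(1) by auto
    ultimately have "m mod int e = 0"
      using not_less_Least[of "nat (m mod int e)" "\<lambda>m. 0 < m \<and> int m \<in> G"]
      by (auto simp: e_def[symmetric] nat_less_iff)
    then show ?thesis by (metis dvd_def mod_0_imp_dvd mult.commute)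
  qed
  with mult e(1) show ?thesis by (intro exI[of _ "int e"]) auto
qed

text \<open>Over an algebraically closed field p splits into linear factors, so the parity has to be
  known only for \<tau> - c. Nonvanishing says that \<tau> is transcendental over the
  constants.\<close>

lemma fls_eval_even_subdegree:
  fixes \<tau> :: "'a::alg_closed_field fls"
  assumes \<tau>: "\<And>c. \<tau> - fls_const c \<noteq> 0 \<and> even (fls_subdegree (\<tau> - fls_const c))"
    and "p \<noteq> 0"
  shows "fls_eval \<tau> p \<noteq> 0 \<and> even (fls_subdegree (fls_eval \<tau> p))"
  using \<open>p \<noteq> 0\<close>
proof (induction "degree p" arbitrary: p)
  case 0
  then obtain c where "p = [:c:]" by (metis degree_eq_zeroE)
  with 0 show ?case by simp
next
  case (Suc n)
  then obtain r where "poly p r = 0"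
    using alg_closed_imp_poly_has_root[of p] by auto
  then obtain q where q: "p = [:- r, 1:] * q"
    by (auto simp: poly_eq_0_iff_dvd)
  with Suc have "q \<noteq> 0" by auto
  moreover have "degree p = Suc (degree q)"
    unfolding q using \<open>q \<noteq> 0\<close> by (subst degree_mult_eq) auto
  ultimately have IH: "fls_eval \<tau> q \<noteq> 0 \<and> even (fls_subdegree (fls_eval \<tau> q))"
    using Suc by simp
  have "fls_eval \<tau> p = (\<tau> - fls_const r) * fls_eval \<tau> q"
    unfolding q fls_eval_mult by simp
  with IH \<tau>[of r] show ?case by simp
qed

text \<open>The quotient is the same for all representations of the fraction once no nonzero
  polynomial vanishes at \<tau>; this is the hypothesis of the context that follows.\<close>

definition fls_eval_fract :: "'a::field fls \<Rightarrow> 'a poly fract \<Rightarrow> 'a fls" where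
  "fls_eval_fract \<tau> r = (THE g. \<exists>p q. q \<noteq> 0 \<and> r = Fract p q \<and> g = fls_eval \<tau> p / fls_eval \<tau> q)"

context
  fixes \<tau> :: "'a::field fls"
  assumes \<tau>: "\<And>p. p \<noteq> 0 \<Longrightarrow> fls_eval \<tau> p \<noteq> 0"
begin

lemma fls_eval_fract_Fract:
  assumes "q \<noteq> 0"
  shows "fls_eval_fract \<tau> (Fract p q) = fls_eval \<tau> p / fls_eval \<tau> q"
  unfolding fls_eval_fract_def
proof (rule the_equality)
  fix g
  assume "\<exists>p' q'. q' \<noteq> 0 \<and> Fract p q = Fract p' q' \<and> g = fls_eval \<tau> p' / fls_eval \<tau> q'"
  then obtain p' q' where q': "q' \<noteq> 0" and eq: "Fract p q = Fract p' q'"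
    and g: "g = fls_eval \<tau> p' / fls_eval \<tau> q'" by blast
  have "p' * q = p * q'" using eq assms q' by (simp add: eq_fract)
  then have "fls_eval \<tau> p' * fls_eval \<tau> q = fls_eval \<tau> p * fls_eval \<tau> q'"
    by (metis fls_eval_mult)
  then show "g = fls_eval \<tau> p / fls_eval \<tau> q"
    using \<tau>[OF assms] \<tau>[OF q'] by (simp add: g field_simps)
qed (use assms in blast)

lemma fls_eval_fract_to_fract [simp]: "fls_eval_fract \<tau> (to_fract p) = fls_eval \<tau> p"
  by (simp add: to_fract_def fls_eval_fract_Fract)

lemma fls_eval_fract_add: "fls_eval_fract \<tau> (r + s) = fls_eval_fract \<tau> r + fls_eval_fract \<tau> s"
  by (cases r; cases s) (simp add: fls_eval_fract_Fract \<tau> field_simps)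

lemma fls_eval_fract_mult: "fls_eval_fract \<tau> (r * s) = fls_eval_fract \<tau> r * fls_eval_fract \<tau> s"
  by (cases r; cases s) (simp add: fls_eval_fract_Fract \<tau> field_simps)

lemma fls_eval_fract_eq_0_iff: "fls_eval_fract \<tau> r = 0 \<longleftrightarrow> r = 0"
  using \<tau> by (cases r) (auto simp: fls_eval_fract_Fract eq_fract Zero_fract_def)

end

section \<open>Existence of places\<close>

context hyperelliptic
begin

text \<open>The subdegree in t, pulled back along the map from a + b Y to a(\<tau>) + b(\<tau>) Z
  with Z^2 = F(\<tau>), satisfies all the laws of a place except surjectivity. Its value group is
  nonzero by the hypothesis on r, and division by a generator e normalizes it. The number e stays
  unspecified: the uses of this lemma need only signs.\<close>

lemma place_of_parametrization:
  fixes \<tau> :: "qbar fls"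
  assumes \<tau>: "\<And>c. \<tau> - fls_const c \<noteq> 0 \<and> even (fls_subdegree (\<tau> - fls_const c))"
    and r: "fls_subdegree (\<tau> - fls_const r) \<noteq> 0"
  shows "\<exists>w\<in>P. \<exists>e>0. \<forall>p. p \<noteq> 0 \<longrightarrow> wx w p * e = fls_subdegree (fls_eval \<tau> p)"
proof -
  have eval: "fls_eval \<tau> p \<noteq> 0" if "p \<noteq> 0" for p
    using fls_eval_even_subdegree[OF \<tau> that] by simp
  define ev where "ev = fls_eval_fract \<tau>"
  have ev_add: "ev (a + b) = ev a + ev b" and ev_mult: "ev (a * b) = ev a * ev b"
    and ev_0: "ev a = 0 \<longleftrightarrow> a = 0" and ev_poly: "ev (to_fract p) = fls_eval \<tau> p" for a b p
    using eval by (auto simp: ev_def fls_eval_fract_add fls_eval_fract_mult fls_eval_fract_eq_0_iff)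
  obtain Z where Z: "Z\<^sup>2 = ev FK"
    using fls_square_root_exists[of "fls_eval \<tau> \<Phi>"] fls_eval_even_subdegree[OF \<tau>, of \<Phi>]
    by (auto simp: FK_eq ev_poly)
  define \<phi> where "\<phi> a b = ev a + ev b * Z" for a b
  have \<phi>_add: "\<phi> (a + c) (b + d) = \<phi> a b + \<phi> c d" for a b c d
    by (simp add: \<phi>_def ev_add algebra_simps)
  have \<phi>_mult: "\<phi> (a * c + b * d * FK) (a * d + b * c) = \<phi> a b * \<phi> c d" for a b c d
    by (simp add: \<phi>_def ev_add ev_mult Z[symmetric] algebra_simps power2_eq_square)
  have \<phi>_poly: "\<phi> (to_fract p) 0 = fls_eval \<tau> p" for p
    using ev_0[of 0] by (simp add: \<phi>_def ev_poly)
  have \<phi>_1: "\<phi> 1 0 = 1" using \<phi>_poly[of 1] by simp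
  \<comment> \<open>An invertible element has a nonzero image, so the map is injective.\<close>
  have inv: "\<exists>c d. (c \<noteq> 0 \<or> d \<noteq> 0) \<and> \<phi> a b * \<phi> c d = 1" if ab: "a \<noteq> 0 \<or> b \<noteq> 0" for a b
  proof -
    obtain c d where "c \<noteq> 0 \<or> d \<noteq> 0" "a * c + b * d * FK = 1" "a * d + b * c = 0"
      using inverse_exists[OF ab] by blast
    then show ?thesis using \<phi>_mult[of a c b d] \<phi>_1 by metis
  qed
  have \<phi>_nonzero: "\<phi> a b \<noteq> 0" if "a \<noteq> 0 \<or> b \<noteq> 0" for a b
    using inv[OF that] by auto
  define s where "s a b = fls_subdegree (\<phi> a b)" for a b
  have s_mult: "s (a * c + b * d * FK) (a * d + b * c) = s a b + s c d"
    "a * c + b * d * FK \<noteq> 0 \<or> a * d + b * c \<noteq> 0"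
    if "a \<noteq> 0 \<or> b \<noteq> 0" "c \<noteq> 0 \<or> d \<noteq> 0" for a b c d
  proof -
    have \<phi>: "\<phi> a b * \<phi> c d \<noteq> 0" using \<phi>_nonzero that by simp
    then show "s (a * c + b * d * FK) (a * d + b * c) = s a b + s c d"
      by (simp add: s_def \<phi>_mult)
    show "a * c + b * d * FK \<noteq> 0 \<or> a * d + b * c \<noteq> 0"
      using \<phi> \<phi>_mult[of a c b d] \<phi>_poly[of 0] by auto
  qed
  define G where "G = {s a b | a b. a \<noteq> 0 \<or> b \<noteq> 0}"
  have "m - n \<in> G" if mn: "m \<in> G" "n \<in> G" for m n
  proof -
    obtain a b where ab: "a \<noteq> 0 \<or> b \<noteq> 0" "m = s a b" using mn(1) unfolding G_def by blast
    obtain c d where cd: "c \<noteq> 0 \<or> d \<noteq> 0" "n = s c d" using mn(2) unfolding G_def by blast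
    obtain c' d' where cd': "c' \<noteq> 0 \<or> d' \<noteq> 0" "\<phi> c d * \<phi> c' d' = 1" using inv[OF cd(1)] by blast
    have "s c d + s c' d' = fls_subdegree (\<phi> c d * \<phi> c' d')"
      using \<phi>_nonzero[OF cd(1)] \<phi>_nonzero[OF cd'(1)] by (simp add: s_def)
    then have "s c' d' = - n" using cd cd' by simp
    then have "s (a * c' + b * d' * FK) (a * d' + b * c') = m - n"
      using s_mult(1)[OF ab(1) cd'(1)] ab(2) by simp
    then show ?thesis
      using s_mult(2)[OF ab(1) cd'(1)] unfolding G_def by (intro CollectI exI conjI) (rule sym)
  qed
  moreover have "s (to_fract [:- r, 1:]) 0 \<in> G"
    unfolding G_def by (intro CollectI exI[of _ "to_fract [:- r, 1:]"] exI[of _ 0]) simp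
  moreover have "s (to_fract [:- r, 1:]) 0 \<noteq> 0"
    unfolding s_def \<phi>_poly using r by simp
  ultimately obtain e where e: "e > 0" "G = {k * e | k. True}"
    using int_subgroup_cyclic[of G] by blast
  have s_dvd: "e dvd s a b" if "a \<noteq> 0 \<or> b \<noteq> 0" for a b
  proof -
    have "s a b \<in> G"
      unfolding G_def using that by (intro CollectI exI[of _ a] exI[of _ b]) simp
    then show ?thesis using e(2) by auto
  qed
  \<comment> \<open>A place is a function on all of \<open>ffelem\<close>, so the coordinates a and
    b are recovered by description, and the value is 0 off the nonzero elements of the
    field.\<close>
  define w where "w g = (if g \<in> carrier L - {0}
      then (case (THE (a, b). g = E a b) of (a, b) \<Rightarrow> s a b div e) else 0)" for g
  have w: "w (E a b) = s a b div e" if "a \<noteq> 0 \<or> b \<noteq> 0" for a b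
  proof -
    have "(THE (x, y). E a b = E x y) = (a, b)"
      by (rule the_equality) auto
    then show ?thesis using that by (simp add: w_def)
  qed
  have "w \<in> P"
  proof (rule placesI)
    fix a b c d :: "qbar poly fract"
    assume nz: "a \<noteq> 0 \<or> b \<noteq> 0" "c \<noteq> 0 \<or> d \<noteq> 0"
    show "w (E (a * c + b * d * FK) (a * d + b * c)) = w (E a b) + w (E c d)"
      using s_mult[OF nz] s_dvd[OF nz(1)] s_dvd[OF nz(2)] nz by (simp add: w div_plus_div_distrib_dvd_left)
    assume nz': "a + c \<noteq> 0 \<or> b + d \<noteq> 0"
    have "min (s a b) (s c d) \<le> s (a + c) (b + d)"
      unfolding s_def \<phi>_add using \<phi>_nonzero[OF nz'] \<phi>_add by (intro fls_plus_subdegree) simp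
    then have "s a b \<le> s (a + c) (b + d) \<or> s c d \<le> s (a + c) (b + d)"
      by (simp add: min_def split: if_splits)
    then show "min (w (E a b)) (w (E c d)) \<le> w (E (a + c) (b + d))"
      unfolding w[OF nz(1)] w[OF nz(2)] w[OF nz'] min_le_iff_disj
      using zdiv_mono1[OF _ e(1)] by blast
  next
    fix c :: qbar
    assume "c \<noteq> 0"
    then show "wx w [:c:] = 0" by (simp add: w s_def \<phi>_poly)
  next
    fix n :: int
    have "n * e \<in> G" using e(2) by blast
    then obtain a b where ab: "a \<noteq> 0 \<or> b \<noteq> 0" "n * e = s a b" unfolding G_def by blast
    then have "w (E a b) = n" using e(1) by (simp add: w flip: ab(2))
    with ab show "\<exists>a b. (a \<noteq> 0 \<or> b \<noteq> 0) \<and> w (E a b) = n" by blast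
  qed (simp_all add: w_def)
  moreover have "wx w p * e = fls_subdegree (fls_eval \<tau> p)" if "p \<noteq> 0" for p
    using s_dvd[of "to_fract p" 0] that by (simp add: w) (simp add: s_def \<phi>_poly)
  ultimately show ?thesis using e(1) by blast
qed

text \<open>The point r is arbitrary: thanks to t^2, roots of F are included, and places above them
  are needed in \<open>integral_imp_poly\<close> and \<open>double_not_principal\<close>.\<close>

lemma finite_place_exists: "\<exists>w\<in>P. 0 < wx w [:- r, 1:]"
proof -
  define \<tau> where "\<tau> = fls_const r + fls_X_intpow 2"
  have \<tau>: "\<tau> - fls_const c \<noteq> 0 \<and> fls_subdegree (\<tau> - fls_const c) = (if c = r then 2 else 0)" for c
  proof (cases "c = r")
    case False
    have eq: "\<tau> - fls_const c = fls_const (r - c) + fls_X_intpow 2"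
      by (simp add: \<tau>_def flip: fls_minus_const)
    have "fls_subdegree (fls_const (r - c) + fls_X_intpow 2) = fls_subdegree (fls_const (r - c))"
      using False by (intro fls_subdegree_add_eq1) auto
    moreover have "\<tau> - fls_const c \<noteq> 0"
    proof
      assume "\<tau> - fls_const c = 0"
      then have "\<tau> - fls_const r = fls_const (c - r)"
        by (simp add: fls_minus_const[symmetric])
      then have "fls_subdegree (\<tau> - fls_const r) = 0" by simp
      then show False by (simp add: \<tau>_def)
    qed
    ultimately show ?thesis using False eq by simp
  qed (simp add: \<tau>_def)
  have ev: "\<tau> - fls_const c \<noteq> 0 \<and> even (fls_subdegree (\<tau> - fls_const c))" for c
    using \<tau>[of c] by auto
  obtain w e where w: "w \<in> P" "e > 0" "\<And>p. p \<noteq> 0 \<Longrightarrow> wx w p * e = fls_subdegree (fls_eval \<tau> p)"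
    using place_of_parametrization[OF ev, of r] \<tau>[of r] by auto
  have "wx w [:- r, 1:] * e = 2"
    using w(3)[of "[:- r, 1:]"] \<tau>[of r] by simp
  then have "0 < wx w [:- r, 1:]"
    using w(2) by (metis zero_less_mult_pos2 zero_less_numeral)
  with w(1) show ?thesis by blast
qed

lemma infinite_place_exists: "\<exists>w\<in>P. wx w [:0, 1:] < 0"
proof -
  define \<tau> :: "qbar fls" where "\<tau> = fls_X_intpow (- 2)"
  have \<tau>0: "\<tau> \<noteq> 0"
    unfolding \<tau>_def by (rule fls_X_intpow_nonzero)
  have \<tau>: "\<tau> - fls_const c \<noteq> 0 \<and> fls_subdegree (\<tau> - fls_const c) = - 2" for c
  proof -
    have "fls_subdegree (\<tau> + fls_const (- c)) = fls_subdegree \<tau>"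
      by (rule fls_subdegree_add_eq1) (use \<tau>0 in \<open>simp_all add: \<tau>_def del: fls_const_uminus\<close>)
    then show ?thesis by (auto simp: \<tau>_def)
  qed
  have ev: "\<tau> - fls_const c \<noteq> 0 \<and> even (fls_subdegree (\<tau> - fls_const c))" for c
    using \<tau>[of c] by auto
  obtain w e where w: "w \<in> P" "e > 0" "\<And>p. p \<noteq> 0 \<Longrightarrow> wx w p * e = fls_subdegree (fls_eval \<tau> p)"
    using place_of_parametrization[OF ev, of 0] \<tau>[of 0] by auto
  have "wx w [:0, 1:] * e = - 2"
    using w(3)[of "[:0, 1:]"] \<tau>[of 0] by simp
  then have "wx w [:0, 1:] < 0"
    using w(2) by (smt (verit) mult_nonneg_nonneg)
  with w(1) show ?thesis by blast
qed

end

section \<open>Values of polynomials in x\<close>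

context hyperelliptic
begin

context
  fixes w assumes w: "w \<in> P"
begin

text \<open>The strict case of the ultrametric inequality: a smaller value survives, since the first
  summand is the sum minus the second. The case c = d = 0 is listed separately because places give
  the zero element the value 0, not infinity.\<close>

lemma place_add_eq:
  assumes ab: "a \<noteq> 0 \<or> b \<noteq> 0" and less: "c = 0 \<and> d = 0 \<or> w (E a b) < w (E c d)"
  shows "a + c \<noteq> 0 \<or> b + d \<noteq> 0" "w (E (a + c) (b + d)) = w (E a b)"
proof -
  show *: "a + c \<noteq> 0 \<or> b + d \<noteq> 0"
  proof (rule ccontr)
    assume "\<not> (a + c \<noteq> 0 \<or> b + d \<noteq> 0)"
    then have "c = - a" "d = - b" by (auto simp: add_eq_0_iff)
    with ab less show False by (auto simp: place_minus[OF w])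
  qed
  show "w (E (a + c) (b + d)) = w (E a b)"
  proof (cases "c = 0 \<and> d = 0")
    case False
    then have cd: "c \<noteq> 0 \<or> d \<noteq> 0" by auto
    have "min (w (E (a + c) (b + d))) (w (E (- c) (- d))) \<le> w (E (a + c + - c) (b + d + - d))"
      using * cd ab by (intro place_add[OF w]) auto
    then have "min (w (E (a + c) (b + d))) (w (E c d)) \<le> w (E a b)"
      by (simp add: place_minus[OF w])
    with place_add[OF w ab cd *] less cd show ?thesis by auto
  qed auto
qed

lemma integral_poly:
  assumes x: "0 \<le> wx w [:0, 1:]"
  shows "integral w (to_fract p) 0"
proof (induction p)
  case 0
  then show ?case by (simp add: integral_def)
next
  case (pCons a p)
  have "integral w (to_fract [:0, 1:]) 0"
    using x by (simp add: integral_def)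
  then have "integral w (to_fract ([:0, 1:] * p)) 0"
    using pCons(2) integral_poly_mult[OF w] by blast
  then have "integral w (to_fract [:a:] + to_fract ([:0, 1:] * p)) (0 + 0)"
    by (intro integral_add[OF w] integral_const[OF w])
  moreover have "pCons a p = [:a:] + [:0, 1:] * p" by simp
  ultimately show ?case by (metis add.right_neutral to_fract_add)
qed

lemma integral_Y:
  assumes x: "0 \<le> wx w [:0, 1:]"
  shows "integral w 0 1"
proof -
  have "w (E FK 0) = 2 * w (E 0 1)"
    using place_mult[OF w, of 0 1 0 1] by simp
  moreover have "0 \<le> wx w \<Phi>"
    using integral_poly[OF x, of \<Phi>] by (simp add: integral_def)
  ultimately show ?thesis by (simp add: integral_def FK_eq)
qed

lemma integral_elem:
  assumes x: "0 \<le> wx w [:0, 1:]"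
  shows "integral w (to_fract p) (to_fract q)"
proof -
  have "integral w (to_fract q * 0 + 0 * 1 * FK) (to_fract q * 1 + 0 * 0)"
    by (intro integral_mult[OF w] integral_poly integral_Y x)
  then have "integral w (to_fract p + 0) (0 + to_fract q)"
    by (intro integral_add[OF w] integral_poly x) simp_all
  then show ?thesis by simp
qed

context
  fixes r assumes r: "0 < wx w [:- r, 1:]"
begin

lemma x_integral: "0 \<le> wx w [:0, 1:]"
proof -
  have "integral w (to_fract [:- r, 1:]) 0" using r by (simp add: integral_def)
  then have "integral w (to_fract [:- r, 1:] + to_fract [:r:]) (0 + 0)"
    by (intro integral_add[OF w] integral_const[OF w])
  moreover have "to_fract [:- r, 1:] + to_fract [:r:] = to_fract [:0, 1:]"
    by (simp flip: to_fract_add)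
  ultimately show ?thesis by (simp add: integral_def)
qed

text \<open>The polynomial p differs from the constant p(r) by a multiple of x - r, which vanishes
  at w.\<close>

lemma vanishing_iff_root: "vanishing w (to_fract p) 0 \<longleftrightarrow> poly p r = 0"
proof -
  have dvd: "vanishing w (to_fract p) 0" if root: "poly p r = 0" for p
  proof -
    obtain q where q: "p = [:- r, 1:] * q"
      using root unfolding poly_eq_0_iff_dvd dvd_def by blast
    have "vanishing w (to_fract [:- r, 1:]) 0"
      using r by (simp add: vanishing_def)
    from vanishing_mult[OF w this integral_poly[OF x_integral, of q]] show ?thesis
      unfolding q to_fract_mult by simp
  qed
  moreover have "poly p r = 0" if "vanishing w (to_fract p) 0"
  proof (rule ccontr)
    assume nz: "poly p r \<noteq> 0"
    have "vanishing w (to_fract ([:poly p r:] - p)) 0"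
      by (rule dvd) simp
    then have "vanishing w (to_fract p + to_fract ([:poly p r:] - p)) (0 + 0)"
      using that by (intro vanishing_add[OF w])
    then show False
      using place_const[OF w nz] nz by (simp add: vanishing_def)
  qed
  ultimately show ?thesis by blast
qed

lemma wx_order:
  assumes "p \<noteq> 0"
  shows "wx w p = int (order r p) * wx w [:- r, 1:]"
proof -
  obtain q where q: "p = [:- r, 1:] ^ order r p * q" "\<not> [:- r, 1:] dvd q"
    using order_decomp[OF assms] by blast
  have "q \<noteq> 0" using q(2) by auto
  moreover have "\<not> vanishing w (to_fract q) 0"
    using q(2) by (simp add: vanishing_iff_root poly_eq_0_iff_dvd)
  ultimately have "wx w q = 0"
    using place_eq_0_iff[OF w integral_poly[OF x_integral, of q]] by simp
  moreover have "wx w p = wx w ([:- r, 1:] ^ order r p) + wx w q"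
    using q(1) \<open>q \<noteq> 0\<close> wx_mult[OF w, of "[:- r, 1:] ^ order r p" q] by simp
  ultimately show ?thesis
    using wx_power[OF w, of "[:- r, 1:]" "order r p"] by simp
qed

end

text \<open>Values add over the linear factors of p, so a positive total forces a positive factor.
  This locates the point of the x-line below w.\<close>

lemma root_of_positive:
  assumes "p \<noteq> 0" "wx w p > 0" "0 \<le> wx w [:0, 1:]"
  shows "\<exists>r. poly p r = 0 \<and> 0 < wx w [:- r, 1:]"
  using assms
proof (induction "degree p" arbitrary: p)
  case 0
  then obtain c where "p = [:c:]" by (metis degree_eq_zeroE)
  with 0 show ?case using place_const[OF w, of c] by auto
next
  case (Suc n)
  then obtain r where "poly p r = 0"
    using alg_closed_imp_poly_has_root[of p] by auto
  then obtain q where q: "p = [:- r, 1:] * q"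
    unfolding poly_eq_0_iff_dvd dvd_def by blast
  with Suc have q0: "q \<noteq> 0" by auto
  then have "wx w p = wx w [:- r, 1:] + wx w q"
    unfolding q using wx_mult[OF w, of "[:- r, 1:]" q] by simp
  then consider "0 < wx w [:- r, 1:]" | "0 < wx w q"
    using Suc by linarith
  then show ?case
  proof cases
    case 1
    then show ?thesis using \<open>poly p r = 0\<close> by blast
  next
    case 2
    have "degree p = Suc (degree q)"
      unfolding q using q0 by (subst degree_mult_eq) auto
    then obtain r' where "poly q r' = 0" "0 < wx w [:- r', 1:]"
      using Suc.hyps(1)[of q] Suc 2 q0 by auto
    then show ?thesis unfolding q by auto
  qed
qed

text \<open>Where x has a pole, the leading term has the strictly smallest value.\<close>

lemma wx_degree:
  assumes x: "wx w [:0, 1:] < 0" and "p \<noteq> 0"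
  shows "wx w p = int (degree p) * wx w [:0, 1:]"
  using \<open>p \<noteq> 0\<close>
proof (induction p)
  case (pCons a p)
  show ?case
  proof (cases "p = 0")
    case True
    with pCons show ?thesis by (simp add: place_const[OF w])
  next
    case False
    let ?q = "[:0, 1:] * p"
    have q: "wx w ?q = (int (degree p) + 1) * wx w [:0, 1:]"
      using wx_mult[OF w, of "[:0, 1:]" p] False pCons by (simp add: algebra_simps)
    then have "wx w ?q < 0"
      using x by (simp add: mult_pos_neg)
    then have "w (E (to_fract ?q + to_fract [:a:]) (0 + 0)) = wx w ?q"
      using False place_const[OF w, of a] by (intro place_add_eq; cases "a = 0") auto
    moreover have "to_fract ?q + to_fract [:a:] = to_fract (pCons a p)"
      by (simp flip: to_fract_add)
    ultimately show ?thesis using q False by simp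
  qed
qed simp

end

text \<open>The hyperelliptic involution y -> - y - h, that is Y -> - Y, in the basis 1, y.\<close>

definition conj_elem :: "ffelem \<Rightarrow> ffelem" where
  "conj_elem g = [:coeff g 0 - coeff g 1 * base_change h, - coeff g 1:]"

lemma conj_elem_E [simp]: "conj_elem (E a b) = E a (- b)"
  by (simp add: conj_elem_def ff_elem_def)

text \<open>\<open>conj_elem\<close> reads only two coefficients and so maps everything into the
  function field; elements outside it must be sent to 0 explicitly, as \<open>places\<close>
  demands.\<close>

definition conj_place :: "(ffelem \<Rightarrow> int) \<Rightarrow> ffelem \<Rightarrow> int" where
  "conj_place w g = (if g \<in> carrier L then w (conj_elem g) else 0)"

lemma conj_place_E [simp]: "conj_place w (E a b) = w (E a (- b))"
  by (simp add: conj_place_def)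

lemma conj_place_in:
  assumes w: "w \<in> P"
  shows "conj_place w \<in> P"
proof (rule placesI)
  fix a b c d :: "qbar poly fract"
  assume nz: "a \<noteq> 0 \<or> b \<noteq> 0" "c \<noteq> 0 \<or> d \<noteq> 0"
  then show "conj_place w (E (a * c + b * d * FK) (a * d + b * c))
      = conj_place w (E a b) + conj_place w (E c d)"
    using place_mult[OF w, of a "- b" c "- d"] by simp
  assume "a + c \<noteq> 0 \<or> b + d \<noteq> 0"
  then have "a + c \<noteq> 0 \<or> - b + - d \<noteq> 0"
    by (metis add.inverse_neutral minus_add_distrib neg_equal_iff_equal)
  with nz show "min (conj_place w (E a b)) (conj_place w (E c d)) \<le> conj_place w (E (a + c) (b + d))"
    using place_add[OF w, of a "- b" c "- d"] by simp
next
  fix n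
  obtain a b where "a \<noteq> 0 \<or> b \<noteq> 0" "w (E a b) = n"
    using place_surj[OF w] by blast
  then show "\<exists>a b. (a \<noteq> 0 \<or> b \<noteq> 0) \<and> conj_place w (E a b) = n"
    by (intro exI[of _ a] exI[of _ "- b"]) simp
next
  have "conj_elem 0 = 0" by (simp add: conj_elem_def)
  then show "conj_place w 0 = 0"
    using place_zero[OF w] by (simp add: conj_place_def)
qed (simp_all add: place_const[OF w] conj_place_def)

end

section \<open>Residues\<close>

context hyperelliptic
begin

abbreviation const :: "qbar \<Rightarrow> qbar poly fract" where
  "const c \<equiv> to_fract [:c:]"

lemma const_simps:
  "const (c + d) = const c + const d" "const (c * d) = const c * const d" "const (- c) = - const c"
  by (simp_all flip: to_fract_add to_fract_mult to_fract_uminus)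

context
  fixes w assumes w: "w \<in> P"
begin

text \<open>Here and below, \<open>vanishing w (a - const c) b\<close> expresses that a + b Y has
  residue c at w. A nonzero residue makes a unit.\<close>

lemma value_of_residue:
  assumes c: "c \<noteq> 0" and v: "vanishing w (a - const c) b"
  shows "w (E a b) = 0"
proof -
  have "w (E (const c + (a - const c)) (0 + b)) = wx w [:c:]"
    using v c place_const[OF w c] by (intro place_add_eq[OF w]) (auto simp: vanishing_def)
  then show ?thesis using place_const[OF w c] by simp
qed

text \<open>Residues respect sums and products: a + b \<zeta> Y - (\<alpha> + \<beta> s) = (a -
  \<alpha>) + b (\<zeta> Y - s) + (b - \<beta>) s. The factor \<zeta> makes \<zeta> Y finite: it is
  1 at finite places and x^(-3) at infinity.\<close>

lemma residue_combine:
  assumes a: "vanishing w (a - const \<alpha>) 0" and b: "vanishing w (b - const \<beta>) 0"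
    and Y: "vanishing w (- const s) \<zeta>"
  shows "vanishing w (a - const (\<alpha> + \<beta> * s)) (b * \<zeta>)"
proof -
  have "integral w (b - const \<beta> + const \<beta>) (0 + 0)"
    by (intro integral_add[OF w] integral_const[OF w] vanishing_imp_integral[OF w] b)
  then have ib: "integral w b 0" by simp
  have "vanishing w (- const s * b + \<zeta> * 0 * FK) (- const s * 0 + \<zeta> * b)"
    by (rule vanishing_mult[OF w Y ib])
  moreover have "vanishing w ((b - const \<beta>) * const s + 0 * 0 * FK) ((b - const \<beta>) * 0 + 0 * const s)"
    by (rule vanishing_mult[OF w b integral_const[OF w]])
  ultimately have "vanishing w ((a - const \<alpha>) + ((- const s * b) + (b - const \<beta>) * const s)) (0 + (\<zeta> * b + 0))"
    by (intro vanishing_add[OF w a] vanishing_add[OF w]) simp_all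
  then show ?thesis by (simp add: const_simps algebra_simps)
qed

text \<open>The conjugates have residues \<alpha> + \<beta> s and \<alpha> - \<beta> s at w, which
  cannot both vanish as s is nonzero. If the first vanishes, the conjugate is a unit and the norm
  carries the whole value.\<close>

lemma value_by_residues:
  assumes a: "vanishing w (a - const \<alpha>) 0" and b: "vanishing w (b - const \<beta>) 0"
    and Y: "vanishing w (- const s) \<zeta>" and nz: "\<alpha> \<noteq> 0 \<or> \<beta> \<noteq> 0" and s: "s \<noteq> 0"
    and ab: "a \<noteq> 0 \<or> b * \<zeta> \<noteq> 0"
  shows "w (E a (b * \<zeta>)) = (if \<alpha> + \<beta> * s \<noteq> 0 then 0 else w (E (a\<^sup>2 - (b * \<zeta>)\<^sup>2 * FK) 0))"
proof (cases "\<alpha> + \<beta> * s = 0")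
  case False
  then show ?thesis
    using value_of_residue[OF False residue_combine[OF a b Y]] by simp
next
  case True
  have "\<alpha> + - \<beta> * s \<noteq> 0"
  proof
    assume "\<alpha> + - \<beta> * s = 0"
    moreover have "2 * (\<beta> * s) = (\<alpha> + \<beta> * s) - (\<alpha> + - \<beta> * s)" by simp
    ultimately have "\<beta> = 0" using True s by simp
    with True nz show False by simp
  qed
  moreover have "vanishing w (- b - const (- \<beta>)) 0"
    using vanishing_minus[OF w b] by (simp add: const_simps)
  ultimately have "w (E a (- (b * \<zeta>))) = 0"
    using value_of_residue[OF _ residue_combine[OF a _ Y], of "- \<beta>" "- b"] by simp
  with True place_norm[OF w ab] show ?thesis by simp
qed

text \<open>The product (s - \<zeta> Y) (s + \<zeta> Y) vanishes at w, hence one of its factors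
  does.\<close>

lemma vanishing_square_root:
  assumes "vanishing w (\<zeta>\<^sup>2 * FK - const (s\<^sup>2)) 0" and \<zeta>: "\<zeta> \<noteq> 0"
  shows "vanishing w (- const s) \<zeta> \<or> vanishing w (const s) \<zeta>"
proof -
  have nz: "(const s)\<^sup>2 - \<zeta>\<^sup>2 * FK \<noteq> 0" using \<zeta> by (intro norm_nonzero) simp
  have *: "const (s\<^sup>2) = (const s)\<^sup>2" by (simp only: power2_eq_square const_simps)
  have "w (E (- ((const s)\<^sup>2 - \<zeta>\<^sup>2 * FK)) (- 0)) > 0"
    using assms(1) nz unfolding vanishing_def * by auto
  then have "w (E ((const s)\<^sup>2 - \<zeta>\<^sup>2 * FK) 0) > 0"
    unfolding place_minus[OF w] .
  moreover have "w (E (const s) (- \<zeta>)) = w (E (- const s) \<zeta>)"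
    using place_minus[OF w, of "- const s" \<zeta>] by simp
  ultimately show ?thesis
    using place_norm[OF w, of "const s" \<zeta>] \<zeta> unfolding vanishing_def by auto
qed

lemma vanishing_both_roots:
  assumes "vanishing w (- const s) \<zeta>" "vanishing w (const s) \<zeta>"
  shows "s = 0"
proof (rule ccontr)
  assume "s \<noteq> 0"
  have "vanishing w (const s + - (- const s)) (\<zeta> + - \<zeta>)"
    by (intro vanishing_add[OF w] vanishing_minus[OF w] assms)
  then have "vanishing w (const (s + s)) 0" unfolding const_simps by simp
  moreover have "s + s \<noteq> 0" using \<open>s \<noteq> 0\<close> by (simp add: mult_2[symmetric])
  ultimately show False using place_const[OF w] by (auto simp: vanishing_def)
qed

text \<open>Removing the term of degree n leaves a polynomial of smaller degree, and its quotient by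
  x^n vanishes where x has a pole. So the residue of p / x^n is a coefficient.\<close>

lemma vanishing_degree:
  assumes x: "wx w [:0, 1:] < 0" and "degree p \<le> n"
  shows "vanishing w (to_fract p / to_fract [:0, 1:] ^ n - const (coeff p n)) 0"
proof -
  define q where "q = p - monom (coeff p n) n"
  have q: "degree q < n" if "q \<noteq> 0"
  proof -
    have "degree q \<le> n" using assms(2) by (auto simp: q_def intro!: degree_diff_le degree_monom_le)
    moreover have "coeff q n = 0" by (simp add: q_def)
    ultimately show ?thesis using that by (metis leading_coeff_0_iff order_le_neq_trans)
  qed
  have "monom (coeff p n) n = [:coeff p n:] * [:0, 1:] ^ n"
    by (simp add: monom_altdef)
  then have eq: "to_fract p / to_fract [:0, 1:] ^ n - const (coeff p n) = to_fract q / to_fract [:0, 1:] ^ n"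
    by (simp add: q_def diff_divide_distrib del: mult_pCons_left)
  show ?thesis
  proof (cases "q = 0")
    case False
    have "wx w q = w (E (to_fract [:0, 1:] ^ n * (to_fract q / to_fract [:0, 1:] ^ n))
                        (to_fract [:0, 1:] ^ n * 0))"
      by simp
    also have "\<dots> = w (E (to_fract [:0, 1:] ^ n) 0) + w (E (to_fract q / to_fract [:0, 1:] ^ n) 0)"
      using False by (intro place_scale[OF w]) simp_all
    also have "w (E (to_fract [:0, 1:] ^ n) 0) = int n * wx w [:0, 1:]"
      using wx_power[OF w, of "[:0, 1:]" n] by simp
    finally have "w (E (to_fract q / to_fract [:0, 1:] ^ n) 0) = (int (degree q) - int n) * wx w [:0, 1:]"
      using wx_degree[OF w x False] by (simp add: algebra_simps)
    moreover have "\<dots> > 0"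
      using q[OF False] x by (intro mult_neg_neg) auto
    ultimately show ?thesis unfolding eq by (simp add: vanishing_def)
  qed (simp add: eq vanishing_def)
qed

end

lemma norm_to_fract: "(to_fract a)\<^sup>2 - (to_fract b)\<^sup>2 * FK = to_fract (a\<^sup>2 - b\<^sup>2 * \<Phi>)"
  by (simp add: FK_eq)

lemma norm_poly_nonzero: "a \<noteq> 0 \<or> b \<noteq> 0 \<Longrightarrow> a\<^sup>2 - b\<^sup>2 * \<Phi> \<noteq> 0"
  using norm_nonzero[of "to_fract a" "to_fract b"] unfolding norm_to_fract
  by (simp only: to_fract_eq_0_iff) blast

text \<open>The point is the order of quantifiers: n is the same for all places over the point x =
  r, Y = s. This will show both that x - r is a uniformizer there and that the place is
  unique.\<close>

lemma finite_local_value: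
  assumes s: "s \<noteq> 0" and ab: "a \<noteq> 0 \<or> b \<noteq> 0"
  shows "\<exists>n. \<forall>w\<in>P. 0 < wx w [:- r, 1:] \<longrightarrow> vanishing w (- const s) 1 \<longrightarrow>
           w (E (to_fract a) (to_fract b)) = n * wx w [:- r, 1:]"
  using ab
\<comment> \<open>Common factors x - r of a and b are divided out until the residues of a and b are
  not both zero; then \<open>value_by_residues\<close> applies.\<close>
proof (induction "degree a + degree b" arbitrary: a b rule: less_induct)
  case less
  show ?case
  proof (cases "poly a r = 0 \<and> poly b r = 0")
    case True
    then obtain a' b' where eq: "a = [:- r, 1:] * a'" "b = [:- r, 1:] * b'"
      unfolding poly_eq_0_iff_dvd dvd_def by blast
    with less.prems have nz: "a' \<noteq> 0 \<or> b' \<noteq> 0" by auto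
    have deg: "degree ([:- r, 1:] * c) = (if c = 0 then 0 else Suc (degree c))" for c
      by (cases "c = 0") (simp, subst degree_mult_eq, auto)
    have "degree a' + degree b' < degree a + degree b"
      using nz unfolding eq deg by auto
    then obtain n where n: "\<forall>w\<in>P. 0 < wx w [:- r, 1:] \<longrightarrow> vanishing w (- const s) 1 \<longrightarrow>
        w (E (to_fract a') (to_fract b')) = n * wx w [:- r, 1:]"
      using less.hyps nz by blast
    have "w (E (to_fract a) (to_fract b)) = (n + 1) * wx w [:- r, 1:]"
      if "w \<in> P" "0 < wx w [:- r, 1:]" "vanishing w (- const s) 1" for w
      using place_scale[OF that(1), of "to_fract [:- r, 1:]" "to_fract a'" "to_fract b'"] n that nz
      unfolding eq to_fract_mult by (simp add: algebra_simps)
    then show ?thesis by blast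
  next
    case False
    define n where "n = (if poly a r + poly b r * s \<noteq> 0 then 0 else int (order r (a\<^sup>2 - b\<^sup>2 * \<Phi>)))"
    have "w (E (to_fract a) (to_fract b)) = n * wx w [:- r, 1:]"
      if w: "w \<in> P" and r: "0 < wx w [:- r, 1:]" and Y: "vanishing w (- const s) 1" for w
    proof -
      have van: "vanishing w (to_fract p - const (poly p r)) 0" for p
        using vanishing_iff_root[OF w r, of "p - [:poly p r:]"] by simp
      show ?thesis
        using value_by_residues[OF w van van Y, of a b] False s less.prems
          wx_order[OF w r norm_poly_nonzero[OF less.prems]]
        by (auto simp: norm_to_fract n_def simp del: to_fract_diff to_fract_mult to_fract_power)
    qed
    then show ?thesis by blast
  qed
qed

text \<open>The analogue at infinity of \<open>finite_local_value\<close>, with residues of a / x^N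
  and b / x^(N - 3) and the unit Y / x^3.\<close>

lemma infinite_local_value:
  assumes s: "s \<noteq> 0" and ab: "a \<noteq> 0 \<or> b \<noteq> 0"
  shows "\<exists>n. \<forall>w\<in>P. wx w [:0, 1:] < 0 \<longrightarrow> vanishing w (- const s) (1 / to_fract [:0, 1:] ^ 3) \<longrightarrow>
           w (E (to_fract a) (to_fract b)) = n * wx w [:0, 1:]"
proof -
  define x where "x = to_fract [:0, 1 :: qbar:]"
  have x0: "x \<noteq> 0" by (simp add: x_def)
  \<comment> \<open>For nonzero b this is the least N for which a / x^N and b Y / x^N are both
    integral, and one of the residues \<alpha>, \<beta> is then a leading coefficient.\<close>
  define N where "N = max (degree a) (degree b + 3)"
  define \<alpha> \<beta> where "\<alpha> = coeff a N" and "\<beta> = coeff b (N - 3)"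
  have N: "degree a \<le> N" "degree b \<le> N - 3" "3 \<le> N" by (auto simp: N_def)
  have nz: "\<alpha> \<noteq> 0 \<or> \<beta> \<noteq> 0" if "b \<noteq> 0 \<or> degree a \<ge> 3"
    using that ab unfolding \<alpha>_def \<beta>_def N_def
    by (cases "degree a \<ge> degree b + 3") (auto simp: max_def)
  \<comment> \<open>For b = 0 and degree of a below 3, N would be 3 and both residues zero, so b = 0
    goes through \<open>wx_degree\<close>.\<close>
  have small: ?thesis if "b = 0"
    using that ab wx_degree by (intro exI[of _ "int (degree a)"]) auto
  show ?thesis
  proof (cases "b = 0")
    case False
    \<comment> \<open>In units of the value of x: N undoes the scaling by x^N, and the rest is the
      value of the scaled norm, which is divided by x^(2 N).\<close>
    define n where "n = int N + (if \<alpha> + \<beta> * s \<noteq> 0 then 0 else int (degree (a\<^sup>2 - b\<^sup>2 * \<Phi>)) - 2 * int N)"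
    have "w (E (to_fract a) (to_fract b)) = n * wx w [:0, 1:]"
      if w: "w \<in> P" and inf: "wx w [:0, 1:] < 0" and Y: "vanishing w (- const s) (1 / x ^ 3)" for w
    proof -
      let ?a = "to_fract a / x ^ N" and ?b = "to_fract b / x ^ (N - 3)"
      have xN: "w (E (x ^ n) 0) = int n * wx w [:0, 1:]" for n
        using wx_power[OF w, of "[:0, 1:]" n] by (simp add: x_def)
      have va: "vanishing w (?a - const \<alpha>) 0" and vb: "vanishing w (?b - const \<beta>) 0"
        unfolding x_def \<alpha>_def \<beta>_def using vanishing_degree[OF w inf] N by blast+
      have "x ^ N = x ^ (N - 3) * x ^ 3"
        using N(3) by (simp flip: power_add)
      then have b: "?b * (1 / x ^ 3) = to_fract b / x ^ N" by simp
      have nzb: "?a \<noteq> 0 \<or> to_fract b / x ^ N \<noteq> 0" using False x0 by simp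
      have "w (E ?a (to_fract b / x ^ N)) =
          (if \<alpha> + \<beta> * s \<noteq> 0 then 0 else w (E (?a\<^sup>2 - (to_fract b / x ^ N)\<^sup>2 * FK) 0))"
        using value_by_residues[OF w va vb Y] nz nzb s False unfolding b by blast
      moreover have "w (E (to_fract a) (to_fract b)) = w (E (x ^ N * ?a) (x ^ N * (to_fract b / x ^ N)))"
        using x0 by simp
      moreover have "\<dots> = int N * wx w [:0, 1:] + w (E ?a (to_fract b / x ^ N))"
        unfolding xN[symmetric] using x0 nzb by (intro place_scale[OF w]) auto
      moreover have "int (degree (a\<^sup>2 - b\<^sup>2 * \<Phi>)) * wx w [:0, 1:] =
          int (2 * N) * wx w [:0, 1:] + w (E (?a\<^sup>2 - (to_fract b / x ^ N)\<^sup>2 * FK) 0)"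
      proof -
        have nn: "?a\<^sup>2 - (to_fract b / x ^ N)\<^sup>2 * FK \<noteq> 0"
          using nzb by (intro norm_nonzero)
        have "x ^ (2 * N) * (?a\<^sup>2 - (to_fract b / x ^ N)\<^sup>2 * FK) = (to_fract a)\<^sup>2 - (to_fract b)\<^sup>2 * FK"
          using x0 by (simp add: power_divide power_even_eq right_diff_distrib)
        then have "wx w (a\<^sup>2 - b\<^sup>2 * \<Phi>) =
            w (E (x ^ (2 * N) * (?a\<^sup>2 - (to_fract b / x ^ N)\<^sup>2 * FK)) (x ^ (2 * N) * 0))"
          by (simp only: norm_to_fract mult_zero_right)
        also have "\<dots> = w (E (x ^ (2 * N)) 0) + w (E (?a\<^sup>2 - (to_fract b / x ^ N)\<^sup>2 * FK) 0)"
          using x0 nn by (intro place_scale[OF w]) auto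
        finally show ?thesis
          unfolding xN wx_degree[OF w inf norm_poly_nonzero[OF ab]] .
      qed
      ultimately show ?thesis by (auto simp: n_def algebra_simps)
    qed
    then show ?thesis unfolding x_def by blast
  qed (rule small)
qed

end

section \<open>Places above unramified points\<close>

context hyperelliptic
begin

text \<open>Every value of w is a multiple of w(\<sigma>), while w is onto the integers, so \<sigma>
  has value 1 or -1. The multipliers do not depend on the place, so two places of S that agree at
  \<sigma> are equal. Polynomial coefficients suffice, since a common denominator can be
  cleared.\<close>

lemma
  assumes S: "S \<subseteq> P" and \<sigma>: "\<sigma> \<noteq> 0"
    and local: "\<And>a b. a \<noteq> 0 \<or> b \<noteq> 0 \<Longrightarrow> \<exists>n. \<forall>w\<in>S. w (E (to_fract a) (to_fract b)) = n * wx w \<sigma>"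
  shows local_value_uniformizer: "w \<in> S \<Longrightarrow> \<bar>wx w \<sigma>\<bar> = 1"
    and local_value_unique: "w \<in> S \<Longrightarrow> w' \<in> S \<Longrightarrow> wx w \<sigma> = wx w' \<sigma> \<Longrightarrow> w = w'"
proof -
  have *: "\<exists>n. \<forall>w\<in>S. w (E a b) = n * wx w \<sigma>" if ab: "a \<noteq> 0 \<or> b \<noteq> 0" for a b
  proof -
    obtain p q where a: "a = Fract p q" "q \<noteq> 0" by (cases a) auto
    obtain p' q' where b: "b = Fract p' q'" "q' \<noteq> 0" by (cases b) auto
    have p: "p * q' \<noteq> 0 \<or> p' * q \<noteq> 0"
      using ab a b by (auto simp: Fract_conv_to_fract)
    have eq: "to_fract (q * q') * a = to_fract (p * q')" "to_fract (q * q') * b = to_fract (p' * q)"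
      using a b by (simp_all add: Fract_conv_to_fract)
    obtain n where n: "\<forall>w\<in>S. w (E (to_fract (p * q')) (to_fract (p' * q))) = n * wx w \<sigma>"
      using local[OF p] by blast
    obtain m where m: "\<forall>w\<in>S. w (E (to_fract (q * q')) (to_fract 0)) = m * wx w \<sigma>"
      using local[of "q * q'" 0] a(2) b(2) by auto
    have "w (E a b) = (n - m) * wx w \<sigma>" if "w \<in> S" for w
    proof -
      have "n * wx w \<sigma> = wx w (q * q') + w (E a b)"
        using place_scale[of w "to_fract (q * q')" a b] that S ab a(2) b(2) n unfolding eq by auto
      moreover have "wx w (q * q') = m * wx w \<sigma>" using m that by simp
      ultimately show ?thesis by (simp add: left_diff_distrib)
    qed
    then show ?thesis by blast
  qed
  show "\<bar>wx w \<sigma>\<bar> = 1" if "w \<in> S" for w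
  proof -
    have "w \<in> P" using that S by blast
    from place_surj[OF this] obtain a b where ab: "a \<noteq> 0 \<or> b \<noteq> 0" "w (E a b) = 1"
      by blast
    with *[OF ab(1)] that have "wx w \<sigma> dvd 1" by (metis dvd_triv_right)
    then show ?thesis by simp
  qed
  show "w = w'" if w: "w \<in> S" "w' \<in> S" "wx w \<sigma> = wx w' \<sigma>" for w w'
  proof
    fix g
    show "w g = w' g"
    proof (cases "g \<in> carrier L - {0}")
      case True
      then obtain a b where g: "g = E a b" by (auto simp: carrier_eq)
      with True have "a \<noteq> 0 \<or> b \<noteq> 0" by auto
      from *[OF this] obtain n where n: "\<forall>w\<in>S. w (E a b) = n * wx w \<sigma>" by blast
      show ?thesis using bspec[OF n w(1)] bspec[OF n w(2)] w(3) by (simp add: g)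
    next
      case False
      have "w \<in> P" "w' \<in> P" using w S by auto
      with False show ?thesis
        using place_zero[of w] place_zero[of w'] place_outside[of w g] place_outside[of w' g]
        by (cases "g = 0") auto
    qed
  qed
qed

text \<open>The places centred at the affine point x = r, Y = s of the curve.\<close>

definition finite_branch :: "qbar \<Rightarrow> qbar \<Rightarrow> (ffelem \<Rightarrow> int) set" where
  "finite_branch r s = {w \<in> P. 0 < wx w [:- r, 1:] \<and> vanishing w (- const s) 1}"

lemma finite_branch_local_value:
  assumes "s \<noteq> 0" "a \<noteq> 0 \<or> b \<noteq> 0"
  shows "\<exists>n. \<forall>w\<in>finite_branch r s. w (E (to_fract a) (to_fract b)) = n * wx w [:- r, 1:]"
proof -
  obtain n where "\<forall>w\<in>P. 0 < wx w [:- r, 1:] \<longrightarrow> vanishing w (- const s) 1 \<longrightarrow>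
      w (E (to_fract a) (to_fract b)) = n * wx w [:- r, 1:]"
    using finite_local_value[OF assms] by blast
  then show ?thesis
    unfolding finite_branch_def by (intro exI[of _ n]) simp
qed

lemma finite_place_value:
  assumes w: "w \<in> finite_branch r s" and s: "s \<noteq> 0"
  shows "wx w [:- r, 1:] = 1"
proof -
  have "finite_branch r s \<subseteq> P" by (auto simp: finite_branch_def)
  then have "\<bar>wx w [:- r, 1:]\<bar> = 1"
    using finite_branch_local_value[OF s] w by (intro local_value_uniformizer) auto
  with w show ?thesis by (simp add: finite_branch_def)
qed

lemma finite_place_residue:
  assumes w: "w \<in> P" "0 < wx w [:- r, 1:]" and s: "poly \<Phi> r = s\<^sup>2"
  shows "vanishing w (- const s) 1 \<or> vanishing w (const s) 1"
  using vanishing_iff_root[OF w, of "\<Phi> - [:s\<^sup>2:]"] s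
  by (intro vanishing_square_root[OF w(1)]) (simp_all add: FK_eq)

text \<open>A place over x = r gives Y the residue s or - s; in the second case its conjugate is the
  one sought. Uniqueness is \<open>local_value_unique\<close> with the uniformizer x - r.\<close>

lemma finite_branch_singleton:
  assumes s: "poly \<Phi> r = s\<^sup>2" "s \<noteq> 0"
  shows "\<exists>w. finite_branch r s = {w}"
proof -
  obtain w where w: "w \<in> P" "0 < wx w [:- r, 1:]" using finite_place_exists by blast
  have "\<exists>w. w \<in> finite_branch r s"
  proof (cases "vanishing w (- const s) 1")
    case False
    with finite_place_residue[OF w s(1)] have "vanishing w (- (- const s)) 1" by simp
    then have "vanishing w (- const s) (- 1)"
      using vanishing_minus[OF w(1)] by fastforce
    then have "vanishing (conj_place w) (- const s) 1" by (simp add: vanishing_def)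
    with w conj_place_in show ?thesis
      by (intro exI[of _ "conj_place w"]) (simp add: finite_branch_def)
  qed (use w in \<open>auto simp: finite_branch_def\<close>)
  moreover have "w = w'" if w: "w \<in> finite_branch r s" "w' \<in> finite_branch r s" for w w'
  proof -
    have "finite_branch r s \<subseteq> P" by (auto simp: finite_branch_def)
    moreover have "wx w [:- r, 1:] = wx w' [:- r, 1:]"
      using finite_place_value[OF w(1) s(2)] finite_place_value[OF w(2) s(2)] by simp
    ultimately show ?thesis
      using finite_branch_local_value[OF s(2)] w by (intro local_value_unique) auto
  qed
  ultimately show ?thesis by blast
qed

lemma finite_place_unramified:
  assumes w: "w \<in> P" "0 < wx w [:- r, 1:]" and r: "poly \<Phi> r \<noteq> 0"
  shows "wx w [:- r, 1:] = 1"
proof -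
  obtain s where s: "s\<^sup>2 = poly \<Phi> r" using nth_root_exists[of 2 "poly \<Phi> r"] by auto
  with r have "s \<noteq> 0" "- s \<noteq> 0" by auto
  then show ?thesis
    using finite_place_residue[OF w s[symmetric]] finite_place_value[of w r s]
      finite_place_value[of w r "- s"] w
    by (auto simp: finite_branch_def const_simps(3) simp del: minus_pCons)
qed

section \<open>The two places at infinity\<close>

definition infinite_places :: "(ffelem \<Rightarrow> int) set" where
  "infinite_places = {w \<in> P. wx w [:0, 1:] < 0}"

text \<open>The coefficient of Y in the function Y / x^3, a unit at infinity whose residue is a
  square root of the leading coefficient of F.\<close>

abbreviation (input) inf_Y :: "qbar poly fract" where
  "inf_Y \<equiv> 1 / to_fract [:0, 1:] ^ 3"

definition infinite_branch :: "qbar \<Rightarrow> (ffelem \<Rightarrow> int) set" where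
  "infinite_branch s = {w \<in> infinite_places. vanishing w (- const s) inf_Y}"

lemma infinite_branch_local_value:
  assumes "s \<noteq> 0" "a \<noteq> 0 \<or> b \<noteq> 0"
  shows "\<exists>n. \<forall>w\<in>infinite_branch s. w (E (to_fract a) (to_fract b)) = n * wx w [:0, 1:]"
proof -
  obtain n where "\<forall>w\<in>P. wx w [:0, 1:] < 0 \<longrightarrow> vanishing w (- const s) inf_Y \<longrightarrow>
      w (E (to_fract a) (to_fract b)) = n * wx w [:0, 1:]"
    using infinite_local_value[OF assms] by blast
  then show ?thesis
    unfolding infinite_branch_def infinite_places_def by (intro exI[of _ n]) simp
qed

lemma infinite_branch_value:
  assumes w: "w \<in> infinite_branch s" and s: "s \<noteq> 0"
  shows "wx w [:0, 1:] = - 1"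
proof -
  have "infinite_branch s \<subseteq> P" by (auto simp: infinite_branch_def infinite_places_def)
  then have "\<bar>wx w [:0, 1:]\<bar> = 1"
    using infinite_branch_local_value[OF s] w by (intro local_value_uniformizer) auto
  with w show ?thesis by (simp add: infinite_branch_def infinite_places_def)
qed

lemma infinite_place_residue:
  assumes w: "w \<in> infinite_places" and s: "coeff \<Phi> 6 = s\<^sup>2"
  shows "vanishing w (- const s) inf_Y \<or> vanishing w (const s) inf_Y"
proof (rule vanishing_square_root)
  show "w \<in> P" using w by (simp add: infinite_places_def)
  have "vanishing w (to_fract \<Phi> / to_fract [:0, 1:] ^ 6 - const (coeff \<Phi> 6)) 0"
    using w by (intro vanishing_degree) (simp_all add: infinite_places_def degree_\<Phi>)
  moreover have "to_fract \<Phi> / to_fract [:0, 1:] ^ 6 = inf_Y\<^sup>2 * FK"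
    by (simp add: FK_eq power_divide flip: power_mult)
  ultimately show "vanishing w (inf_Y\<^sup>2 * FK - const (s\<^sup>2)) 0" using s by simp
qed simp

lemma coeff_\<Phi>_6: "coeff \<Phi> 6 \<noteq> 0"
  using leading_coeff_neq_0[of \<Phi>] by (simp add: degree_\<Phi>)

lemma infinite_place_value:
  assumes w: "w \<in> infinite_places"
  shows "wx w [:0, 1:] = - 1"
proof -
  obtain s where s: "s\<^sup>2 = coeff \<Phi> 6" using nth_root_exists[of 2 "coeff \<Phi> 6"] by auto
  with coeff_\<Phi>_6 have "s \<noteq> 0" "- s \<noteq> 0" by auto
  then show ?thesis
    using infinite_place_residue[OF w s[symmetric]] infinite_branch_value[of w s]
      infinite_branch_value[of w "- s"] w
    by (auto simp: infinite_branch_def const_simps(3) simp del: minus_pCons)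
qed

text \<open>The residue s or - s of Y / x^3 splits the infinite places into two disjoint branches,
  exchanged by the involution, and each holds at most one place. As one place exists, each holds
  exactly one.\<close>

lemma card_infinite_places: "finite infinite_places" "card infinite_places = 2"
proof -
  obtain s where s: "s\<^sup>2 = coeff \<Phi> 6" using nth_root_exists[of 2 "coeff \<Phi> 6"] by auto
  with coeff_\<Phi>_6 have s0: "s \<noteq> 0" "- s \<noteq> 0" by auto
  define S where "S = infinite_branch"
  note S_def = S_def infinite_branch_def
  have unique: "w = w'" if w: "w \<in> S c" "w' \<in> S c" and c: "c \<noteq> 0" for c w w'
  proof -
    have "S c \<subseteq> P" by (auto simp: S_def infinite_places_def)
    moreover have "wx w [:0, 1:] = wx w' [:0, 1:]"
      using infinite_place_value[of w] infinite_place_value[of w'] w by (simp add: S_def)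
    ultimately show ?thesis
      using infinite_branch_local_value[OF c] w unfolding S_def(1)
      by (intro local_value_unique) auto
  qed
  have union: "infinite_places = S s \<union> S (- s)"
    using infinite_place_residue[OF _ s[symmetric]]
    by (auto simp: S_def const_simps(3) simp del: minus_pCons)
  have disjoint: "S s \<inter> S (- s) = {}"
    using vanishing_both_roots s0(1)
    by (auto simp: S_def infinite_places_def const_simps(3) simp del: minus_pCons)
  have conj: "conj_place w \<in> S (- c)" if "w \<in> S c" for c w
  proof -
    have "vanishing w (- const c) inf_Y" and w: "w \<in> P" using that by (auto simp: S_def infinite_places_def)
    then have "vanishing w (const c) (- inf_Y)" using vanishing_minus by fastforce
    then show ?thesis
      using that w conj_place_in
      by (simp add: S_def infinite_places_def vanishing_def const_simps(3) del: minus_pCons)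
  qed
  obtain w where "w \<in> infinite_places"
    using infinite_place_exists by (auto simp: infinite_places_def)
  then have "\<exists>w. w \<in> S s" using conj[of _ "- s"] unfolding union by auto
  then obtain w where w: "w \<in> S s" by blast
  then have "S s = {w}" "S (- s) = {conj_place w}"
    using unique s0 conj[OF w] by blast+
  then show "finite infinite_places" "card infinite_places = 2"
    using disjoint by (auto simp: union card_insert_if)
qed

end

section \<open>Divisors given by a pair of polynomials\<close>

lemma card_roots_alg_closed:
  fixes p :: "'a::alg_closed_field poly"
  assumes "p \<noteq> 0" "\<And>r. poly p r = 0 \<Longrightarrow> order r p = 1"
  shows "card {r. poly p r = 0} = degree p"
  using assms
proof (induction "degree p" arbitrary: p)
  case 0
  then obtain c where "p = [:c:]" by (metis degree_eq_zeroE)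
  with 0 show ?case by simp
next
  case (Suc n)
  then obtain r where r: "poly p r = 0"
    using alg_closed_imp_poly_has_root[of p] by auto
  then obtain q where q: "p = [:- r, 1:] * q"
    unfolding poly_eq_0_iff_dvd dvd_def by blast
  with Suc have q0: "q \<noteq> 0" by auto
  have order: "order s p = order s [:- r, 1:] + order s q" for s
    unfolding q using q0 by (intro order_mult no_zero_divisors) auto
  have "order r [:- r, 1:] = 1" using order_power_n_n[of r 1] by simp
  with order[of r] Suc.prems(2)[OF r] have rq: "poly q r \<noteq> 0"
    using q0 by (simp add: order_root)
  have "degree p = Suc (degree q)"
    unfolding q using q0 by (subst degree_mult_eq) auto
  moreover have "order s q = 1" if s: "poly q s = 0" for s
  proof -
    have "s \<noteq> r" using s rq by auto
    then have "order s [:- r, 1:] = 0" by (intro order_0I) simp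
    with order[of s] Suc.prems(2)[of s] s show ?thesis by (simp add: q)
  qed
  ultimately have "card {s. poly q s = 0} = degree q"
    using Suc.hyps q0 by simp
  moreover have "{s. poly p s = 0} = insert r {s. poly q s = 0}"
    unfolding q by auto
  ultimately show ?case
    using rq poly_roots_finite[OF q0] \<open>degree p = Suc (degree q)\<close> by simp
qed

text \<open>A Mumford representation in terms of Y. \<open>v_unit\<close> keeps the points off the
  branch locus, separability of u makes them distinct, and its even degree 2 d lets the infinite
  places enter symmetrically, which serves both degree zero and rationality.\<close>

locale mumford_divisor = hyperelliptic +
  fixes d :: nat and u v :: "rat poly"
  assumes degree_u: "degree u = 2 * d" and d_pos: "0 < d"
    and u_separable: "\<exists>S T. S * u + T * pderiv u = 1"
    and u_dvd: "u dvd F - v\<^sup>2"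
    and v_unit: "\<exists>S T. S * u + T * v = 1"
begin

definition U :: "qbar poly" where "U = base_poly u"
definition V :: "qbar poly" where "V = base_poly v"

lemma degree_U: "degree U = 2 * d"
  by (simp add: U_def degree_u)

lemma U_nonzero: "U \<noteq> 0"
  using degree_U d_pos by auto

lemma order_root_U:
  assumes "poly U r = 0"
  shows "order r U = 1"
proof -
  obtain S T where "S * u + T * pderiv u = 1"
    using u_separable by blast
  then have "base_poly (S * u + T * pderiv u) = 1" by simp
  then have "base_poly S * U + base_poly T * pderiv U = 1"
    by (simp add: base_poly_pderiv U_def)
  then have "poly (base_poly S * U + base_poly T * pderiv U) r = 1" by simp
  with assms have *: "poly (pderiv U) r \<noteq> 0" by auto
  have "order r U = Suc (order r (pderiv U))"
    using assms U_nonzero by (intro order_pderiv)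
  then show ?thesis using * by (simp add: order_0I)
qed

lemma root_U:
  assumes "poly U r = 0"
  shows "poly \<Phi> r = (poly V r)\<^sup>2" "poly V r \<noteq> 0"
proof -
  obtain k where "F - v\<^sup>2 = u * k" using u_dvd by blast
  then have "base_poly (F - v\<^sup>2) = base_poly (u * k)" by simp
  then have "\<Phi> - V\<^sup>2 = U * base_poly k" by (simp add: \<Phi>_def V_def U_def)
  then have "poly (\<Phi> - V\<^sup>2) r = poly (U * base_poly k) r" by simp
  with assms show "poly \<Phi> r = (poly V r)\<^sup>2" by simp
  obtain S T where "S * u + T * v = 1" using v_unit by blast
  then have "base_poly (S * u + T * v) = 1" by simp
  then have "poly (base_poly S * U + base_poly T * V) r = 1" by (simp add: U_def V_def)
  with assms show "poly V r \<noteq> 0" by auto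
qed

text \<open>Given by values at the rational functions u and Y - v instead of by points, so that
  Galois invariance is immediate in \<open>D_invariant\<close>; \<open>zeros_eq\<close> recovers the
  points. Places at infinity do not qualify, as u has a pole there.\<close>

definition zeros :: "(ffelem \<Rightarrow> int) set" where
  "zeros = {w \<in> P. 0 < wx w U \<and> vanishing w (- to_fract V) 1}"

definition D :: divisor where
  "D w = (if w \<in> zeros then 1 else if w \<in> infinite_places then - int d else 0)"

lemma zeros_not_infinite: "w \<in> zeros \<Longrightarrow> 0 \<le> wx w [:0, 1:]"
  using wx_degree[of w U] U_nonzero mult_nonneg_nonpos[of "int (degree U)" "wx w [:0, 1:]"]
  by (cases "wx w [:0, 1:] < 0") (auto simp: zeros_def)

lemma finite_U_value:
  assumes w: "w \<in> P" and x: "0 \<le> wx w [:0, 1:]" and pos: "0 < wx w U"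
  shows "wx w U = 1"
proof -
  obtain r where r: "poly U r = 0" "0 < wx w [:- r, 1:]"
    using root_of_positive[OF w U_nonzero pos x] by blast
  have "poly \<Phi> r \<noteq> 0" using root_U[OF r(1)] by simp
  then show ?thesis
    using wx_order[OF w r(2) U_nonzero] order_root_U[OF r(1)] finite_place_unramified[OF w r(2)] by simp
qed

text \<open>V - V(r) vanishes at w, so V may be replaced by its residue.\<close>

lemma vanishing_V_iff:
  assumes w: "w \<in> P" and r: "0 < wx w [:- r, 1:]"
  shows "vanishing w (- to_fract V) 1 \<longleftrightarrow> vanishing w (- const (poly V r)) 1"
proof -
  have *: "vanishing w (to_fract (V - [:poly V r:])) 0"
    using vanishing_iff_root[OF w r, of "V - [:poly V r:]"] by simp
  then have **: "vanishing w (- to_fract (V - [:poly V r:])) (- 0)"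
    by (rule vanishing_minus[OF w])
  show ?thesis
    using vanishing_add[OF w * , of "- to_fract V" 1] vanishing_add[OF w ** , of "- const (poly V r)" 1]
    by auto
qed

lemma zeros_eq: "zeros = (\<Union>r\<in>{r. poly U r = 0}. finite_branch r (poly V r))"
proof (intro equalityI subsetI)
  fix w
  assume w: "w \<in> zeros"
  then have "w \<in> P" "0 < wx w U" by (auto simp: zeros_def)
  then obtain r where "poly U r = 0" "0 < wx w [:- r, 1:]"
    using root_of_positive U_nonzero zeros_not_infinite[OF w] by blast
  with w show "w \<in> (\<Union>r\<in>{r. poly U r = 0}. finite_branch r (poly V r))"
    using vanishing_V_iff by (auto simp: zeros_def finite_branch_def)
next
  fix w
  assume "w \<in> (\<Union>r\<in>{r. poly U r = 0}. finite_branch r (poly V r))"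
  then obtain r where r: "poly U r = 0" and w: "w \<in> P" "0 < wx w [:- r, 1:]"
    and van: "vanishing w (- const (poly V r)) 1"
    by (auto simp: finite_branch_def)
  from r have "0 < wx w U"
    using wx_order[OF w U_nonzero] order_root_U[OF r] w(2) by simp
  with w van show "w \<in> zeros" using vanishing_V_iff[OF w] by (simp add: zeros_def)
qed

lemma card_roots_U: "card {r. poly U r = 0} = 2 * d"
  using card_roots_alg_closed[OF U_nonzero order_root_U] degree_U by simp

lemma card_zeros: "finite zeros" "card zeros = 2 * d"
proof -
  let ?R = "{r. poly U r = 0}"
  define g where "g r = the_elem (finite_branch r (poly V r))" for r
  have g: "finite_branch r (poly V r) = {g r}" if r: "r \<in> ?R" for r
  proof -
    obtain w where "finite_branch r (poly V r) = {w}"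
      using finite_branch_singleton root_U[of r] r by blast
    then show ?thesis by (simp add: g_def)
  qed
  have "zeros = (\<Union>r\<in>?R. {g r})"
    unfolding zeros_eq by (rule SUP_cong[OF refl g])
  then have eq: "zeros = g ` ?R" by blast
  have "inj_on g ?R"
  proof (rule inj_onI)
    fix r r'
    assume r: "r \<in> ?R" "r' \<in> ?R" "g r = g r'"
    then have "g r \<in> finite_branch r (poly V r)" "g r \<in> finite_branch r' (poly V r')"
      using g by auto
    then have w: "g r \<in> P" "0 < wx (g r) [:- r, 1:]" and "vanishing (g r) (to_fract [:- r', 1:]) 0"
      by (auto simp: finite_branch_def vanishing_def)
    then have "poly [:- r', 1:] r = 0" using vanishing_iff_root[OF w] by blast
    then show "r = r'" by simp
  qed
  moreover have "finite ?R" using U_nonzero by (rule poly_roots_finite)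
  ultimately show "finite zeros" "card zeros = 2 * d"
    unfolding eq by (simp_all add: card_image card_roots_U)
qed

text \<open>The 2 d places with coefficient 1 balance the two with coefficient - d.\<close>

lemma D_in_carrier: "D \<in> carrier (degree_zero_divisors h f)"
proof -
  have disjoint: "zeros \<inter> infinite_places = {}"
    using zeros_not_infinite by (force simp: infinite_places_def)
  have support: "{w. D w \<noteq> 0} = zeros \<union> infinite_places"
    using d_pos by (auto simp: D_def)
  have "(\<Sum>w\<in>zeros \<union> infinite_places. D w) = (\<Sum>w\<in>zeros. D w) + (\<Sum>w\<in>infinite_places. D w)"
    using card_zeros card_infinite_places disjoint by (intro sum.union_disjoint)
  also have "(\<Sum>w\<in>zeros. D w) = (\<Sum>w\<in>zeros. 1)"
    by (rule sum.cong) (simp_all add: D_def)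
  also have "(\<Sum>w\<in>infinite_places. D w) = (\<Sum>w\<in>infinite_places. - int d)"
    using disjoint by (intro sum.cong) (auto simp: D_def)
  finally have "(\<Sum>w | D w \<noteq> 0. D w) = 0"
    unfolding support using card_zeros card_infinite_places by simp
  moreover have "zeros \<union> infinite_places \<subseteq> P" by (auto simp: zeros_def infinite_places_def)
  ultimately show ?thesis
    using card_zeros card_infinite_places by (simp add: degree_zero_divisors_def support)
qed

text \<open>With G = a + b Y, the norm identity shows that the values of G and its conjugate add up
  to n w(u). At a finite place off u both are nonnegative, hence 0. Over a root of u,
  \<open>unit\<close> says that a - b v does not vanish: this is the residue of the conjugate at
  points with Y = v and that of G at points with Y = - v, so G has value n at the former and 0 at
  the latter. At infinity the degree bounds are forced to be equalities.\<close>

lemma multiple_principal: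
  fixes a b :: "rat poly" and c :: rat
  assumes norm: "a\<^sup>2 - b\<^sup>2 * F = smult c (u ^ n)" and c: "c \<noteq> 0"
    and deg: "degree a \<le> n * d" "b = 0 \<or> degree b + 3 \<le> n * d"
    and unit: "\<exists>S T. S * u + T * (a - b * v) = 1" and w: "w \<in> P"
  shows "w (E (base_change a) (base_change b)) = int n * D w"
proof -
  define A B where "A = base_poly a" and "B = base_poly b"
  have "base_poly (a\<^sup>2 - b\<^sup>2 * F) = base_poly (smult c (u ^ n))"
    using norm by simp
  then have norm': "A\<^sup>2 - B\<^sup>2 * \<Phi> = smult (to_ac c) (U ^ n)"
    by (simp add: A_def B_def \<Phi>_def U_def)
  have "smult (to_ac c) (U ^ n) \<noteq> 0" using c U_nonzero by simp
  then have AB: "A \<noteq> 0 \<or> B \<noteq> 0" unfolding norm'[symmetric] by auto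
  have sum: "w (E (to_fract A) (to_fract B)) + w (E (to_fract A) (- to_fract B)) = int n * wx w U"
    using place_norm[OF w, of "to_fract A" "to_fract B"] AB
      wx_smult[OF w, of "to_ac c" "U ^ n"] wx_power[OF w U_nonzero] c
    by (simp add: norm_to_fract norm' del: to_fract_power to_fract_mult to_fract_diff)
  have goal: "w (E (base_change a) (base_change b)) = w (E (to_fract A) (to_fract B))"
    by (simp add: A_def B_def base_change_conv)
  show ?thesis
  proof (cases "0 \<le> wx w [:0, 1:]")
    case x: True
    then have D: "D w = (if w \<in> zeros then 1 else 0)"
      by (simp add: D_def infinite_places_def)
    have ge: "0 \<le> w (E (to_fract p) (to_fract q))" if "p \<noteq> 0 \<or> q \<noteq> 0" for p q
      using integral_elem[OF w x, of p q] that by (auto simp: integral_def)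
    have nonneg: "0 \<le> w (E (to_fract A) (to_fract B))" "0 \<le> w (E (to_fract A) (- to_fract B))"
      using ge[of A B] ge[of A "- B"] AB by auto
    show ?thesis
    proof (cases "0 < wx w U")
      case False
      with ge[of U 0] U_nonzero have "wx w U = 0" by simp
      with sum have "w (E (to_fract A) (to_fract B)) + w (E (to_fract A) (- to_fract B)) = 0" by simp
      with nonneg have "w (E (to_fract A) (to_fract B)) = 0" by linarith
      moreover have "w \<notin> zeros" using False by (simp add: zeros_def)
      ultimately show ?thesis using D goal by simp
    next
      case pos: True
      then obtain r where r: "poly U r = 0" "0 < wx w [:- r, 1:]"
        using root_of_positive[OF w U_nonzero _ x] by blast
      obtain S T where "S * u + T * (a - b * v) = 1" using unit by blast
      then have "base_poly (S * u + T * (a - b * v)) = 1" by simp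
      then have "poly (base_poly S * U + base_poly T * (A - B * V)) r = 1"
        by (simp add: U_def V_def A_def B_def)
      with r(1) have nz: "poly (A - B * V) r \<noteq> 0" by auto
      have residue: "vanishing w (to_fract p - const (poly p r)) 0" for p
        using vanishing_iff_root[OF w r(2), of "p - [:poly p r:]"] by simp
      note combine = residue_combine[OF w residue residue]
      show ?thesis
      proof (cases "w \<in> zeros")
        case True
        then have Y: "vanishing w (- const (poly V r)) 1"
          using vanishing_V_iff[OF w r(2)] by (simp add: zeros_def)
        have "w (E (to_fract A) (to_fract (- B) * 1)) = 0"
          using value_of_residue[OF w _ combine[OF Y, of A "- B"]] nz by simp
        with sum finite_U_value[OF w x pos] True D goal show ?thesis by simp
      next
        case False
        then have "\<not> vanishing w (- to_fract V) 1"
          using w pos by (simp add: zeros_def)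
        then have "vanishing w (const (poly V r)) 1"
          using vanishing_V_iff[OF w r(2)] finite_place_residue[OF w r(2) root_U(1)[OF r(1)]] by simp
        then have "vanishing w (- const (- poly V r)) 1" by (simp add: const_simps(3) del: minus_pCons)
        from value_of_residue[OF w _ combine[OF this, of A B]]
        have "w (E (to_fract A) (to_fract B)) = 0" using nz by simp
        with False D goal show ?thesis by simp
      qed
    qed
  next
    case False
    then have inf: "w \<in> infinite_places" using w by (simp add: infinite_places_def)
    then have x: "wx w [:0, 1:] = - 1" by (rule infinite_place_value)
    have "w \<notin> zeros" using False zeros_not_infinite by blast
    then have D: "D w = - int d" using inf by (simp add: D_def)
    have Y: "w (E 0 1) = - 3"
      using place_mult[OF w, of 0 1 0 1] wx_degree[OF w _ \<Phi>_nonzero] x by (simp add: FK_eq degree_\<Phi>)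
    have int_deg: "int (degree a) \<le> int (n * d)" "b = 0 \<or> int (degree b) + 3 \<le> int (n * d)"
      using deg by linarith+
    \<comment> \<open>Stated for B' so that it covers both B and - B, that is, G and its
      conjugate.\<close>
    have ge: "- int (n * d) \<le> w (E (to_fract A) (to_fract B'))"
      if B': "degree B' = degree B" "B' = 0 \<longleftrightarrow> B = 0" for B'
    proof -
      have a: "A = 0 \<or> - int (n * d) \<le> wx w A"
        using wx_degree[OF w, of A] x int_deg(1) by (cases "A = 0") (auto simp: A_def)
      have b: "B' = 0 \<or> - int (n * d) \<le> w (E 0 (to_fract B'))"
        using place_mult[OF w, of "to_fract B'" 0 0 1] wx_degree[OF w, of B'] x int_deg(2) Y B'
        by (cases "B = 0") (auto simp: B_def)
      show ?thesis
        using a b AB B'(2) place_add[OF w, of "to_fract A" 0 0 "to_fract B'"]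
        by (cases "A = 0"; cases "B' = 0") auto
    qed
    have "wx w U = - int (2 * d)"
      using wx_degree[OF w _ U_nonzero] x by (simp add: degree_U)
    \<comment> \<open>Two terms that are at least - n d and have sum - 2 n d are both equal to - n
      d.\<close>
    with sum ge[of B] ge[of "- B"] have "w (E (to_fract A) (to_fract B)) = - int (n * d)"
      by (simp add: algebra_simps)
    with D goal show ?thesis by simp
  qed
qed

end

section \<open>Divisor classes\<close>

context hyperelliptic
begin

abbreviation DZ :: "divisor monoid" where "DZ \<equiv> degree_zero_divisors h f"
abbreviation PD :: "divisor set" where "PD \<equiv> principal_divisors h f"

lemma DZ_iff:
  "D \<in> carrier DZ \<longleftrightarrow> finite {v. D v \<noteq> 0} \<and> (\<forall>v. v \<notin> P \<longrightarrow> D v = 0) \<and> (\<Sum>v | D v \<noteq> 0. D v) = 0"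
  by (auto simp: degree_zero_divisors_def)

lemma DZ_simps [simp]: "D \<otimes>\<^bsub>DZ\<^esub> D' = (\<lambda>v. D v + D' v)" "\<one>\<^bsub>DZ\<^esub> = (\<lambda>_. 0)"
  by (simp_all add: degree_zero_divisors_def)

lemma DZ_add:
  assumes D: "D \<in> carrier DZ" "D' \<in> carrier DZ"
  shows "(\<lambda>v. D v + D' v) \<in> carrier DZ"
proof -
  let ?S = "{v. D v \<noteq> 0} \<union> {v. D' v \<noteq> 0}"
  have fin: "finite ?S" using D by (simp add: DZ_iff)
  have sub: "{v. D v + D' v \<noteq> 0} \<subseteq> ?S" by auto
  have "(\<Sum>v | D v + D' v \<noteq> 0. D v + D' v) = (\<Sum>v\<in>?S. D v + D' v)"
    using fin sub by (intro sum.mono_neutral_left) auto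
  also have "\<dots> = (\<Sum>v\<in>?S. D v) + (\<Sum>v\<in>?S. D' v)" by (rule sum.distrib)
  also have "(\<Sum>v\<in>?S. D v) = (\<Sum>v | D v \<noteq> 0. D v)"
    using fin by (intro sum.mono_neutral_right) auto
  also have "(\<Sum>v\<in>?S. D' v) = (\<Sum>v | D' v \<noteq> 0. D' v)"
    using fin by (intro sum.mono_neutral_right) auto
  finally have "(\<Sum>v | D v + D' v \<noteq> 0. D v + D' v) = 0"
    using D by (simp add: DZ_iff)
  moreover have "finite {v. D v + D' v \<noteq> 0}" using fin sub by (rule rev_finite_subset)
  ultimately show ?thesis using D by (simp add: DZ_iff)
qed

lemma DZ_uminus: "D \<in> carrier DZ \<Longrightarrow> (\<lambda>v. - D v) \<in> carrier DZ"
  by (simp add: DZ_iff sum_negf)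

lemma DZ_scale: "D \<in> carrier DZ \<Longrightarrow> (\<lambda>v. k * D v) \<in> carrier DZ"
  by (cases "k = 0") (simp_all add: DZ_iff flip: sum_distrib_left)

lemma DZ_comm_group: "comm_group DZ"
proof (rule comm_groupI)
  fix D
  assume "D \<in> carrier DZ"
  then show "\<exists>D'\<in>carrier DZ. D' \<otimes>\<^bsub>DZ\<^esub> D = \<one>\<^bsub>DZ\<^esub>"
    by (intro bexI[of _ "\<lambda>v. - D v"] DZ_uminus) simp_all
qed (simp_all add: DZ_add ac_simps, simp add: DZ_iff)

lemma PD_iff:
  "D \<in> PD \<longleftrightarrow> D \<in> carrier DZ \<and> (\<exists>a b. (a \<noteq> 0 \<or> b \<noteq> 0) \<and> (\<forall>v\<in>P. D v = v (E a b)))"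
  unfolding principal_divisors_def by (auto simp: carrier_eq) blast+

lemma PD_add:
  assumes "D \<in> PD" "D' \<in> PD"
  shows "(\<lambda>v. D v + D' v) \<in> PD"
proof -
  obtain a b where ab: "a \<noteq> 0 \<or> b \<noteq> 0" "\<forall>v\<in>P. D v = v (E a b)"
    using assms(1) unfolding PD_iff by blast
  obtain c d where cd: "c \<noteq> 0 \<or> d \<noteq> 0" "\<forall>v\<in>P. D' v = v (E c d)"
    using assms(2) unfolding PD_iff by blast
  \<comment> \<open>The norm is multiplicative, so the product of nonzero elements is
    nonzero.\<close>
  have "(a * c + b * d * FK)\<^sup>2 - (a * d + b * c)\<^sup>2 * FK = (a\<^sup>2 - b\<^sup>2 * FK) * (c\<^sup>2 - d\<^sup>2 * FK)"
    by (simp add: power2_eq_square algebra_simps)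
  then have nz: "a * c + b * d * FK \<noteq> 0 \<or> a * d + b * c \<noteq> 0"
    using norm_nonzero[OF ab(1)] norm_nonzero[OF cd(1)] by auto
  have "D v + D' v = v (E (a * c + b * d * FK) (a * d + b * c))" if "v \<in> P" for v
    using place_mult[OF that ab(1) cd(1)] ab(2) cd(2) that by simp
  with nz show ?thesis
    using assms DZ_add by (auto simp: PD_iff simp del: ff_elem_eq_iff)
qed

lemma PD_uminus:
  assumes "D \<in> PD"
  shows "(\<lambda>v. - D v) \<in> PD"
proof -
  obtain a b where ab: "a \<noteq> 0 \<or> b \<noteq> 0" "\<forall>v\<in>P. D v = v (E a b)"
    using assms unfolding PD_iff by blast
  obtain c d where cd: "c \<noteq> 0 \<or> d \<noteq> 0" and eq: "a * c + b * d * FK = 1" "a * d + b * c = 0"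
    using inverse_exists[OF ab(1)] by blast
  have "- D v = v (E c d)" if v: "v \<in> P" for v
    using place_mult[OF v ab(1) cd] place_1[OF v] ab(2) v unfolding eq by simp
  with cd show ?thesis
    using assms DZ_uminus unfolding PD_iff by blast
qed

lemma PD_zero: "(\<lambda>_. 0) \<in> PD"
  unfolding PD_iff using place_1 by (intro conjI exI[of _ 1] exI[of _ 0]) (simp_all add: DZ_iff)

lemma PD_scale: "D \<in> PD \<Longrightarrow> (\<lambda>v. int k * D v) \<in> PD"
proof (induction k)
  case (Suc k)
  then show ?case using PD_add[of D "\<lambda>v. int k * D v"] by (simp add: algebra_simps)
qed (simp add: PD_zero)

lemma PD_subgroup: "subgroup PD DZ"
proof -
  interpret DZ: comm_group DZ by (rule DZ_comm_group)
  have inv: "inv\<^bsub>DZ\<^esub> D = (\<lambda>v. - D v)" if "D \<in> carrier DZ" for D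
    using that DZ_uminus by (intro DZ.inv_equality) simp_all
  show ?thesis
  proof (rule DZ.subgroupI)
    show sub: "PD \<subseteq> carrier DZ" by (auto simp: PD_iff)
    show "PD \<noteq> {}" using PD_zero by blast
    show "inv\<^bsub>DZ\<^esub> D \<in> PD" if "D \<in> PD" for D
      using PD_uminus[OF that] inv sub that by auto
    show "D \<otimes>\<^bsub>DZ\<^esub> D' \<in> PD" if "D \<in> PD" "D' \<in> PD" for D D'
      using PD_add[OF that] by simp
  qed
qed

lemma PD_normal: "PD \<lhd> DZ"
  by (rule comm_group.normal_iff_subgroup[OF DZ_comm_group, THEN iffD2, OF PD_subgroup])

text \<open>Written out as a coset so that images under \<open>act_divisor\<close> can be computed
  element by element.\<close>

definition divisor_class :: "divisor \<Rightarrow> divisor set" where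
  "divisor_class D = {\<lambda>v. D' v + D v | D'. D' \<in> PD}"

lemma divisor_class_conv: "divisor_class D = PD #>\<^bsub>DZ\<^esub> D"
  by (auto simp: divisor_class_def r_coset_def)

lemma jacobian_group: "group (jacobian h f)"
  unfolding jacobian_def by (rule normal.factorgroup_is_group[OF PD_normal])

lemma divisor_class_in: "D \<in> carrier DZ \<Longrightarrow> divisor_class D \<in> carrier (jacobian h f)"
  unfolding jacobian_def divisor_class_conv by (auto simp: FactGroup_def RCOSETS_def)

lemma divisor_class_power:
  assumes D: "D \<in> carrier DZ"
  shows "divisor_class D [^]\<^bsub>jacobian h f\<^esub> (n :: nat) = divisor_class (\<lambda>v. int n * D v)"
proof (induction n)
  case 0
  have "divisor_class (\<lambda>_. 0) = PD" by (simp add: divisor_class_def)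
  then show ?case by (simp add: jacobian_def FactGroup_def)
next
  case (Suc n)
  interpret J: group "jacobian h f" by (rule jacobian_group)
  have "divisor_class D [^]\<^bsub>jacobian h f\<^esub> Suc n =
      divisor_class (\<lambda>v. int n * D v) <#>\<^bsub>DZ\<^esub> divisor_class D"
    using Suc by (simp add: jacobian_def FactGroup_def)
  also have "\<dots> = divisor_class (\<lambda>v. int n * D v + D v)"
    unfolding divisor_class_conv
    using normal.rcos_sum[OF PD_normal DZ_scale[OF D] D] by simp
  finally show ?case by (simp add: algebra_simps)
qed

lemma divisor_class_eq_one:
  assumes D: "D \<in> carrier DZ"
  shows "divisor_class D = \<one>\<^bsub>jacobian h f\<^esub> \<longleftrightarrow> D \<in> PD"
proof -
  interpret DZ: comm_group DZ by (rule DZ_comm_group)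
  have "divisor_class D = PD \<longleftrightarrow> D \<in> PD"
    unfolding divisor_class_conv
    using DZ.coset_join1[OF _ D PD_subgroup] DZ.coset_join2[OF D PD_subgroup]
      subgroup.subset[OF PD_subgroup] by blast
  then show ?thesis by (simp add: jacobian_def FactGroup_def)
qed

section \<open>Automorphisms of the function field acting on places\<close>

definition place_pullback :: "(ffelem \<Rightarrow> ffelem) \<Rightarrow> (ffelem \<Rightarrow> int) \<Rightarrow> ffelem \<Rightarrow> int" where
  "place_pullback \<phi> v a = (if a \<in> carrier L then v (\<phi> a) else 0)"

lemma act_divisor_eq: "act_divisor h f \<phi> D v = (if v \<in> P then D (place_pullback \<phi> v) else 0)"
proof -
  have "place_pullback \<phi> v = (\<lambda>a. if a \<in> carrier L then v (\<phi> a) else 0)"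
    by (rule ext) (rule place_pullback_def)
  then show ?thesis by (simp add: act_divisor_def)
qed

text \<open>What is kept of a Galois lift: enough to pull back places to places, and shared by the
  inverse map, so that both directions use the same lemmas.\<close>

definition const_iso :: "(ffelem \<Rightarrow> ffelem) \<Rightarrow> bool" where
  "const_iso \<phi> \<longleftrightarrow> \<phi> \<in> ring_iso L L \<and> (\<forall>c. \<exists>c'. \<phi> (ff_const c) = ff_const c')"

lemma one_L: "\<one>\<^bsub>L\<^esub> = E 1 0"
  by (simp add: function_field_def ff_elem_def)

lemma zero_carrier [simp]: "0 \<in> carrier L"
  using elem_carrier[of h 0 0 f] by (simp del: elem_carrier)

lemma ring_iso_zero:
  assumes "\<phi> \<in> ring_iso L L"
  shows "\<phi> 0 = 0"
proof -
  have "\<phi> (E 0 0 \<oplus>\<^bsub>L\<^esub> E 0 0) = \<phi> (E 0 0) \<oplus>\<^bsub>L\<^esub> \<phi> (E 0 0)"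
    using assms by (intro ring_iso_memE(3)) simp_all
  moreover have "E 0 0 \<oplus>\<^bsub>L\<^esub> E 0 0 = E 0 0"
    by (simp only: add_elem add_0)
  ultimately have "\<phi> 0 = \<phi> 0 \<oplus>\<^bsub>L\<^esub> \<phi> 0" by (simp only: ff_elem_0_0)
  then have "\<phi> 0 = \<phi> 0 + \<phi> 0"
    unfolding function_field_def ring.select_convs .
  then show ?thesis by (metis add_cancel_right_right)
qed

lemma ring_iso_nonzero:
  assumes \<phi>: "\<phi> \<in> ring_iso L L" and "g \<in> carrier L - {0}"
  shows "\<phi> g \<in> carrier L - {0}"
proof -
  have bij: "bij_betw \<phi> (carrier L) (carrier L)" using \<phi> by (rule ring_iso_memE(5))
  have "\<phi> g \<noteq> \<phi> 0"
    using bij assms(2) zero_carrier unfolding bij_betw_def inj_on_def by blast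
  then show ?thesis using assms ring_iso_memE(1)[OF \<phi>] ring_iso_zero[OF \<phi>] by simp
qed

lemma place_pullback_in:
  assumes \<phi>: "const_iso \<phi>" and v: "v \<in> P"
  shows "place_pullback \<phi> v \<in> P"
proof -
  have iso: "\<phi> \<in> ring_iso L L" using \<phi> by (simp add: const_iso_def)
  have bij: "bij_betw \<phi> (carrier L) (carrier L)" using iso by (rule ring_iso_memE(5))
  have pb: "place_pullback \<phi> v (E a b) = v (\<phi> (E a b))" for a b
    by (simp add: place_pullback_def)
  have nz: "\<exists>a' b'. \<phi> (E a b) = E a' b' \<and> (a' \<noteq> 0 \<or> b' \<noteq> 0)" if "a \<noteq> 0 \<or> b \<noteq> 0" for a b
  proof -
    have "\<phi> (E a b) \<in> carrier L - {0}"
      using that by (intro ring_iso_nonzero[OF iso]) auto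
    then show ?thesis by (auto simp: carrier_eq)
  qed
  show ?thesis
  proof (rule placesI)
    fix a b c d :: "qbar poly fract"
    assume ab: "a \<noteq> 0 \<or> b \<noteq> 0" and cd: "c \<noteq> 0 \<or> d \<noteq> 0"
    obtain a' b' where ab': "\<phi> (E a b) = E a' b'" "a' \<noteq> 0 \<or> b' \<noteq> 0" using nz[OF ab] by blast
    obtain c' d' where cd': "\<phi> (E c d) = E c' d'" "c' \<noteq> 0 \<or> d' \<noteq> 0" using nz[OF cd] by blast
    have "\<phi> (E a b \<otimes>\<^bsub>L\<^esub> E c d) = \<phi> (E a b) \<otimes>\<^bsub>L\<^esub> \<phi> (E c d)"
      using iso by (intro ring_iso_memE(2)) simp_all
    then show "place_pullback \<phi> v (E (a * c + b * d * FK) (a * d + b * c)) =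
        place_pullback \<phi> v (E a b) + place_pullback \<phi> v (E c d)"
      using place_mult[OF v ab'(2) cd'(2)] by (simp add: pb ab' cd')
    assume "a + c \<noteq> 0 \<or> b + d \<noteq> 0"
    from nz[OF this] obtain e e' where ee: "\<phi> (E (a + c) (b + d)) = E e e'" "e \<noteq> 0 \<or> e' \<noteq> 0" by blast
    have "\<phi> (E a b \<oplus>\<^bsub>L\<^esub> E c d) = \<phi> (E a b) \<oplus>\<^bsub>L\<^esub> \<phi> (E c d)"
      using iso by (intro ring_iso_memE(3)) simp_all
    then have eq: "e = a' + c'" "e' = b' + d'" using ee by (simp_all add: ab' cd')
    show "min (place_pullback \<phi> v (E a b)) (place_pullback \<phi> v (E c d)) \<le> place_pullback \<phi> v (E (a + c) (b + d))"
      using place_add[OF v ab'(2) cd'(2)] ee unfolding pb ab' cd' ee eq by blast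
  next
    fix c :: qbar
    assume c: "c \<noteq> 0"
    obtain c' where c': "\<phi> (ff_const c) = ff_const c'" using \<phi> unfolding const_iso_def by blast
    obtain a' b' where "\<phi> (E (const c) 0) = E a' b'" "a' \<noteq> 0 \<or> b' \<noteq> 0" using nz[of "const c" 0] c by auto
    with c' have "c' \<noteq> 0" unfolding ff_const_elem[of _ h] by auto
    then show "wx (place_pullback \<phi> v) [:c:] = 0"
      unfolding pb using c' place_const[OF v] by (simp add: ff_const_elem[of _ h])
  next
    fix n
    obtain a b where ab: "a \<noteq> 0 \<or> b \<noteq> 0" "v (E a b) = n" using place_surj[OF v] by blast
    have "E a b \<in> \<phi> ` carrier L" using bij by (simp add: bij_betw_def)
    then obtain c d where cd: "E a b = \<phi> (E c d)" by (auto simp: carrier_eq)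
    have "c \<noteq> 0 \<or> d \<noteq> 0"
    proof (rule ccontr)
      assume "\<not> (c \<noteq> 0 \<or> d \<noteq> 0)"
      then have "E a b = 0" using cd ring_iso_zero[OF iso] by simp
      with ab show False by simp
    qed
    with cd ab show "\<exists>a b. (a \<noteq> 0 \<or> b \<noteq> 0) \<and> place_pullback \<phi> v (E a b) = n"
      unfolding pb by metis
  next
    show "place_pullback \<phi> v 0 = 0"
      using ring_iso_zero[OF iso] place_zero[OF v] by (simp add: place_pullback_def)
  qed (simp add: place_pullback_def)
qed

end

section \<open>Galois action\<close>

context hyperelliptic
begin

lemma lifts_const_iso:
  assumes "\<phi> \<in> galois_lifts h f"
  shows "const_iso \<phi>"
  using assms by (auto simp: galois_lifts_def const_iso_def)

lemma lifts_inverse_const_iso: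
  assumes "\<phi> \<in> galois_lifts h f"
  shows "\<exists>\<psi>. const_iso \<psi> \<and> (\<forall>g\<in>carrier L. \<phi> (\<psi> g) = g)"
proof -
  have iso: "\<phi> \<in> ring_iso L L" using assms by (simp add: galois_lifts_def)
  have bij: "bij_betw \<phi> (carrier L) (carrier L)" using iso by (rule ring_iso_memE(5))
  define \<psi> where "\<psi> = inv_into (carrier L) \<phi>"
  have in_L: "\<psi> g \<in> carrier L" and right: "\<phi> (\<psi> g) = g" if "g \<in> carrier L" for g
    using that bij by (auto simp: \<psi>_def bij_betw_def inv_into_into f_inv_into_f)
  have left: "\<psi> g' = g" if "g \<in> carrier L" "\<phi> g = g'" for g g'
    using that bij by (auto simp: \<psi>_def bij_betw_def)
  have closed: "x \<otimes>\<^bsub>L\<^esub> y \<in> carrier L" "x \<oplus>\<^bsub>L\<^esub> y \<in> carrier L"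
    if "x \<in> carrier L" "y \<in> carrier L" for x y
    using that by (auto simp: carrier_eq)
  have "\<psi> \<in> ring_iso L L"
  proof (rule ring_iso_memI)
    fix x y
    assume xy: "x \<in> carrier L" "y \<in> carrier L"
    show "\<psi> (x \<otimes>\<^bsub>L\<^esub> y) = \<psi> x \<otimes>\<^bsub>L\<^esub> \<psi> y"
      using xy in_L by (intro left) (simp_all add: closed ring_iso_memE(2)[OF iso] right)
    show "\<psi> (x \<oplus>\<^bsub>L\<^esub> y) = \<psi> x \<oplus>\<^bsub>L\<^esub> \<psi> y"
      using xy in_L by (intro left) (simp_all add: closed ring_iso_memE(3)[OF iso] right)
  next
    show "\<psi> \<one>\<^bsub>L\<^esub> = \<one>\<^bsub>L\<^esub>"
      by (intro left ring_iso_memE(4)[OF iso]) (simp add: one_L)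
    show "bij_betw \<psi> (carrier L) (carrier L)"
      unfolding \<psi>_def by (rule bij_betw_inv_into[OF bij])
  qed (rule in_L)
  moreover have "\<exists>c'. \<psi> (ff_const c) = ff_const c'" for c
  proof -
    obtain \<sigma> where \<sigma>: "\<sigma> \<in> absolute_galois" "\<forall>c. \<phi> (ff_const c) = ff_const (\<sigma> c)"
      using assms by (auto simp: galois_lifts_def)
    \<comment> \<open>Constants stay constants under the inverse because \<sigma> is onto.\<close>
    then have "surj \<sigma>" by (simp add: absolute_galois_def bij_is_surj)
    then obtain c' where "c = \<sigma> c'" by (rule surjE)
    with \<sigma>(2) have "\<psi> (ff_const c) = ff_const c'"
      by (intro left) (simp_all add: ff_const_elem[of _ h])
    then show ?thesis by blast
  qed
  ultimately show ?thesis using right unfolding const_iso_def by blast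
qed

lemma place_pullback_inverse:
  assumes \<psi>: "\<psi> \<in> ring_iso L L" and inv: "\<forall>g\<in>carrier L. \<phi> (\<psi> g) = g" and v: "v \<in> P"
  shows "place_pullback \<psi> (place_pullback \<phi> v) = v"
proof
  fix g
  show "place_pullback \<psi> (place_pullback \<phi> v) g = v g"
    using ring_iso_memE(1)[OF \<psi>, of g] inv place_outside[OF v, of g]
    by (simp add: place_pullback_def)
qed

lemma const_iso_inverse:
  assumes "const_iso \<psi>" "const_iso \<phi>" "\<forall>g\<in>carrier L. \<phi> (\<psi> g) = g"
  shows "\<forall>g\<in>carrier L. \<psi> (\<phi> g) = g"
proof
  fix g assume g: "g \<in> carrier L"
  have iso: "\<phi> \<in> ring_iso L L" "\<psi> \<in> ring_iso L L" using assms by (auto simp: const_iso_def)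
  have "\<phi> g \<in> carrier L" "\<psi> (\<phi> g) \<in> carrier L"
    using g ring_iso_memE(1)[OF iso(1)] ring_iso_memE(1)[OF iso(2)] by auto
  moreover have "inj_on \<phi> (carrier L)" using ring_iso_memE(5)[OF iso(1)] by (simp add: bij_betw_def)
  ultimately show "\<psi> (\<phi> g) = g"
    using assms(3) g by (metis inj_onD)
qed

text \<open>If D is the divisor of g, the transformed divisor is that of \<phi>(g), since the pulled
  back place has the value v(\<phi>(g)) at g. Finite support and degree zero are carried over by the
  bijection v -> v o \<phi> of places, whose inverse comes from \<psi>.\<close>

lemma act_divisor_PD:
  assumes \<phi>: "const_iso \<phi>" and \<psi>: "const_iso \<psi>" and inv: "\<forall>g\<in>carrier L. \<phi> (\<psi> g) = g"
    and D: "D \<in> PD"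
  shows "act_divisor h f \<phi> D \<in> PD"
proof -
  note inv' = const_iso_inverse[OF \<psi> \<phi> inv]
  have iso: "\<phi> \<in> ring_iso L L" "\<psi> \<in> ring_iso L L" using \<phi> \<psi> by (auto simp: const_iso_def)
  let ?D = "act_divisor h f \<phi> D"
  let ?p = "place_pullback \<phi>" and ?q = "place_pullback \<psi>"
  have DC: "D \<in> carrier DZ" using D by (simp add: PD_iff)
  have qp: "?q (?p v) = v" and pq: "?p (?q v) = v" if "v \<in> P" for v
    using place_pullback_inverse[OF iso(2) inv that] place_pullback_inverse[OF iso(1) inv' that] by auto
  have bij: "bij_betw ?p {v. ?D v \<noteq> 0} {v. D v \<noteq> 0}"
  proof (rule bij_betw_byWitness[where f' = ?q])
    show "?q ` {v. D v \<noteq> 0} \<subseteq> {v. ?D v \<noteq> 0}"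
    proof safe
      fix v assume v: "D v \<noteq> 0" "?D (?q v) = 0"
      then have "v \<in> P" using DC by (auto simp: DZ_iff)
      with v place_pullback_in[OF \<psi>] pq show False by (simp add: act_divisor_eq)
    qed
  qed (use qp pq DC in \<open>auto simp: act_divisor_eq DZ_iff split: if_splits\<close>)
  have "(\<Sum>v | ?D v \<noteq> 0. ?D v) = (\<Sum>v | ?D v \<noteq> 0. D (?p v))"
    by (intro sum.cong) (auto simp: act_divisor_eq split: if_splits)
  also have "\<dots> = (\<Sum>v | D v \<noteq> 0. D v)"
    by (rule sum.reindex_bij_betw[OF bij])
  finally have "(\<Sum>v | ?D v \<noteq> 0. ?D v) = 0"
    using DC by (simp add: DZ_iff)
  moreover have "finite {v. ?D v \<noteq> 0}"
    using bij_betw_finite[OF bij] DC by (simp add: DZ_iff)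
  ultimately have carrier: "?D \<in> carrier DZ"
    by (simp add: DZ_iff) (simp add: act_divisor_eq)
  obtain a b where ab: "a \<noteq> 0 \<or> b \<noteq> 0" "\<forall>v\<in>P. D v = v (E a b)"
    using D unfolding PD_iff by blast
  have "\<phi> (E a b) \<in> carrier L - {0}"
    using ab(1) by (intro ring_iso_nonzero[OF iso(1)]) auto
  then obtain c d where cd: "\<phi> (E a b) = E c d" "c \<noteq> 0 \<or> d \<noteq> 0" by (auto simp: carrier_eq)
  have "?D v = v (E c d)" if v: "v \<in> P" for v
    using ab(2) place_pullback_in[OF \<phi> v] v cd(1) by (simp add: act_divisor_eq place_pullback_def)
  with cd(2) carrier show ?thesis unfolding PD_iff by blast
qed

lemma act_divisor_add:
  "act_divisor h f \<phi> (\<lambda>v. D v + D' v) = (\<lambda>v. act_divisor h f \<phi> D v + act_divisor h f \<phi> D' v)"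
  by (auto simp: act_divisor_eq)

text \<open>D itself is fixed and principal divisors go to principal divisors, which gives one
  inclusion; for the other, each element of the class is the image of the one obtained by applying
  \<psi> to its principal part.\<close>

lemma divisor_class_rational:
  assumes D: "D \<in> carrier DZ"
    and invariant: "\<And>\<phi> v. \<phi> \<in> galois_lifts h f \<Longrightarrow> v \<in> P \<Longrightarrow> D (place_pullback \<phi> v) = D v"
  shows "divisor_class D \<in> jacobian_rational_points h f"
proof -
  have "act_divisor h f \<phi> ` divisor_class D = divisor_class D" if \<phi>: "\<phi> \<in> galois_lifts h f" for \<phi>
  proof -
    have act_D: "act_divisor h f \<phi> D = D"
      using invariant[OF \<phi>] D by (auto simp: act_divisor_eq DZ_iff)
    obtain \<psi> where \<psi>: "const_iso \<psi>" "\<forall>g\<in>carrier L. \<phi> (\<psi> g) = g"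
      using lifts_inverse_const_iso[OF \<phi>] by blast
    note \<phi>' = lifts_const_iso[OF \<phi>]
    note inv' = const_iso_inverse[OF \<psi>(1) \<phi>' \<psi>(2)]
    have act_class: "act_divisor h f \<phi> (\<lambda>v. D' v + D v) = (\<lambda>v. act_divisor h f \<phi> D' v + D v)" for D'
      by (simp add: act_divisor_add act_D)
    have inverse: "act_divisor h f \<phi> (act_divisor h f \<psi> D') = D'" if "D' \<in> PD" for D'
    proof
      fix v
      have "\<psi> \<in> ring_iso L L" using \<psi>(1) by (simp add: const_iso_def)
      then show "act_divisor h f \<phi> (act_divisor h f \<psi> D') v = D' v"
        using that place_pullback_inverse[of \<psi> \<phi> v] \<psi>(2) place_pullback_in[OF \<phi>', of v]
        by (auto simp: act_divisor_eq PD_iff DZ_iff)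
    qed
    show ?thesis
    proof (intro equalityI subsetI)
      fix Z assume "Z \<in> act_divisor h f \<phi> ` divisor_class D"
      then obtain D' where D': "D' \<in> PD" "Z = (\<lambda>v. act_divisor h f \<phi> D' v + D v)"
        by (auto simp: divisor_class_def act_class)
      with act_divisor_PD[OF \<phi>' \<psi>] show "Z \<in> divisor_class D"
        unfolding divisor_class_def by blast
    next
      fix Z assume "Z \<in> divisor_class D"
      then obtain D' where D': "D' \<in> PD" "Z = (\<lambda>v. D' v + D v)"
        by (auto simp: divisor_class_def)
      let ?D = "act_divisor h f \<psi> D'"
      have "Z = act_divisor h f \<phi> (\<lambda>v. ?D v + D v)"
        using inverse D' by (simp add: act_class)
      moreover have "?D \<in> PD" by (rule act_divisor_PD[OF \<psi>(1) \<phi>' inv' D'(1)])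
      ultimately show "Z \<in> act_divisor h f \<phi> ` divisor_class D"
        unfolding divisor_class_def by blast
    qed
  qed
  then show ?thesis
    using divisor_class_in[OF D] by (simp add: jacobian_rational_points_def)
qed

text \<open>14 = 28 / 2 and 4 = 28 / 7 are the maximal proper divisors of 28, so an order that
  divides 28 but neither of them is 28.\<close>

lemma divisor_class_order:
  assumes D: "D \<in> carrier DZ"
    and "(\<lambda>v. 28 * D v) \<in> PD" "(\<lambda>v. 14 * D v) \<notin> PD" "(\<lambda>v. 4 * D v) \<notin> PD"
  shows "group.ord (jacobian h f) (divisor_class D) = 28"
proof -
  interpret J: group "jacobian h f" by (rule jacobian_group)
  have *: "J.ord (divisor_class D) dvd n \<longleftrightarrow> (\<lambda>v. int n * D v) \<in> PD" for n
    using J.pow_eq_id[OF divisor_class_in[OF D], of n] divisor_class_eq_one[OF DZ_scale[OF D]]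
    by (simp add: divisor_class_power[OF D])
  have dvd: "J.ord (divisor_class D) dvd 28" "\<not> J.ord (divisor_class D) dvd 14"
    "\<not> J.ord (divisor_class D) dvd 4"
    using assms(2-4) by (simp_all add: *)
  obtain k where k: "28 = J.ord (divisor_class D) * k"
    using dvd(1) by (rule dvdE)
  have "\<not> 2 dvd k"
  proof
    assume "2 dvd k"
    then obtain j where "k = 2 * j" by (rule dvdE)
    with k have "14 = j * J.ord (divisor_class D)" by simp
    with dvd(2) show False by (metis dvd_triv_right)
  qed
  moreover have "\<not> 7 dvd k"
  proof
    assume "7 dvd k"
    then obtain j where "k = 7 * j" by (rule dvdE)
    with k have "4 = j * J.ord (divisor_class D)" by simp
    with dvd(3) show False by (metis dvd_triv_right)
  qed
  ultimately have "coprime 2 k" "coprime 7 k"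
    by (auto intro!: prime_imp_coprime)
  then have "coprime (2 * (2 * 7)) k" by (simp only: coprime_mult_left_iff)
  then have "coprime k 28" by (simp add: coprime_commute)
  moreover have "k dvd 28" by (subst k) simp
  ultimately have "k = 1" by (simp add: coprime_absorb_left)
  with k show ?thesis by simp
qed

text \<open>Rational constants and x are fixed, hence rational polynomials in x by Horner induction;
  Y is fixed as h + 2 y.\<close>

lemma lifts_fix_rational:
  assumes \<phi>: "\<phi> \<in> galois_lifts h f"
  shows "\<phi> (E (base_change p) (base_change q)) = E (base_change p) (base_change q)"
proof -
  have iso: "\<phi> \<in> ring_iso L L" and x: "\<phi> ff_x = ff_x" and y: "\<phi> ff_y = ff_y"
    using \<phi> by (simp_all add: galois_lifts_def)
  obtain \<sigma> where \<sigma>: "\<sigma> \<in> absolute_galois" "\<forall>c. \<phi> (ff_const c) = ff_const (\<sigma> c)"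
    using \<phi> by (auto simp: galois_lifts_def)
  have add: "\<phi> (E (a + c) (b + d)) = E a b \<oplus>\<^bsub>L\<^esub> E c d"
    if "\<phi> (E a b) = E a b" "\<phi> (E c d) = E c d" for a b c d
    using ring_iso_memE(3)[OF iso, of "E a b" "E c d"] that by simp
  have mult: "\<phi> (E (a * c + b * d * FK) (a * d + b * c)) = E a b \<otimes>\<^bsub>L\<^esub> E c d"
    if "\<phi> (E a b) = E a b" "\<phi> (E c d) = E c d" for a b c d
    using ring_iso_memE(2)[OF iso, of "E a b" "E c d"] that by simp
  have fix_const: "\<phi> (E (const (to_ac q)) 0) = E (const (to_ac q)) 0" for q
    using \<sigma> by (simp add: absolute_galois_def flip: ff_const_elem)
  have fix_poly: "\<phi> (E (base_change p) 0) = E (base_change p) 0" for p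
  proof (induction p)
    case 0
    then show ?case using ring_iso_zero[OF iso] by (simp add: base_change_conv)
  next
    case (pCons c p)
    have "\<phi> (E (to_fract [:0, 1:]) 0) = E (to_fract [:0, 1:]) 0"
      using x by (simp flip: ff_x_elem)
    from mult[OF this pCons(2)] fix_const[of c]
    have "\<phi> (E (const (to_ac c) + to_fract [:0, 1:] * base_change p) 0) =
        E (const (to_ac c) + to_fract [:0, 1:] * base_change p) 0"
      using add[of "const (to_ac c)" 0 "to_fract [:0, 1:] * base_change p" 0] by simp
    moreover have "base_change (pCons c p) = const (to_ac c) + to_fract [:0, 1:] * base_change p"
      by (simp add: base_change_conv flip: to_fract_add to_fract_mult)
    ultimately show ?case by simp
  qed
  have two: "\<phi> (E 2 0) = E 2 0"
    using fix_poly[of 2] by (simp add: base_change_conv)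
  \<comment> \<open>These are the coordinates of y.\<close>
  have "\<phi> (E (- base_change h / 2) (1 / 2)) = E (- base_change h / 2) (1 / 2)"
    using y by (simp only: flip: ff_y_elem)
  from mult[OF two this] have "\<phi> (E (- base_change h) 1) = E (- base_change h) 1" by simp
  from add[OF fix_poly[of h] this] have Y: "\<phi> (E 0 1) = E 0 1" by simp
  from mult[OF fix_poly[of q] Y] have "\<phi> (E 0 (base_change q)) = E 0 (base_change q)" by simp
  from add[OF fix_poly[of p] this] show ?thesis by simp
qed

lemma pullback_rational:
  assumes "\<phi> \<in> galois_lifts h f"
  shows "place_pullback \<phi> v (E (to_fract (base_poly p)) (to_fract (base_poly q)))
    = v (E (to_fract (base_poly p)) (to_fract (base_poly q)))"
  using lifts_fix_rational[OF assms] by (simp add: place_pullback_def base_change_conv)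

end

lemma (in mumford_divisor) D_invariant:
  assumes \<phi>: "\<phi> \<in> galois_lifts h f" and w: "w \<in> P"
  shows "D (place_pullback \<phi> w) = D w"
proof -
  have P: "place_pullback \<phi> w \<in> P"
    using place_pullback_in[OF lifts_const_iso[OF \<phi>] w] .
  note pb = pullback_rational[OF \<phi>, of w]
  have "place_pullback \<phi> w \<in> zeros \<longleftrightarrow> w \<in> zeros"
    using P w pb[of u 0] pb[of "- v" 1] by (simp add: zeros_def vanishing_def U_def V_def)
  moreover have "place_pullback \<phi> w \<in> infinite_places \<longleftrightarrow> w \<in> infinite_places"
    using P w pb[of "[:0, 1:]" 0] by (simp add: infinite_places_def)
  ultimately show ?thesis by (simp add: D_def)
qed

section \<open>Functions with simple poles at infinity\<close>

context hyperelliptic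
begin

text \<open>At a place above a root of the denominator, integrality forces the numerator to vanish
  too, and the common factor cancels.\<close>

lemma integral_imp_poly:
  assumes "\<And>w. w \<in> P \<Longrightarrow> 0 \<le> wx w [:0, 1:] \<Longrightarrow> integral w r 0"
  shows "\<exists>p. r = to_fract p"
proof -
  have "\<exists>p. r = to_fract p" if "r = to_fract p / to_fract q" "q \<noteq> 0" for p q
    using that
  proof (induction "degree q" arbitrary: p q rule: less_induct)
    case less
    show ?case
    proof (cases "degree q = 0 \<or> r = 0")
      case True
      then consider "r = 0" | c where "q = [:c:]" by (metis degree_eq_zeroE)
      then show ?thesis
      proof cases
        case 2
        have "to_fract [:c:] * to_fract [:inverse c:] = 1"
          using 2 less.prems(2) by (simp flip: to_fract_mult one_pCons)
        then have "r = to_fract p * to_fract [:inverse c:]"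
          using 2 less.prems by (simp add: divide_inverse inverse_unique)
        then have "r = to_fract (p * [:inverse c:])" by (simp only: to_fract_mult)
        then show ?thesis by blast
      qed (metis to_fract_0)
    next
      case False
      then obtain \<rho> where \<rho>: "poly q \<rho> = 0"
        using alg_closed_imp_poly_has_root[of q] by auto
      obtain w where w: "w \<in> P" "0 < wx w [:- \<rho>, 1:]" using finite_place_exists by blast
      have "p \<noteq> 0" using False less.prems by auto
      have "vanishing w (to_fract q) 0" using vanishing_iff_root[OF w] \<rho> by blast
      moreover have "integral w r 0" using assms[OF w(1) x_integral[OF w]] .
      ultimately have "vanishing w (to_fract q * r + 0 * 0 * FK) (to_fract q * 0 + 0 * r)"
        by (rule vanishing_mult[OF w(1)])
      then have "vanishing w (to_fract p) 0" using less.prems by simp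
      then have "poly p \<rho> = 0" using vanishing_iff_root[OF w] by blast
      with \<rho> obtain p' q' where eq: "p = [:- \<rho>, 1:] * p'" "q = [:- \<rho>, 1:] * q'"
        unfolding poly_eq_0_iff_dvd dvd_def by blast
      have q': "q' \<noteq> 0" using eq less.prems by auto
      have "degree q = Suc (degree q')"
        unfolding eq using q' by (subst degree_mult_eq) auto
      moreover have "r = to_fract p' / to_fract q'"
        using less.prems unfolding eq to_fract_mult by simp
      ultimately show ?thesis using less.hyps[of q' p'] q' by simp
    qed
  qed
  moreover obtain p q where "r = Fract p q" "q \<noteq> 0" by (cases r) auto
  ultimately show ?thesis by (auto simp: Fract_conv_to_fract)
qed

text \<open>
  The function \<open>x\<close> has a simple pole at each of the two infinite places, so this is the
  description of the Riemann-Roch space of the polar divisor of \<open>x\<close>, which is canonical.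
\<close>

lemma linear_of_simple_poles:
  assumes ab: "a \<noteq> 0 \<or> b \<noteq> 0"
    and fin: "\<And>w. w \<in> P \<Longrightarrow> 0 \<le> wx w [:0, 1:] \<Longrightarrow> 0 \<le> w (E a b)"
    and inf: "\<And>w. w \<in> infinite_places \<Longrightarrow> - 1 \<le> w (E a b)"
  shows "\<exists>p. degree p \<le> 1 \<and> a = to_fract p \<and> b = 0"
proof -
  have fin': "0 \<le> w (E a (- b))" if "w \<in> P" "0 \<le> wx w [:0, 1:]" for w
    using fin[OF conj_place_in[OF that(1)]] that(2) by simp
  have inf': "- 1 \<le> w (E a (- b))" if "w \<in> infinite_places" for w
    using inf[of "conj_place w"] conj_place_in that by (simp add: infinite_places_def)
  \<comment> \<open>Adding the conjugates shows that 2 a is integral, hence so is b Y = (a + b Y) -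
    a, and its square b^2 F lies in K again.\<close>
  have "integral w (2 * a) 0" and ib: "integral w (b\<^sup>2 * FK) 0" if w: "w \<in> P" "0 \<le> wx w [:0, 1:]" for w
  proof -
    have i: "integral w a b" "integral w a (- b)" using fin[OF w] fin'[OF w] by (simp_all add: integral_def)
    from integral_add[OF w(1) i] show *: "integral w (2 * a) 0" by simp
    have "integral w (const (1 / 2) * (2 * a) + 0 * 0 * FK) (const (1 / 2) * 0 + 0 * (2 * a))"
      by (rule integral_mult[OF w(1) integral_const[OF w(1)] *])
    moreover have "const (1 / 2) * 2 = 1"
    proof -
      have "const (1 / 2) * const 2 = const 1"
        unfolding const_simps(2)[symmetric] by simp
      then show ?thesis by (metis numeral_poly one_pCons to_fract_1 to_fract_numeral)
    qed
    ultimately have "integral w a 0" by (simp flip: mult.assoc)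
    from integral_add[OF w(1) i(1) integral_minus[OF w(1) this]] have "integral w 0 b" by simp
    from integral_mult[OF w(1) this this] show "integral w (b\<^sup>2 * FK) 0" by (simp add: power2_eq_square)
  qed
  then obtain p' where p': "2 * a = to_fract p'" using integral_imp_poly by blast
  obtain B where B: "b\<^sup>2 * FK = to_fract B" using integral_imp_poly ib by blast
  obtain w where w: "w \<in> infinite_places"
    using infinite_place_exists by (auto simp: infinite_places_def)
  then have wP: "w \<in> P" and wx: "wx w [:0, 1:] = - 1" 
    using infinite_place_value by (auto simp: infinite_places_def)
  have double: "- 1 \<le> w (E 0 (2 * b)) \<or> b = 0"
  proof (cases "b = 0")
    case False
    have "b + b = 2 * b" by simp
    then have "min (w (E a b)) (w (E (- a) b)) \<le> w (E 0 (2 * b))"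
      using place_add[OF wP, of a b "- a" b] False by simp
    moreover have "w (E (- a) b) = w (E a (- b))"
      using place_minus[OF wP, of a "- b"] by simp
    ultimately show ?thesis using inf[OF w] inf'[OF w] by linarith
  qed simp
  have "const 2 = 2" by (metis numeral_poly to_fract_numeral)
  then have "w (E 2 0) = 0" using place_const[OF wP, of 2] by simp
  then have "w (E 0 (2 * b)) = w (E 0 b) \<or> b = 0"
    using place_scale[OF wP, of 2 0 b] by auto
  moreover have "w (E (b\<^sup>2 * FK) 0) = 2 * w (E 0 b) \<or> b = 0"
    using place_mult[OF wP, of 0 b 0 b] by (auto simp: power2_eq_square)
  ultimately have "b = 0 \<or> wx w B \<ge> - 2" using double by (auto simp: B)
  \<comment> \<open>b Y has at most a simple pole at infinity, so its square B has degree at most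
    2.\<close>
  then have degB: "b = 0 \<or> degree B \<le> 2"
    using wx_degree[OF wP, of B] wx B by (cases "B = 0") auto
  have "b = 0"
  proof (rule ccontr)
    assume b: "b \<noteq> 0"
    then have B0: "B \<noteq> 0" using B by (auto simp: FK_eq)
    obtain p q where pq: "b = Fract p q" "q \<noteq> 0" by (cases b) auto
    have "to_fract (p\<^sup>2 * \<Phi>) = to_fract (B * q\<^sup>2)"
      using B pq by (simp add: Fract_conv_to_fract FK_eq field_simps)
    then have eq: "p\<^sup>2 * \<Phi> = B * q\<^sup>2" by (simp only: to_fract_eq_iff)
    have p: "p \<noteq> 0" using pq b by (auto simp: Fract_conv_to_fract)
    \<comment> \<open>The order of B = b^2 F at a root of F is odd, hence nonzero. So B would have
      the six roots of F, against its degree.\<close>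
    have "poly B r = 0" if r: "poly \<Phi> r = 0" for r
    proof -
      have "order r (p\<^sup>2 * \<Phi>) = 2 * order r p + 1"
        using p by (simp add: power2_eq_square order_mult order_root_\<Phi>[OF r])
      moreover have "order r (B * q\<^sup>2) = order r B + 2 * order r q"
        using B0 pq(2) by (simp add: power2_eq_square order_mult)
      ultimately have "2 * order r p + 1 = order r B + 2 * order r q"
        using eq by metis
      then have "order r B \<noteq> 0" by presburger
      then show ?thesis using B0 by (simp add: order_root)
    qed
    then have "card {r. poly \<Phi> r = 0} \<le> card {r. poly B r = 0}"
      using B0 by (intro card_mono poly_roots_finite) auto
    moreover have "card {r. poly \<Phi> r = 0} = 6"
      using card_roots_alg_closed[OF \<Phi>_nonzero order_root_\<Phi>] by (simp add: degree_\<Phi>)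
    ultimately show False using card_poly_roots_bound[OF B0] degB b by simp
  qed
  with ab have a: "a \<noteq> 0" by simp
  define p where "p = smult (1 / 2) p'"
  have "p' = 2 * p"
    by (simp add: p_def numeral_poly)
  then have "2 * a = 2 * to_fract p" using p' by simp
  then have ap: "a = to_fract p" by simp
  with a have "p \<noteq> 0" by auto
  then have "degree p \<le> 1"
    using wx_degree[OF wP, of p] wx inf[OF w] ap \<open>b = 0\<close> by simp
  with ap \<open>b = 0\<close> show ?thesis by blast
qed

end

section \<open>Divisors that are not principal\<close>

context mumford_divisor
begin

lemma D_cases:
  "w \<in> P \<Longrightarrow> 0 \<le> wx w [:0, 1:] \<Longrightarrow> 0 \<le> D w" "w \<in> infinite_places \<Longrightarrow> D w = - int d"
  using zeros_not_infinite[of w] by (auto simp: D_def infinite_places_def)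

text \<open>For d = 1 a function with divisor D has at most simple poles at infinity, so it is a
  polynomial in x and its divisor is invariant under the involution. But the zero with Y = v has a
  conjugate with Y = - v, and v does not vanish there.\<close>

lemma not_principal:
  assumes "d = 1"
  shows "D \<notin> PD"
proof
  assume "D \<in> PD"
  then obtain a b where ab: "a \<noteq> 0 \<or> b \<noteq> 0" and D: "\<forall>w\<in>P. D w = w (E a b)"
    unfolding PD_iff by blast
  have "\<exists>p. degree p \<le> 1 \<and> a = to_fract p \<and> b = 0"
  proof (rule linear_of_simple_poles[OF ab])
    show "0 \<le> w (E a b)" if "w \<in> P" "0 \<le> wx w [:0, 1:]" for w
      using D_cases(1)[OF that] bspec[OF D that(1)] by simp
    show "- 1 \<le> w (E a b)" if "w \<in> infinite_places" for w
      using D_cases(2)[OF that] bspec[OF D, of w] that assms by (simp add: infinite_places_def)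
  qed
  then have b: "b = 0" by blast
  have "zeros \<noteq> {}" using card_zeros d_pos by auto
  then obtain w where w: "w \<in> zeros" by blast
  then have wP: "w \<in> P" and van: "vanishing w (- to_fract V) 1" by (auto simp: zeros_def)
  have "D (conj_place w) = D w"
    using bspec[OF D wP] bspec[OF D conj_place_in[OF wP]] b by simp
  also have "\<dots> = 1" using w by (simp add: D_def)
  finally have "conj_place w \<in> zeros" by (auto simp: D_def split: if_splits)
  then have van: "vanishing (conj_place w) (- to_fract V) 1" by (simp add: zeros_def)
  obtain r where r: "poly U r = 0" and w': "0 < wx w [:- r, 1:]" "vanishing w (- const (poly V r)) 1"
    using w unfolding zeros_eq finite_branch_def by blast
  have "vanishing (conj_place w) (- const (poly V r)) 1"
    using van vanishing_V_iff[OF conj_place_in[OF wP], of r] w' by simp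
  then have "vanishing w (- const (poly V r)) (- 1)" by (simp add: vanishing_def)
  from vanishing_minus[OF wP this] have "vanishing w (const (poly V r)) 1" by simp
  with vanishing_both_roots[OF wP w'(2)] root_U(2)[OF r] show False by blast
qed

text \<open>
  The function \<open>G = q a1 + b0 Y\<close> satisfies \<open>G\<^sup>2 = q (a + b Y)\<close>, so its divisor is \<open>2 D\<close> plus half of
  the divisor of \<open>q\<close>. If \<open>2 D\<close> were the divisor of \<open>g\<close>, then \<open>G / g\<close> would have at most simple poles
  at infinity and be a polynomial of degree at most 1 vanishing at both roots of \<open>q\<close>.
\<close>

lemma double_not_principal:
  fixes q A a1 b0 :: "rat poly"
  assumes F: "F = q * A" and q: "degree q = 2" and nz: "a1 \<noteq> 0 \<or> b0 \<noteq> 0"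
    and D: "\<And>w. w \<in> P \<Longrightarrow>
      w (E (base_change (q * a1\<^sup>2 + A * b0\<^sup>2)) (base_change (2 * a1 * b0))) = 4 * D w"
  shows "(\<lambda>w. 2 * D w) \<notin> PD"
proof
  assume "(\<lambda>w. 2 * D w) \<in> PD"
  then obtain a b where ab: "a \<noteq> 0 \<or> b \<noteq> 0" and ab_D: "\<forall>w\<in>P. 2 * D w = w (E a b)"
    unfolding PD_iff by blast
  define Q where "Q = base_poly q"
  have "\<Phi> = base_poly (q * A)" unfolding F[symmetric] \<Phi>_def ..
  then have \<Phi>: "\<Phi> = Q * base_poly A" by (simp add: Q_def)
  have Q: "Q \<noteq> 0" "degree Q = 2" using q by (auto simp: Q_def)
  define g1 g2 where "g1 = base_change (q * a1)" and "g2 = base_change b0"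
  define e1 e2 where "e1 = base_change (q * a1\<^sup>2 + A * b0\<^sup>2)" and "e2 = base_change (2 * a1 * b0)"
  have g: "g1 \<noteq> 0 \<or> g2 \<noteq> 0"
    using nz Q by (auto simp: g1_def g2_def base_change_conv Q_def)
  have GG: "g1 * g1 + g2 * g2 * FK = to_fract Q * e1" "g1 * g2 + g2 * g1 = to_fract Q * e2"
    by (simp_all add: g1_def g2_def e1_def e2_def FK_eq \<Phi> Q_def base_change_conv
        power2_eq_square algebra_simps)
  have gnz: "g1 * g1 + g2 * g2 * FK \<noteq> 0 \<or> g1 * g2 + g2 * g1 \<noteq> 0"
  proof -
    have "(g1 * g1 + g2 * g2 * FK)\<^sup>2 - (g1 * g2 + g2 * g1)\<^sup>2 * FK = (g1\<^sup>2 - g2\<^sup>2 * FK)\<^sup>2"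
      by (simp add: power2_eq_square algebra_simps)
    then show ?thesis using norm_nonzero[OF g] by auto
  qed
  then have e: "e1 \<noteq> 0 \<or> e2 \<noteq> 0" unfolding GG by auto
  have G: "2 * w (E g1 g2) = wx w Q + 4 * D w" if w: "w \<in> P" for w
    using place_mult[OF w g g] place_scale[OF w _ e, of "to_fract Q"] D[OF w] Q
    unfolding GG e1_def[symmetric] e2_def[symmetric] by simp
  obtain c d where cd: "c \<noteq> 0 \<or> d \<noteq> 0" "a * c + b * d * FK = 1" "a * d + b * c = 0"
    using inverse_exists[OF ab] by blast
  \<comment> \<open>c + d Y is the inverse of g = a + b Y, so k1 + k2 Y is the quotient G /
    g.\<close>
  define k1 k2 where "k1 = g1 * c + g2 * d * FK" and "k2 = g1 * d + g2 * c"
  have k: "2 * w (E k1 k2) = wx w Q" if w: "w \<in> P" for w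
  proof -
    have "w (E a b) + w (E c d) = 0"
      using place_mult[OF w ab cd(1)] place_1[OF w] unfolding cd by simp
    then show ?thesis
      using place_mult[OF w g cd(1)] G[OF w] bspec[OF ab_D w] by (simp add: k1_def k2_def)
  qed
  have knz: "k1 \<noteq> 0 \<or> k2 \<noteq> 0"
  proof -
    have "k1\<^sup>2 - k2\<^sup>2 * FK = (g1\<^sup>2 - g2\<^sup>2 * FK) * (c\<^sup>2 - d\<^sup>2 * FK)"
      by (simp add: k1_def k2_def power2_eq_square algebra_simps)
    then show ?thesis using norm_nonzero[OF g] norm_nonzero[OF cd(1)] by auto
  qed
  have "\<exists>p. degree p \<le> 1 \<and> k1 = to_fract p \<and> k2 = 0"
  proof (rule linear_of_simple_poles[OF knz])
    show "0 \<le> w (E k1 k2)" if "w \<in> P" "0 \<le> wx w [:0, 1:]" for w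
      using k[OF that(1)] integral_poly[OF that, of Q] Q by (auto simp: integral_def)
    show "- 1 \<le> w (E k1 k2)" if w: "w \<in> infinite_places" for w
    proof -
      have "w \<in> P" "wx w [:0, 1:] = - 1"
        using infinite_place_value[OF w] w by (auto simp: infinite_places_def)
      then show ?thesis using k[of w] wx_degree[of w Q] Q by simp
    qed
  qed
  then obtain p where p: "degree p \<le> 1" "k1 = to_fract p" "k2 = 0" by blast
  with knz have p0: "p \<noteq> 0" by auto
  have "poly p r = 0" if r: "poly Q r = 0" for r
  proof -
    obtain w where w: "w \<in> P" "0 < wx w [:- r, 1:]" using finite_place_exists by blast
    have "vanishing w (to_fract Q) 0" using vanishing_iff_root[OF w] r by blast
    then have "0 < wx w p" using k[OF w(1)] Q p by (simp add: vanishing_def)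
    then show ?thesis using vanishing_iff_root[OF w, of p] by (simp add: vanishing_def)
  qed
  then have "card {r. poly Q r = 0} \<le> card {r. poly p r = 0}"
    using p0 by (intro card_mono poly_roots_finite) auto
  \<comment> \<open>The roots of q are among those of F, hence simple, so there are two of
    them.\<close>
  moreover have "card {r. poly Q r = 0} = degree Q"
  proof (rule card_roots_alg_closed[OF Q(1)])
    fix r assume r: "poly Q r = 0"
    have "order r \<Phi> = order r Q + order r (base_poly A)"
      unfolding \<Phi> using \<Phi>_nonzero unfolding \<Phi> by (rule order_mult)
    moreover have "poly \<Phi> r = 0" using r by (simp add: \<Phi>)
    moreover have "order r Q \<noteq> 0" using r Q(1) by (simp add: order_root)
    ultimately show "order r Q = 1" using order_root_\<Phi>[of r] by simp
  qed
  ultimately show False using card_poly_roots_bound[OF p0] p(1) Q(2) by simp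
qed

end

text \<open>Reduces each curve to polynomial identities. \<open>square\<close> says that (q a1 + b0
  Y)^2 = q (a4 + b4 Y); it follows that the norm of a4 + b4 Y is (q a1^2 - A b0^2)^2, so every c4
  below is a square. The conditions \<open>unit4\<close> and \<open>unit7\<close> separate the
  points of the divisor from their conjugates.\<close>

lemma (in hyperelliptic) rational_point_of_order_28:
  fixes q A a1 b0 a4 b4 a7 b7 :: "rat poly"
  assumes D4: "mumford_divisor h f F d4 u4 v4" and D7: "mumford_divisor h f F 1 u7 v7"
    and q: "F = q * A" "degree q = 2"
    and square: "q * a1\<^sup>2 + A * b0\<^sup>2 = a4" "2 * a1 * b0 = b4"
    and norm4: "a4\<^sup>2 - b4\<^sup>2 * F = smult c4 (u4 ^ 4)" "c4 \<noteq> 0"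
    and deg4: "degree a4 \<le> 4 * d4" "degree b4 + 3 \<le> 4 * d4"
    and unit4: "\<exists>S T. S * u4 + T * (a4 - b4 * v4) = 1"
    and norm7: "a7\<^sup>2 - b7\<^sup>2 * F = smult c7 (u7 ^ 7)" "c7 \<noteq> 0"
    and deg7: "degree a7 \<le> 7" "degree b7 + 3 \<le> 7"
    and unit7: "\<exists>S T. S * u7 + T * (a7 - b7 * v7) = 1"
  shows "\<exists>Z \<in> jacobian_rational_points h f. group.ord (jacobian h f) Z = 28"
proof -
  interpret D4: mumford_divisor h f F d4 u4 v4 by (rule D4)
  interpret D7: mumford_divisor h f F 1 u7 v7 by (rule D7)
  have div4: "w (E (base_change a4) (base_change b4)) = int 4 * D4.D w"
    if "w \<in> P" for w
    using D4.multiple_principal[OF norm4 deg4(1) disjI2[OF deg4(2)] unit4 that] .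
  have div7: "w (E (base_change a7) (base_change b7)) = int 7 * D7.D w" if "w \<in> P" for w
    using D7.multiple_principal[OF norm7, unfolded mult_1_right, OF deg7(1) disjI2[OF deg7(2)] unit7 that] .
  have u4: "u4 \<noteq> 0" and u7: "u7 \<noteq> 0"
    using D4.degree_u D4.d_pos D7.degree_u by auto
  have nz4: "base_change a4 \<noteq> 0 \<or> base_change b4 \<noteq> 0"
  proof (rule ccontr)
    assume "\<not> ?thesis"
    then have "a4 = 0" "b4 = 0" by (simp_all add: base_change_conv)
    then have "smult c4 (u4 ^ 4) = 0" unfolding norm4(1)[symmetric] by simp
    then show False using norm4(2) u4 by simp
  qed
  have nz7: "base_change a7 \<noteq> 0 \<or> base_change b7 \<noteq> 0"
  proof (rule ccontr)
    assume "\<not> ?thesis"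
    then have "a7 = 0" "b7 = 0" by (simp_all add: base_change_conv)
    then have "smult c7 (u7 ^ 7) = 0" unfolding norm7(1)[symmetric] by simp
    then show False using norm7(2) u7 by simp
  qed
  have PD4: "(\<lambda>v. 4 * D4.D v) \<in> PD"
    unfolding PD_iff using div4 nz4 DZ_scale[OF D4.D_in_carrier, of 4] by fastforce
  have PD7: "(\<lambda>v. 7 * D7.D v) \<in> PD"
    unfolding PD_iff using div7 nz7 DZ_scale[OF D7.D_in_carrier, of 7] by fastforce
  have n4: "(\<lambda>w. 2 * D4.D w) \<notin> PD"
  proof (rule D4.double_not_principal[OF q])
    show "a1 \<noteq> 0 \<or> b0 \<noteq> 0" using nz4 square by (auto simp: base_change_conv)
  qed (use div4 square in simp)
  have n7: "D7.D \<notin> PD" by (rule D7.not_principal) simp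
  define D where "D v = D4.D v + D7.D v" for v
  have D: "D \<in> carrier DZ"
    unfolding D_def by (rule DZ_add[OF D4.D_in_carrier D7.D_in_carrier])
  have diff: "(\<lambda>v. D v - D' v) \<in> PD" if "D \<in> PD" "D' \<in> PD" for D D'
    using PD_add[OF that(1) PD_uminus[OF that(2)]] by simp
  show ?thesis
  proof (intro bexI[of _ "divisor_class D"] divisor_class_rational divisor_class_order D)
    have "(\<lambda>v. int 7 * (4 * D4.D v) + int 4 * (7 * D7.D v)) \<in> PD"
      by (intro PD_add PD_scale PD4 PD7)
    then show "(\<lambda>v. 28 * D v) \<in> PD" by (simp add: D_def algebra_simps)
    show "(\<lambda>v. 14 * D v) \<notin> PD"
    proof
      assume "(\<lambda>v. 14 * D v) \<in> PD"
      \<comment> \<open>14 D - 2 (7 D7) - 3 (4 D4) = 2 D4.\<close>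
      from diff[OF diff[OF this PD_scale[OF PD7, of 2]] PD_scale[OF PD4, of 3]]
      have "(\<lambda>v. 2 * D4.D v) \<in> PD" by (simp add: D_def algebra_simps)
      with n4 show False by simp
    qed
    show "(\<lambda>v. 4 * D v) \<notin> PD"
    proof
      assume "(\<lambda>v. 4 * D v) \<in> PD"
      \<comment> \<open>2 (4 D - 4 D4) - 7 D7 = 8 D7 - 7 D7 = D7.\<close>
      from diff[OF PD_scale[OF diff[OF this PD4], of 2] PD7]
      have "D7.D \<in> PD" by (simp add: D_def algebra_simps)
      with n7 show False by simp
    qed
    show "D (place_pullback \<phi> v) = D v" if "\<phi> \<in> galois_lifts h f" "v \<in> P" for \<phi> v
      using D4.D_invariant[OF that] D7.D_invariant[OF that] by (simp add: D_def)
  qed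
qed

text \<open>If p^2 divides F, then p divides F and its derivative, hence the Bezout combination
  1.\<close>

lemma (in hyperelliptic) genus_two:
  assumes "degree h \<le> 3" "degree f \<le> 6"
  shows "genus_two_model h f"
proof -
  obtain S T where ST: "S * F + T * pderiv F = 1" using bezout by blast
  have "squarefree F"
    unfolding squarefree_def
  proof (intro allI impI)
    fix p assume "p\<^sup>2 dvd F"
    then obtain k where k: "F = p\<^sup>2 * k" by (rule dvdE)
    then have "F = p * (p * k)" by (simp add: power2_eq_square mult.assoc)
    moreover from this have "pderiv F = p * pderiv (p * k) + p * k * pderiv p"
      by (simp add: pderiv_mult)
    ultimately have "p dvd S * F + T * pderiv F"
      by (metis dvd_add dvd_mult dvd_triv_left mult.assoc)
    then show "p dvd 1" using ST by simp
  qed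
  then show ?thesis
    using assms degree_F unfolding genus_two_model_def F_eq by simp
qed

section \<open>The five curves\<close>

text \<open>Allows integral cofactors, the denominators being collected in c. For the separability
  of a quadratic u with leading coefficient m, they come from u'^2 - 4 m u = disc u, up to sign and
  a common factor.\<close>

lemma bezoutI:
  fixes p q S T :: "rat poly"
  assumes "S * p + T * q = [:c:]" "c \<noteq> 0"
  shows "\<exists>S T. S * p + T * q = 1"
proof (intro exI)
  have "smult (1 / c) S * p + smult (1 / c) T * q = smult (1 / c) [:c:]"
    unfolding assms(1)[symmetric] by (simp add: smult_add_right)
  then show "smult (1 / c) S * p + smult (1 / c) T * q = 1"
    using assms(2) by (simp add: one_pCons)
qed

lemma curve_28_1:
  fixes h f :: "rat poly"
  assumes h: "h = [:0, 1, 1:]" and f: "f = [:4, -10, -4, 0, 5, 3, 1:]"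
  shows "genus_two_model h f \<and> (\<exists>Z \<in> jacobian_rational_points h f. group.ord (jacobian h f) Z = 28)"
proof -
  define F :: "rat poly" where "F = [:16, -40, -15, 2, 21, 12, 4:]"
  interpret hyperelliptic h f F
  proof
    show "F = 4 * f + h\<^sup>2" by (simp add: F_def h f numeral_poly power2_eq_square)
    show "degree F = 6" by (simp add: F_def)
    show "\<exists>S T. S * F + T * pderiv F = 1"
      unfolding F_def by (rule bezoutI[of "[:551466, -6609690, -11294172, -5714244,
        -1837224:]" _ "[:-3655868, -453441, 1676922, 2511651, 1105476,
        306204:]" _ "155058176"]) (simp_all add: pderiv_pCons)
  qed
  \<comment> \<open>The cubic v4 is - q a1 / b0 for the q, a1 and constant b0 = 7 used below: it
    makes q a1 + b0 Y vanish at the points of D4.\<close>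
  have D4: "mumford_divisor h f F 1 [:-4, 11, 6:] [:-36 / 7, 61 / 7, 57 / 7, 22 / 7:]"
  proof (unfold_locales)
    show "\<exists>S T. S * [:-4, 11, 6:] + T * pderiv [:-4, 11, 6:] = (1 :: rat poly)"
      by (rule bezoutI[of "[:-24:]" _ "[:11, 12:]" _ "217"]) (simp_all add: pderiv_pCons)
    show "[:-4, 11, 6:] dvd F - [:-36 / 7, 61 / 7, 57 / 7, 22 / 7:]\<^sup>2"
      by (rule dvdI[of _ _ "[:128 / 49, -256 / 49, -424 / 49, -232 / 49,
        -48 / 49:]"]) (simp add: F_def power2_eq_square)
    show "\<exists>S T. S * [:-4, 11, 6:] + T * [:-36 / 7, 61 / 7, 57 / 7,
      22 / 7:] = (1 :: rat poly)"
      by (rule bezoutI[of "[:2461, 2005, 638:]" _ "[:-2905,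
        -1218:]" _ "5096"]) (simp_all add: pderiv_pCons)
  qed simp_all
  \<comment> \<open>v7 is the representative of degree below 2 of - a7 / b7 modulo u7, where a7 + b7
    Y is the function with divisor 7 D7 below.\<close>
  have D7: "mumford_divisor h f F 1 [:-4, 1, 2:] [:-8, 2:]"
  proof (unfold_locales)
    show "\<exists>S T. S * [:-4, 1, 2:] + T * pderiv [:-4, 1, 2:] = (1 :: rat poly)"
      by (rule bezoutI[of "[:-8:]" _ "[:1, 4:]" _ "33"]) (simp_all add: pderiv_pCons)
    show "[:-4, 1, 2:] dvd F - [:-8, 2:]\<^sup>2"
      by (rule dvdI[of _ _ "[:12, 5, 12, 5, 2:]"]) (simp add: F_def power2_eq_square)
    show "\<exists>S T. S * [:-4, 1, 2:] + T * [:-8, 2:] = (1 :: rat poly)"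
      by (rule bezoutI[of "[:2:]" _ "[:-9, -2:]" _ "64"]) (simp_all add: pderiv_pCons)
  qed simp_all
  have "\<exists>Z \<in> jacobian_rational_points h f. group.ord (jacobian h f) Z = 28"
  proof (rule rational_point_of_order_28[OF D4 D7])
    show "F = [:4, 3, 1:] * [:4, -13, 5, 0, 4:]" by (simp add: F_def)
    show "([:4, 3, 1:] :: rat poly) * [:9, -22:]\<^sup>2 + [:4, -13, 5, 0, 4:] * [:7:]\<^sup>2 =
      [:520, -1978, 1074, 1056, 680:]"
      by (simp add: power2_eq_square)
    show "(2 :: rat poly) * [:9, -22:] * [:7:] = ([:126,
      -308:] :: rat poly)" by (simp add: numeral_poly)
    show "[:520, -1978, 1074, 1056, 680:]\<^sup>2 - [:126, -308:]\<^sup>2 * F = smult (64) ([:-4,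
      11, 6:] ^ 4)"
      by (simp add: F_def eval_nat_numeral)
    show "\<exists>S T. S * [:-4, 11, 6:] + T * ([:520, -1978, 1074, 1056, 680:] - [:126,
      -308:] * [:-36 / 7, 61 / 7, 57 / 7, 22 / 7:]) = (1 :: rat poly)"
      by (rule bezoutI[of "[:654116, -740604, -705616, -314768:]" _ "[:2467,
        1146:]" _ "264992"]) (simp_all add: pderiv_pCons)
    show "[:320, -688, 748, -617, 61, 62, 124, -8:]\<^sup>2 - [:48, -152, 115, -20,
      12:]\<^sup>2 * F = smult (-4) ([:-4, 1, 2:] ^ 7)"
      by (simp add: F_def eval_nat_numeral)
    show "\<exists>S T. S * [:-4, 1, 2:] + T * ([:320, -688, 748, -617, 61, 62, 124, -8:] - [:48,
      -152, 115, -20, 12:] * [:-8, 2:]) = (1 :: rat poly)"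
      by (rule bezoutI[of "[:113040, -523384, 206465, -161895, -71842, -46036, 3224:]" _ "[:1387,
        806:]" _ "524288"]) (simp_all add: pderiv_pCons)
  qed simp_all
  moreover have "genus_two_model h f" by (rule genus_two) (simp_all add: h f)
  ultimately show ?thesis by blast
qed

lemma curve_28_2:
  fixes h f :: "rat poly"
  assumes h: "h = [:0, 1, 1:]" and f: "f = [:0, 18, -6, 13, 3, 3, 1:]"
  shows "genus_two_model h f \<and> (\<exists>Z \<in> jacobian_rational_points h f. group.ord (jacobian h f) Z = 28)"
proof -
  define F :: "rat poly" where "F = [:0, 72, -23, 54, 13, 12, 4:]"
  interpret hyperelliptic h f F
  proof
    show "F = 4 * f + h\<^sup>2" by (simp add: F_def h f numeral_poly power2_eq_square)
    show "degree F = 6" by (simp add: F_def)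
    show "\<exists>S T. S * F + T * pderiv F = 1"
      unfolding F_def by (rule bezoutI[of "[:23132, -79866, -35168, -32628, -11496:]" _ "[:24696,
        -7354, 26991, 8261, 6396, 1916:]" _ "1778112"]) (simp_all add: pderiv_pCons)
  qed
  \<comment> \<open>Again v4 = - q a1 / b0, with b0 = 3.\<close>
  have D4: "mumford_divisor h f F 1 [:9, 5, 2:] [:24, 49 / 3, 23 / 3, 10 / 3:]"
  proof (unfold_locales)
    show "\<exists>S T. S * [:9, 5, 2:] + T * pderiv [:9, 5, 2:] = (1 :: rat poly)"
      by (rule bezoutI[of "[:8:]" _ "[:-5, -4:]" _ "47"]) (simp_all add: pderiv_pCons)
    show "[:9, 5, 2:] dvd F - [:24, 49 / 3, 23 / 3, 10 / 3:]\<^sup>2"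
      by (rule dvdI[of _ _ "[:-64, -392 / 9, -104 / 3, -32 / 3,
        -32 / 9:]"]) (simp add: F_def power2_eq_square)
    show "\<exists>S T. S * [:9, 5, 2:] + T * [:24, 49 / 3, 23 / 3, 10 / 3:] = (1 :: rat poly)"
      by (rule bezoutI[of "[:22, -67, 10:]" _ "[:39, -6:]" _ "1134"]) (simp_all add: pderiv_pCons)
  qed simp_all
  \<comment> \<open>Here, and for the third and fifth curves, - a7 / b7 is constant modulo
    u7.\<close>
  have D7: "mumford_divisor h f F 1 [:3, -1, 2:] [:6:]"
  proof (unfold_locales)
    show "\<exists>S T. S * [:3, -1, 2:] + T * pderiv [:3, -1, 2:] = (1 :: rat poly)"
      by (rule bezoutI[of "[:8:]" _ "[:1, -4:]" _ "23"]) (simp_all add: pderiv_pCons)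
    show "[:3, -1, 2:] dvd F - [:6:]\<^sup>2"
      by (rule dvdI[of _ _ "[:-12, 20, 7, 7, 2:]"]) (simp add: F_def power2_eq_square)
    show "\<exists>S T. S * [:3, -1, 2:] + T * [:6:] = (1 :: rat poly)"
      by (rule bezoutI[of "0" _ "[:1:]" _ "6"]) (simp_all add: pderiv_pCons)
  qed simp_all
  have "\<exists>Z \<in> jacobian_rational_points h f. group.ord (jacobian h f) Z = 28"
  proof (rule rational_point_of_order_28[OF D4 D7])
    show "F = [:8, 1, 2:] * [:0, 9, -4, 5, 2:]" by (simp add: F_def)
    show "([:8, 1, 2:] :: rat poly) * [:-9, -5:]\<^sup>2 + [:0, 9, -4, 5, 2:] * [:3:]\<^sup>2 =
      [:648, 882, 416, 250, 68:]"
      by (simp add: power2_eq_square)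
    show "(2 :: rat poly) * [:-9, -5:] * [:3:] = ([:-54,
      -30:] :: rat poly)" by (simp add: numeral_poly)
    show "[:648, 882, 416, 250, 68:]\<^sup>2 - [:-54, -30:]\<^sup>2 * F = smult (64) ([:9, 5,
      2:] ^ 4)"
      by (simp add: F_def eval_nat_numeral)
    show "\<exists>S T. S * [:9, 5, 2:] + T * ([:648, 882, 416, 250, 68:] - [:-54, -30:] * [:24,
      49 / 3, 23 / 3, 10 / 3:]) = (1 :: rat poly)"
      by (rule bezoutI[of "[:120744, 18732, 35124, 13944:]" _ "[:-181,
        -166:]" _ "734832"]) (simp_all add: pderiv_pCons)
    show "[:324, 63, -385, 1071, -707, 518, -84, 88:]\<^sup>2 - [:-63, 98, -63, 12,
      20:]\<^sup>2 * F = smult (48) ([:3, -1, 2:] ^ 7)"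
      by (simp add: F_def eval_nat_numeral)
    show "\<exists>S T. S * [:3, -1, 2:] + T * ([:324, 63, -385, 1071, -707, 518, -84, 88:] -
      [:-63, 98, -63, 12, 20:] * [:6:]) = (1 :: rat poly)"
      by (rule bezoutI[of "[:1566, -237, -955, 841, -243, 152, -44:]" _ "[:-3,
        1:]" _ "2592"]) (simp_all add: pderiv_pCons)
  qed simp_all
  moreover have "genus_two_model h f" by (rule genus_two) (simp_all add: h f)
  ultimately show ?thesis by blast
qed

lemma curve_28_3:
  fixes h f :: "rat poly"
  assumes h: "h = [:0, 1, 1:]" and f: "f = [:-11, 23, 13, 3, 18, -2, 4:]"
  shows "genus_two_model h f \<and> (\<exists>Z \<in> jacobian_rational_points h f. group.ord (jacobian h f) Z = 28)"
proof -
  define F :: "rat poly" where "F = [:-44, 92, 53, 14, 73, -8, 16:]"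
  interpret hyperelliptic h f F
  proof
    show "F = 4 * f + h\<^sup>2" by (simp add: F_def h f numeral_poly power2_eq_square)
    show "degree F = 6" by (simp add: F_def)
    show "\<exists>S T. S * F + T * pderiv F = 1"
      unfolding F_def by (rule bezoutI[of "[:-208156, 7398, -315204, 489048,
        -80928:]" _ "[:198708, -17252, -109069, 79371, -82632,
        13488:]" _ "27440000"]) (simp_all add: pderiv_pCons)
  qed
  \<comment> \<open>The only case with four points. Here b0 is not constant, and v4 represents - q
    a1 / b0 modulo the quartic u4.\<close>
  have D4: "mumford_divisor h f F 2 [:-3, 1, 1, 0, 1:] [:2, 7, 1, 4:]"
  proof (unfold_locales)
    show "\<exists>S T. S * [:-3, 1, 1, 0, 1:] + T * pderiv [:-3, 1, 1, 0, 1:] = (1 :: rat poly)"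
      by (rule bezoutI[of "[:-80, -16, -16:]" _ "[:5, 22, 4,
        4:]" _ "245"]) (simp_all add: pderiv_pCons)
    show "[:-3, 1, 1, 0, 1:] dvd F - [:2, 7, 1, 4:]\<^sup>2"
      by (rule dvdI[of _ _ "[:16, -16:]"]) (simp add: F_def power2_eq_square)
    show "\<exists>S T. S * [:-3, 1, 1, 0, 1:] + T * [:2, 7, 1, 4:] = (1 :: rat poly)"
      by (rule bezoutI[of "[:-184, -107, 4:]" _ "[:-31, 40, 27,
        -1:]" _ "490"]) (simp_all add: pderiv_pCons)
  qed simp_all
  have D7: "mumford_divisor h f F 1 [:3, -1, 1:] [:5:]"
  proof (unfold_locales)
    show "\<exists>S T. S * [:3, -1, 1:] + T * pderiv [:3, -1, 1:] = (1 :: rat poly)"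
      by (rule bezoutI[of "[:4:]" _ "[:1, -2:]" _ "11"]) (simp_all add: pderiv_pCons)
    show "[:3, -1, 1:] dvd F - [:5:]\<^sup>2"
      by (rule dvdI[of _ _ "[:-23, 23, 33, 8, 16:]"]) (simp add: F_def power2_eq_square)
    show "\<exists>S T. S * [:3, -1, 1:] + T * [:5:] = (1 :: rat poly)"
      by (rule bezoutI[of "0" _ "[:1:]" _ "5"]) (simp_all add: pderiv_pCons)
  qed simp_all
  have "\<exists>Z \<in> jacobian_rational_points h f. group.ord (jacobian h f) Z = 28"
  proof (rule rational_point_of_order_28[OF D4 D7])
    show "F = [:11, -1, 4:] * [:-4, 8, 7, -1, 4:]" by (simp add: F_def)
    show "([:11, -1, 4:] :: rat poly) * [:4, 4, 1, 5:]\<^sup>2 + [:-4, 8, 7, -1, 4:] * [:-10, -1,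
      -3:]\<^sup>2 = [:-224, 1056, 912, 1136, 1318, 394, 730, 30, 136:]"
      by (simp add: power2_eq_square)
    show "(2 :: rat poly) * [:4, 4, 1, 5:] * [:-10, -1, -3:] = ([:-80, -88, -52, -126, -16,
      -30:] :: rat poly)" by (simp add: numeral_poly)
    show "[:-224, 1056, 912, 1136, 1318, 394, 730, 30, 136:]\<^sup>2 - [:-80, -88, -52, -126, -16,
      -30:]\<^sup>2 * F = smult (4096) ([:-3, 1, 1, 0, 1:] ^ 4)"
      by (simp add: F_def eval_nat_numeral)
    show "\<exists>S T. S * [:-3, 1, 1, 0, 1:] + T * ([:-224, 1056, 912, 1136, 1318, 394, 730, 30,
      136:] - [:-80, -88, -52, -126, -16, -30:] * [:2, 7, 1, 4:]) = (1 :: rat poly)"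
      by (rule bezoutI[of "[:-629408, -509792, -797200, -537600, -733588, -320016, -191932,
        -61696:]" _ "[:-509, -190, 633, 241:]" _ "1920800"]) (simp_all add: pderiv_pCons)
    show "[:848, 4704, -2912, 6748, -2821, 2758, -581, 324:]\<^sup>2 - [:488, -284, 434, -115,
      79:]\<^sup>2 * F = smult (5120) ([:3, -1, 1:] ^ 7)"
      by (simp add: F_def eval_nat_numeral)
    show "\<exists>S T. S * [:3, -1, 1:] + T * ([:848, 4704, -2912, 6748, -2821, 2758, -581,
      324:] - [:488, -284, 434, -115, 79:] * [:5:]) = (1 :: rat poly)"
      by (rule bezoutI[of "[:1478, -5182, 7292, -5806, 5101, -1419, 972:]" _ "[:2,
        -3:]" _ "1250"]) (simp_all add: pderiv_pCons)
  qed simp_all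
  moreover have "genus_two_model h f" by (rule genus_two) (simp_all add: h f)
  ultimately show ?thesis by blast
qed

lemma curve_28_4:
  fixes h f :: "rat poly"
  assumes h: "h = [:0, 1, 1:]" and f: "f = [:40064896, -155174208, 154134546, -35302844,
    213557586, 167100960, 28320768:]"
  shows "genus_two_model h f \<and> (\<exists>Z \<in> jacobian_rational_points h f. group.ord (jacobian h f) Z = 28)"
proof -
  define F :: "rat poly" where "F = [:160259584, -620696832, 616538185, -141211374, 854230345,
    668403840, 113283072:]"
  interpret hyperelliptic h f F
  proof
    show "F = 4 * f + h\<^sup>2" by (simp add: F_def h f numeral_poly power2_eq_square)
    show "degree F = 6" by (simp add: F_def)
    show "\<exists>S T. S * F + T * pderiv F = 1"
      unfolding F_def by (rule bezoutI[of "[:115189278023175078, 107812185982264094,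
        308199869101106084, 209908754132032128, 35037023710961664:]" _ "[:20202788515297664,
        -47218064015159635, -21411710095839740, -72212790297237929, -40727260899235968,
        -5839503951826944:]" _ "5920378948243136777647104"]) (simp_all add: pderiv_pCons)
  qed
  \<comment> \<open>v4 = - q a1 / b0 with b0 = 253.\<close>
  have D4: "mumford_divisor h f F 1 [:-15076, 34363, 12156:] [:10451712 / 253, -45634489 / 253,
    49519639 / 253, 20144832 / 253:]"
  proof (unfold_locales)
    show "\<exists>S T. S * [:-15076, 34363, 12156:] + T * pderiv [:-15076, 34363,
      12156:] = (1 :: rat poly)"
      by (rule bezoutI[of "[:-48624:]" _ "[:34363,
        24312:]" _ "1913871193"]) (simp_all add: pderiv_pCons)
    show "[:-15076, 34363, 12156:] dvd F - [:10451712 / 253, -45634489 / 253, 49519639 / 253,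
      20144832 / 253:]\<^sup>2"
      by (rule dvdI[of _ _ "[:6565417088 / 64009, -45673883104 / 64009, 105365492768 / 64009,
        -67923147648 / 64009, -32787357696 / 64009:]"]) (simp add: F_def power2_eq_square)
    show "\<exists>S T. S * [:-15076, 34363, 12156:] + T * [:10451712 / 253, -45634489 / 253,
      49519639 / 253, 20144832 / 253:] = (1 :: rat poly)"
      by (rule bezoutI[of "[:16384766709, -61485890903, 52839894336:]" _ "[:6413006303,
        -8066952564:]" _ "17911695566028"]) (simp_all add: pderiv_pCons)
  qed simp_all
  have D7: "mumford_divisor h f F 1 [:-70, 993, 756:] [:-2119931 / 162, 23319241 / 756:]"
  proof (unfold_locales)
    show "\<exists>S T. S * [:-70, 993, 756:] + T * pderiv [:-70, 993, 756:] = (1 :: rat poly)"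
      by (rule bezoutI[of "[:-1008:]" _ "[:331, 504:]" _ "399243"]) (simp_all add: pderiv_pCons)
    show "[:-70, 993, 756:] dvd F - [:-2119931 / 162, 23319241 / 756:]\<^sup>2"
      by (rule dvdI[of _ _ "[:57650984453 / 367416, -753981104419 / 1714608, 1639973617 / 6804,
        18557408 / 27, 449536 / 3:]"]) (simp add: F_def power2_eq_square)
    show "\<exists>S T. S * [:-70, 993, 756:] + T * [:-2119931 / 162,
      23319241 / 756:] = (1 :: rat poly)"
      by (rule bezoutI[of "[:256511651:]" _ "[:-10924956,
        -6286896:]" _ "125008091208"]) (simp_all add: pderiv_pCons)
  qed simp_all
  have "\<exists>Z \<in> jacobian_rational_points h f. group.ord (jacobian h f) Z = 28"
  proof (rule rational_point_of_order_28[OF D4 D7])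
    show "F = [:31, -145, 192:] * [:5169664, 4158208, 7319447, 3926855,
      590016:]" by (simp add: F_def)
    show "([:31, -145, 192:] :: rat poly) * [:-337152, -104921:]\<^sup>2 + [:5169664, 4158208,
      7319447, 3926855, 590016:] * [:253:]\<^sup>2 = [:3854720627200, -14022992424704,
      12376139590782, 12238874503678, 2151382252416:]"
      by (simp add: power2_eq_square)
    show "(2 :: rat poly) * [:-337152, -104921:] * [:253:] = ([:-170598912,
      -53090026:] :: rat poly)" by (simp add: numeral_poly)
    show "[:3854720627200, -14022992424704, 12376139590782, 12238874503678,
      2151382252416:]\<^sup>2 - [:-170598912,
      -53090026:]\<^sup>2 * F = smult (197346304) ([:-15076, 34363, 12156:] ^ 4)"
      by (simp add: F_def eval_nat_numeral)
    show "\<exists>S T. S * [:-15076, 34363, 12156:] + T * ([:3854720627200, -14022992424704,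
      12376139590782, 12238874503678, 2151382252416:] - [:-170598912, -53090026:] *
      [:10451712 / 253, -45634489 / 253, 49519639 / 253, 20144832 / 253:]) = (1 :: rat poly)"
      by (rule bezoutI[of "[:4507188884468946644656, -19013984616693343418236,
        20877544275960663721204, 8471343293368577928960:]" _ "[:6232803954271,
        -16144204311156:]" _ "1842009826710284818752"]) (simp_all add: pderiv_pCons)
    show "[:56618185639168, -294408668913875, 602439370161740, -712700634641848, 727049843009364,
      -358639648911306, 127016603642313, 102676620465216:]\<^sup>2 - [:4472434031, -14595163531,
      19107598419, -17038309743, 9545359005:]\<^sup>2 * F = smult (1564596) ([:-70, 993, 756:] ^ 7)"
      by (simp add: F_def eval_nat_numeral)
    show "\<exists>S T. S * [:-70, 993, 756:] + T * ([:56618185639168, -294408668913875,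
      602439370161740, -712700634641848, 727049843009364, -358639648911306, 127016603642313,
      102676620465216:] - [:4472434031, -14595163531, 19107598419, -17038309743, 9545359005:] *
      [:-2119931 / 162, 23319241 / 756:]) = (1 :: rat poly)"
      by (rule bezoutI[of "[:192964074174326712083621, -463788487073924223607285,
        560940039432178441846461, -525489474355286094389169, 254567259167048476505451,
        -53215591373962574128236, -40577775354757969687296:]" _ "[:414659521836,
        298771015536:]" _ "34238248994662061940326736"]) (simp_all add: pderiv_pCons)
  qed simp_all
  moreover have "genus_two_model h f" by (rule genus_two) (simp_all add: h f)
  ultimately show ?thesis by blast
qed

lemma curve_28_5:
  fixes h f :: "rat poly"
  assumes h: "h = [:0, 1, 1:]" and f: "f = [:0, -1210, 570, 2494, 1675, -455, 25:]"
  shows "genus_two_model h f \<and> (\<exists>Z \<in> jacobian_rational_points h f. group.ord (jacobian h f) Z = 28)"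
proof -
  define F :: "rat poly" where "F = [:0, -4840, 2281, 9978, 6701, -1820, 100:]"
  interpret hyperelliptic h f F
  proof
    show "F = 4 * f + h\<^sup>2" by (simp add: F_def h f numeral_poly power2_eq_square)
    show "degree F = 6" by (simp add: F_def)
    show "\<exists>S T. S * F + T * pderiv F = 1"
      unfolding F_def by (rule bezoutI[of "[:-6127217699660, -31302591879018, -24644042827824,
        8615853015900, -572035584600:]" _ "[:-3392134352200, 2929920816450, 10197212848639,
        6206558380611, -1725171270420,
        95339264100:]" _ "16417930264648000"]) (simp_all add: pderiv_pCons)
  qed
  \<comment> \<open>v4 = - q a1 / b0 with b0 = 451 = 11 * 41; in the constant term - 4840 / 451 the
    factor 11 cancels.\<close>
  have D4: "mumford_divisor h f F 1 [:-121, -1519, 390:] [:-440 / 41, 45841 / 451, -74191 / 451,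
    9010 / 451:]"
  proof (unfold_locales)
    show "\<exists>S T. S * [:-121, -1519, 390:] + T * pderiv [:-121, -1519,
      390:] = (1 :: rat poly)"
      by (rule bezoutI[of "[:-1560:]" _ "[:-1519, 780:]" _ "2496121"]) (simp_all add: pderiv_pCons)
    show "[:-121, -1519, 390:] dvd F - [:-440 / 41, 45841 / 451, -74191 / 451, 9010 / 451:]\<^sup>2"
      by (rule dvdI[of _ _ "[:1600 / 1681, 2038360 / 203401, -5497160 / 203401, 1871200 / 203401,
        -156000 / 203401:]"]) (simp add: F_def power2_eq_square)
    show "\<exists>S T. S * [:-121, -1519, 390:] + T * [:-440 / 41, 45841 / 451, -74191 / 451,
      9010 / 451:] = (1 :: rat poly)"
      by (rule bezoutI[of "[:-40673190, 55917359, -6658390:]" _ "[:-527548681,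
        129982710:]" _ "10582954030"]) (simp_all add: pderiv_pCons)
  qed simp_all
  have D7: "mumford_divisor h f F 1 [:11, 9, 10:] [:110:]"
  proof (unfold_locales)
    show "\<exists>S T. S * [:11, 9, 10:] + T * pderiv [:11, 9, 10:] = (1 :: rat poly)"
      by (rule bezoutI[of "[:40:]" _ "[:-9, -20:]" _ "359"]) (simp_all add: pderiv_pCons)
    show "[:11, 9, 10:] dvd F - [:110:]\<^sup>2"
      by (rule dvdI[of _ _ "[:-1100, 460, 831, -191, 10:]"]) (simp add: F_def power2_eq_square)
    show "\<exists>S T. S * [:11, 9, 10:] + T * [:110:] = (1 :: rat poly)"
      by (rule bezoutI[of "0" _ "[:1:]" _ "110"]) (simp_all add: pderiv_pCons)
  qed simp_all
  have "\<exists>Z \<in> jacobian_rational_points h f. group.ord (jacobian h f) Z = 28"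
  proof (rule rational_point_of_order_28[OF D4 D7])
    show "F = [:40, -81, 10:] * [:0, -121, -188, -101, 10:]" by (simp add: F_def)
    show "([:40, -81, 10:] :: rat poly) * [:121, -901:]\<^sup>2 + [:0, -121, -188, -101, 10:] *
      [:451:]\<^sup>2 = [:585640, -34519122, 12040464, -88479802, 10152020:]"
      by (simp add: power2_eq_square)
    show "(2 :: rat poly) * [:121, -901:] * [:451:] = ([:109142,
      -812702:] :: rat poly)" by (simp add: numeral_poly)
    show "[:585640, -34519122, 12040464, -88479802, 10152020:]\<^sup>2 - [:109142,
      -812702:]\<^sup>2 * F = smult (1600) ([:-121, -1519, 390:] ^ 4)"
      by (simp add: F_def eval_nat_numeral)
    show "\<exists>S T. S * [:-121, -1519, 390:] + T * ([:585640, -34519122, 12040464, -88479802,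
      10152020:] - [:109142, -812702:] * [:-440 / 41, 45841 / 451, -74191 / 451,
      9010 / 451:]) = (1 :: rat poly)"
      by (rule bezoutI[of "[:-1643986949692120, 3224130939574724, -5624453204127084,
        655874232827240:]" _ "[:38466766049,
        -9693442590:]" _ "266505451519555600"]) (simp_all add: pderiv_pCons)
    show "[:292820, -3575671, -5797137, 10149377, 30493341, 25279970, 6260300,
      -1011000:]\<^sup>2 - [:-23111, 28702, 200089, 246020,
      98900:]\<^sup>2 * F = smult (4400) ([:11, 9, 10:] ^ 7)"
      by (simp add: F_def eval_nat_numeral)
    show "\<exists>S T. S * [:11, 9, 10:] + T * ([:292820, -3575671, -5797137, 10149377, 30493341,
      25279970, 6260300, -1011000:] - [:-23111, 28702, 200089, 246020, 98900:] *
      [:110:]) = (1 :: rat poly)"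
      by (rule bezoutI[of "[:29455030, -28512891, -36764227, 16336687, 25832221, 5341080,
        -909900:]" _ "[:-11, -9:]" _ "292820000"]) (simp_all add: pderiv_pCons)
  qed simp_all
  moreover have "genus_two_model h f" by (rule genus_two) (simp_all add: h f)
  ultimately show ?thesis by blast
qed

theorem theorem2p1:
  fixes h :: "rat poly"
  assumes "h = [:0, 1, 1:]"
  shows "\<forall>f \<in> {
       [:4, -10, -4, 0, 5, 3, 1:],
       [:0, 18, -6, 13, 3, 3, 1:],
       [:-11, 23, 13, 3, 18, -2, 4:],
       [:40064896, -155174208, 154134546, -35302844, 213557586, 167100960, 28320768:],
       [:0, -1210, 570, 2494, 1675, -455, 25:]}.
     genus_two_model h f \<and>
     (\<exists>P \<in> jacobian_rational_points h f. group.ord (jacobian h f) P = 28)"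
  using curve_28_1[OF assms refl] curve_28_2[OF assms refl] curve_28_3[OF assms refl]
    curve_28_4[OF assms refl] curve_28_5[OF assms refl]
  by simp

end
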